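(* Let $M\subset[0,1)$ be measurable with $M\cap s(M)=\emptyset$ and $M\cup s(M)=[0,1)$ up to null sets, let $m_0=\operatorname{Per}(\chi_M)$, and let $\tilde X(m_0)$, $\lambda$, $\tilde r$, $\tilde U$, $\tilde T$, $\tilde F$ be as in the context. Then: (1) $\tilde T$ and $\tilde U$ are unitary on $L^2(\tilde X(m_0),\lambda)$ and $\tilde U\tilde T\tilde U^{-1}=\tilde T^2$. (2) An orthogonal projection $P$ on $L^2(\tilde X(m_0))$ commutes with $\tilde U$ and $\tilde T$ if and only if $Pf=\chi_Sf$ for some measurable $S\subset[0,1)\times\Omega$ with $\tilde r(S)=S$. (3) With $\tilde\varphi=\chi_{\tilde F}$: $\langle\tilde T^k\tilde\varphi,\tilde\varphi\rangle=\delta_{k,0}$ for $k\in\mathbb{Z}$, and $\tilde U\tilde\varphi(x,\omega)=\sqrt2\,m_0(x)\tilde\varphi(x,\omega)$. (4) If $\tilde V_0=\overline{\operatorname{span}}\{\tilde T^k\tilde\varphi\mid k\in\mathbb{Z}\}$ and $\tilde V_n=\tilde U^{-n}\tilde V_0$ ($n\in\mathbb{Z}$), then $(\tilde V_n)$ is a multiresolution analysis for $L^2(\tilde X(m_0))$: $\tilde V_n\subset\tilde V_{n+1}$, $\bigcup_n\tilde V_n$ is dense, $\bigcap_n\tilde V_n=\{0\}$, and $\{\tilde T^k\tilde\varphi\}_{k}$ is an orthonormal basis of $\tilde V_0$. (5) The function $\tilde\psi:=\tilde U^{-1}(\sqrt2(1-m_0)\tilde\varphi)$ equals $\chi_{\tilde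 P}$ with $\tilde P=\tilde r(\tilde F)\setminus\tilde F$, and $\tilde\psi$ is an orthonormal wavelet for $\{\tilde U,\tilde T\}$ on $L^2(\tilde X(m_0))$, i.e. $\{\tilde U^j\tilde T^k\tilde\psi\mid j,k\in\mathbb{Z}\}$ is an orthonormal basis. (6) Suppose now that $\psi\in L^2(\mathbb{R})$ is an MRA Parseval wavelet set, $\hat\psi=\chi_P$, with $\hat\varphi=\chi_F$, $F=\bigcup_{j\ge1}2^{-j}P$, and that $M$ is such that $m_0$ satisfies $\hat\varphi(2x)=m_0(x)\hat\varphi(x)$, $\hat\varphi(x)=\prod_{n\ge1}m_0(x/2^n)$ and $\hat\psi(2x)=(1-m_0(x))\hat\varphi(x)$ for a.e. $x\in\mathbb{R}$, and $\bigcup_{n\ge1}2^nF=\mathbb{R}$ up to a null set. Then $A_{\mathbb{Z}}\subset A(x)$ for a.e. $x\in[0,1)$, so $[0,1)\times A_{\mathbb{Z}}$ is an $\tilde r$-invariant subset of $\tilde X(m_0)$, and with $P_{\mathbb{R}}$ the projection of multiplication by $\chi_{[0,1)\times A_{\mathbb{Z}}}$ one has $P_{\mathbb{R}}\tilde\varphi=\mathcal E\hat\varphi$ and $P_{\mathbb{R}}\tilde\psi=\mathcal E\hat\psi$, where $\mathcal Ef(x,\omega)=f(x+d_{\mathbb{Z}}(\omega))$.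
   Context: Notation on $[0,1)$: $\tau_0(x)=x/2$, $\tau_1(x)=(x+1)/2$, $r(x)=2x\bmod1$, $s(x)=(x+\frac12)\bmod1$, and $\omega_x\in\{0,1\}$ is the digit with $\tau_{\omega_x}(r(x))=x$. $\operatorname{Per}(\chi_M)(x)=\sum_{k\in\mathbb{Z}}\chi_M(x+k)$. $\Omega=\{0,1\}^{\mathbb{N}}$ is the set of infinite words $\omega=\omega_1\omega_2\cdots$. Chosen path: for (a.e.) $x\in[0,1)$ exactly one of $\tau_0x,\tau_1x$ lies in $M$; let $\omega_1$ be the digit with $\tau_{\omega_1}x\in M$ and inductively $\omega_{n+1}$ the unique digit with $\tau_{\omega_{n+1}}\tau_{\omega_n}\cdots\tau_{\omega_1}x\in M$; $\omega(x):=\omega_1\omega_2\cdots$. Let $A(x)=\{\eta_1\cdots\eta_n\,\omega(\tau_{\eta_n}\cdots\tau_{\eta_1}x)\mid n\ge0,\ \eta_i\in\{0,1\}\}$, $\tilde X(m_0)=\{(x,\omega)\mid x\in[0,1),\ \omega\in A(x)\}$, and $\lambda$ the measure with $\int f\,d\lambda=\int_0^1\sum_{\omega\in A(x)}f(x,\omega)\,dx$. $\tilde r(x,\omega_1\omega_2\cdots)=(r(x),\omega_x\omega_1\omega_2\cdots)$. On $L^2(\tilde X(m_0),\lambda)$: $\tilde Tf(x,\omega)=e^{2\pi ix}f(x,\omega)$, $\tilde Uf(x,\omega)=\sqrt2 f(\tilde r(x,\omega))$. $\tilde F=\{(x,\omega(x))\mid x\in[0,1)\}$. Fourier transform $\hat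 f(x)=\int f(t)e^{-2\pi itx}dt$. An MRA Parseval wavelet set is $\psi\in L^2(\mathbb{R})$ such that $\{2^{j/2}\psi(2^j\cdot-k)\}_{j,k\in\mathbb{Z}}$ is a Parseval frame for $L^2(\mathbb{R})$, $\hat\psi=\chi_P$, and $F=\bigcup_{j\ge1}2^{-j}P$ is translation simple ($F\cap(F+k)$ null for $k\ne0$). $A_{\mathbb{Z}}$ is the set of words of the form $\omega_1\cdots\omega_n000\cdots$ or $\omega_1\cdots\omega_n111\cdots$ ($n\ge0$), and $d_{\mathbb{Z}}(\omega_1\cdots\omega_n000\cdots)=\sum_{k=1}^n\omega_k2^{k-1}$, $d_{\mathbb{Z}}(\omega_1\cdots\omega_n111\cdots)=\sum_{k=1}^n\omega_k2^{k-1}-2^n$. *)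

theory Defs
  imports "HOL-Analysis.Analysis"
begin

text \<open>Binary digits are booleans: False = 0, True = 1.
  Infinite words omega = omega_1 omega_2 ... are functions nat => bool with
  omega_1 stored at index 0.\<close>

type_synonym word = "nat \<Rightarrow> bool"
type_synonym pt = "real \<times> word"

definition dig :: "bool \<Rightarrow> real" where
  "dig b = (if b then 1 else 0)"

definition tau :: "bool \<Rightarrow> real \<Rightarrow> real" where
  "tau b x = (x + dig b) / 2"

definition rr :: "real \<Rightarrow> real" where
  "rr x = frac (2 * x)"

definition ss :: "real \<Rightarrow> real" where
  "ss x = frac (x + 1/2)"

text \<open>omega_x: the digit with tau omega_x (r x) = x (for x in [0,1)).\<close>
definition digit_of :: "real \<Rightarrow> bool" where
  "digit_of x = (x \<ge> 1/2)"

definition Per :: "real set \<Rightarrow> real \<Rightarrow> real" where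
  "Per M x = (\<Sum>\<^sub>\<infinity>k::int. indicator M (x + of_int k))"

text \<open>The digit chosen at a point y: the digit d with tau d y in M
  (convention on the null set where this is not unique: 1 iff tau 0 y is not in M).\<close>
definition choose_dig :: "real set \<Rightarrow> real \<Rightarrow> bool" where
  "choose_dig M y = (tau False y \<notin> M)"

definition path_pt :: "real set \<Rightarrow> real \<Rightarrow> nat \<Rightarrow> real" where
  "path_pt M x n = ((\<lambda>y. tau (choose_dig M y) y) ^^ n) x"

definition chosen :: "real set \<Rightarrow> real \<Rightarrow> word" where
  "chosen M x n = choose_dig M (path_pt M x n)"

definition tau_list :: "bool list \<Rightarrow> real \<Rightarrow> real" where
  "tau_list eta x = foldl (\<lambda>y b. tau b y) x eta"

definition prepend :: "bool list \<Rightarrow> word \<Rightarrow> word" where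
  "prepend eta w n = (if n < length eta then eta ! n else w (n - length eta))"

definition Aset :: "real set \<Rightarrow> real \<Rightarrow> word set" where
  "Aset M x = {prepend eta (chosen M (tau_list eta x)) | eta. True}"

definition Xt :: "real set \<Rightarrow> pt set" where
  "Xt M = {(x, w). x \<in> {0..<1} \<and> w \<in> Aset M x}"

definition Omega_M :: "word measure" where
  "Omega_M = Pi\<^sub>M UNIV (\<lambda>_. count_space UNIV)"

text \<open>lambda(S) = integral over [0,1) of the number of omega in A(x) with (x,omega) in S;
  a measure on real x word, concentrated on Xt M, with the product sigma algebra
  (Lebesgue on the real factor, product sigma algebra on Omega).\<close>
definition lam :: "real set \<Rightarrow> pt measure" where
  "lam M = measure_of UNIV (sets (lebesgue \<Otimes>\<^sub>M Omega_M))
     (\<lambda>S. \<integral>\<^sup>+ x. indicator {0..<1} x *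
            (\<integral>\<^sup>+ w. indicator (Aset M x) w * indicator S (x, w) \<partial>count_space UNIV) \<partial>lebesgue)"

definition rt :: "pt \<Rightarrow> pt" where
  "rt p = (rr (fst p), case_nat (digit_of (fst p)) (snd p))"

definition Tt :: "(pt \<Rightarrow> complex) \<Rightarrow> pt \<Rightarrow> complex" where
  "Tt f p = exp (2 * pi * \<i> * complex_of_real (fst p)) * f p"

definition Ut :: "(pt \<Rightarrow> complex) \<Rightarrow> pt \<Rightarrow> complex" where
  "Ut f p = complex_of_real (sqrt 2) * f (rt p)"

definition Ft :: "real set \<Rightarrow> pt set" where
  "Ft M = {(x, chosen M x) | x. x \<in> {0..<1}}"

definition L2 :: "'a measure \<Rightarrow> ('a \<Rightarrow> complex) set" where
  "L2 \<mu> = {f. f \<in> borel_measurable \<mu> \<and> integrable \<mu> (\<lambda>x. (norm (f x))\<^sup>2)}"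

definition l2_inner :: "'a measure \<Rightarrow> ('a \<Rightarrow> complex) \<Rightarrow> ('a \<Rightarrow> complex) \<Rightarrow> complex" where
  "l2_inner \<mu> f g = (\<integral> x. f x * cnj (g x) \<partial>\<mu>)"

definition l2_norm :: "'a measure \<Rightarrow> ('a \<Rightarrow> complex) \<Rightarrow> real" where
  "l2_norm \<mu> f = sqrt (\<integral> x. (norm (f x))\<^sup>2 \<partial>\<mu>)"

definition l2_operator :: "'a measure \<Rightarrow> (('a \<Rightarrow> complex) \<Rightarrow> ('a \<Rightarrow> complex)) \<Rightarrow> bool" where
  "l2_operator \<mu> A \<longleftrightarrow>
     (\<forall>f\<in>L2 \<mu>. A f \<in> L2 \<mu>) \<and>
     (\<forall>f\<in>L2 \<mu>. \<forall>g\<in>L2 \<mu>. (AE x in \<mu>. f x = g x) \<longrightarrow> (AE x in \<mu>. A f x = A g x)) \<and>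
     (\<forall>f\<in>L2 \<mu>. \<forall>g\<in>L2 \<mu>. \<forall>c. AE x in \<mu>. A (\<lambda>y. c * f y + g y) x = c * A f x + A g x)"

definition l2_unitary :: "'a measure \<Rightarrow> (('a \<Rightarrow> complex) \<Rightarrow> ('a \<Rightarrow> complex)) \<Rightarrow> bool" where
  "l2_unitary \<mu> A \<longleftrightarrow> l2_operator \<mu> A \<and>
     (\<forall>f\<in>L2 \<mu>. \<forall>g\<in>L2 \<mu>. l2_inner \<mu> (A f) (A g) = l2_inner \<mu> f g) \<and>
     (\<forall>g\<in>L2 \<mu>. \<exists>f\<in>L2 \<mu>. AE x in \<mu>. A f x = g x)"

definition l2_inv :: "'a measure \<Rightarrow> (('a \<Rightarrow> complex) \<Rightarrow> ('a \<Rightarrow> complex)) \<Rightarrow> ('a \<Rightarrow> complex) \<Rightarrow> ('a \<Rightarrow> complex)" where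
  "l2_inv \<mu> A g = (SOME f. f \<in> L2 \<mu> \<and> (AE x in \<mu>. A f x = g x))"

definition l2_zpow :: "'a measure \<Rightarrow> (('a \<Rightarrow> complex) \<Rightarrow> ('a \<Rightarrow> complex)) \<Rightarrow> int \<Rightarrow> ('a \<Rightarrow> complex) \<Rightarrow> ('a \<Rightarrow> complex)" where
  "l2_zpow \<mu> A j = (if j \<ge> 0 then A ^^ nat j else l2_inv \<mu> A ^^ nat (- j))"

definition l2_orth_proj :: "'a measure \<Rightarrow> (('a \<Rightarrow> complex) \<Rightarrow> ('a \<Rightarrow> complex)) \<Rightarrow> bool" where
  "l2_orth_proj \<mu> P \<longleftrightarrow> l2_operator \<mu> P \<and>
     (\<forall>f\<in>L2 \<mu>. AE x in \<mu>. P (P f) x = P f x) \<and>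
     (\<forall>f\<in>L2 \<mu>. \<forall>g\<in>L2 \<mu>. l2_inner \<mu> (P f) g = l2_inner \<mu> f (P g))"

definition l2_commute :: "'a measure \<Rightarrow> (('a \<Rightarrow> complex) \<Rightarrow> ('a \<Rightarrow> complex)) \<Rightarrow> (('a \<Rightarrow> complex) \<Rightarrow> ('a \<Rightarrow> complex)) \<Rightarrow> bool" where
  "l2_commute \<mu> A B \<longleftrightarrow> (\<forall>f\<in>L2 \<mu>. AE x in \<mu>. A (B f) x = B (A f) x)"

definition l2_cspan :: "'a measure \<Rightarrow> ('a \<Rightarrow> complex) set \<Rightarrow> ('a \<Rightarrow> complex) set" where
  "l2_cspan \<mu> E = {f \<in> L2 \<mu>. \<forall>\<epsilon>>0. \<exists>K c. finite K \<and> K \<subseteq> E \<and>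
       l2_norm \<mu> (\<lambda>x. f x - (\<Sum>e\<in>K. c e * e x)) < \<epsilon>}"

definition l2_orthonormal :: "'a measure \<Rightarrow> ('i \<Rightarrow> 'a \<Rightarrow> complex) \<Rightarrow> bool" where
  "l2_orthonormal \<mu> e \<longleftrightarrow> (\<forall>i. e i \<in> L2 \<mu>) \<and>
     (\<forall>i j. l2_inner \<mu> (e i) (e j) = (if i = j then 1 else 0))"

text \<open>Orthonormal basis of a closed subspace V (V closed under a.e. equality).\<close>
definition l2_onb_of :: "'a measure \<Rightarrow> ('i \<Rightarrow> 'a \<Rightarrow> complex) \<Rightarrow> ('a \<Rightarrow> complex) set \<Rightarrow> bool" where
  "l2_onb_of \<mu> e V \<longleftrightarrow> l2_orthonormal \<mu> e \<and> l2_cspan \<mu> (range e) = V"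

definition m0 :: "real set \<Rightarrow> real \<Rightarrow> real" where
  "m0 M = Per M"

definition phit :: "real set \<Rightarrow> pt \<Rightarrow> complex" where
  "phit M = indicator (Ft M)"

definition V0 :: "real set \<Rightarrow> (pt \<Rightarrow> complex) set" where
  "V0 M = l2_cspan (lam M) (range (\<lambda>k. l2_zpow (lam M) Tt k (phit M)))"

text \<open>V_n = U^{-n} V_0 (as a set of L^2 classes, i.e. closed under a.e. equality)\<close>
definition Vn :: "real set \<Rightarrow> int \<Rightarrow> (pt \<Rightarrow> complex) set" where
  "Vn M n = {f \<in> L2 (lam M). \<exists>g\<in>V0 M. AE p in lam M. f p = l2_zpow (lam M) Ut (- n) g p}"

definition psit :: "real set \<Rightarrow> pt \<Rightarrow> complex" where
  "psit M = l2_inv (lam M) Ut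
      (\<lambda>p. complex_of_real (sqrt 2 * (1 - m0 M (fst p))) * phit M p)"

definition Pt :: "real set \<Rightarrow> pt set" where
  "Pt M = rt ` Ft M - Ft M"

definition AZ :: "word set" where
  "AZ = {w. \<exists>n. \<forall>m\<ge>n. w m = w n}"

text \<open>d_Z(omega_1...omega_n 000...) = sum omega_k 2^(k-1),
  d_Z(omega_1...omega_n 111...) = sum omega_k 2^(k-1) - 2^n (independent of the choice of n).\<close>
definition dZ :: "word \<Rightarrow> int" where
  "dZ w = (let n = (LEAST n. \<forall>m\<ge>n. w m = w n) in
     (\<Sum>k<n. (if w k then 2 ^ k else 0)) - (if w n then 2 ^ n else 0))"

definition Emb :: "(real \<Rightarrow> complex) \<Rightarrow> pt \<Rightarrow> complex" where
  "Emb f p = (if snd p \<in> AZ then f (fst p + of_int (dZ (snd p))) else 0)"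

text \<open>Inverse Fourier transform of the indicator of a set of finite measure
  (the function psi with psi-hat = chi_P, with hat f(x) = integral f(t) e^{-2 pi i t x} dt).\<close>
definition inv_fourier_ind :: "real set \<Rightarrow> real \<Rightarrow> complex" where
  "inv_fourier_ind P t = (\<integral> x. indicator P x * exp (2 * pi * \<i> * complex_of_real (t * x)) \<partial>lebesgue)"

definition parseval_frame :: "'a measure \<Rightarrow> ('i \<Rightarrow> 'a \<Rightarrow> complex) \<Rightarrow> bool" where
  "parseval_frame \<mu> e \<longleftrightarrow> (\<forall>i. e i \<in> L2 \<mu>) \<and>
     (\<forall>f\<in>L2 \<mu>. ((\<lambda>i. (norm (l2_inner \<mu> f (e i)))\<^sup>2) has_sum (l2_norm \<mu> f)\<^sup>2) UNIV)"

definition MRA_parseval_wavelet_set :: "real set \<Rightarrow> (real \<Rightarrow> complex) \<Rightarrow> bool" where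
  "MRA_parseval_wavelet_set P psi \<longleftrightarrow>
     P \<in> sets lebesgue \<and> emeasure lebesgue P < \<infinity> \<and> psi = inv_fourier_ind P \<and>
     parseval_frame lebesgue
       (\<lambda>(j::int, k::int) t. complex_of_real (2 powr (real_of_int j / 2)) * psi (2 powr real_of_int j * t - of_int k)) \<and>
     (let F = (\<Union>j\<in>{1::nat..}. (\<lambda>x. x / 2 ^ j) ` P) in
        \<forall>k::int. k \<noteq> 0 \<longrightarrow> F \<inter> ((\<lambda>x. x + of_int k) ` F) \<in> null_sets lebesgue)"

end

theory Submission
  imports Defs
begin

text \<open>The map \<open>rt\<close> is invertible over \<open>[0,1)\<close> and doubles \<open>lam M\<close>, so \<open>Ut\<close> is unitary. The graph \<open>Ft M\<close>
  of the chosen path carries \<open>lam M\<close> as a copy of Lebesgue measure on \<open>[0,1)\<close>; the functions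
  \<open>Tt\<^sup>k phit\<close> are there the exponentials, so \<open>V0 M\<close> consists of all square integrable functions
  supported on \<open>Ft M\<close>, and \<open>Vn M n\<close> of those supported on \<open>rt\<^sup>n (Ft M)\<close>. These sets increase with \<open>n\<close>,
  exhaust \<open>Xt M\<close> (every admissible word eventually follows the chosen path) and have measure \<open>2\<^sup>n\<close>,
  which gives the multiresolution analysis. The set \<open>Pt M\<close> is the graph of the path whose first
  step is the digit that was not chosen, so the same argument makes the translates of \<open>psit\<close>
  an orthonormal basis of the functions supported on it, and the dilates of \<open>Pt M\<close> partition \<open>Xt M\<close>.

  A projection commuting with \<open>Tt\<close> commutes with multiplication by functions of \<open>x\<close>; conjugating
  with \<open>Ut\<close>, also with functions of \<open>\<tau>\<^bsub>\<omega>\<^sub>n\<^esub> \<dots> \<tau>\<^bsub>\<omega>\<^sub>1\<^esub> x\<close>, whose leading digit is \<open>\<omega>\<^sub>n\<close>. Hence it commutes with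
  all bounded multiplications and is itself one.

  On words in \<open>AZ\<close> the coordinate \<open>x + d\<^sub>\<int>(\<omega>)\<close> is halved by the inverse of \<open>rt\<close>, so the product
  formula for \<open>indicator F\<close> at that point says exactly that \<open>\<omega>\<close> is the chosen path of \<open>x\<close>.\<close>

subsection \<open>Square integrable functions\<close>

text \<open>The operators act on genuine functions, not on classes, and \<open>lam M\<close> lives
  on all of \<open>real\<close> times the words, while \<open>rt\<close> is invertible only over
  [0,1) and \<open>l2_inv\<close> is an arbitrary choice. Hence integer powers of \<open>Ut\<close>
  are compared a.e. with explicit operators \<open>dil j\<close>, and the laws of \<open>Rz\<close>
  carry the guard that \<open>fst p\<close> lies in [0,1). The convention in
  \<open>choose_dig\<close> makes the chosen path total, so the geometry of \<open>Ft M\<close>, its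
  images and \<open>Pt M\<close> is exact; the tiling of [0,1) by \<open>M\<close> and its
  half-translate enters through the a.e. statement \<open>AE_choose_iff\<close>, which ties the path
  to the filter \<open>m0 M\<close>. The passage from exponentials to all functions of x is needed
  for closed spans on a graph and again for commuting projections, so it is isolated in
  \<open>trig_class_indicator\<close>. As \<open>lebesgue\<close> is complete, maps of x must pull
  back null sets as well. For the real line, one exceptional null set of x must serve all finite
  words and all integer translates at once; this is what \<open>good_orbit\<close> records.\<close>

lemma borel_measurable_cnj' [measurable (raw)]:
  "f \<in> borel_measurable \<mu> \<Longrightarrow> (\<lambda>x. cnj (f x)) \<in> borel_measurable \<mu>"
  by (rule measurable_compose[OF _ borel_measurable_continuous_onI]) (auto intro: continuous_intros)

lemma L2_iff: "f \<in> L2 \<mu> \<longleftrightarrow> f \<in> borel_measurable \<mu> \<and> integrable \<mu> (\<lambda>x. (norm (f x))\<^sup>2)"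
  by (simp add: L2_def)

lemma L2_measurable [measurable_dest]: "f \<in> L2 \<mu> \<Longrightarrow> f \<in> borel_measurable \<mu>"
  by (simp add: L2_def)

lemma L2_integrable: "f \<in> L2 \<mu> \<Longrightarrow> integrable \<mu> (\<lambda>x. (norm (f x))\<^sup>2)"
  by (simp add: L2_def)

lemma norm_add_sq_le:
  fixes a b :: "'a::real_normed_vector"
  shows "(norm (a + b))\<^sup>2 \<le> 2 * (norm a)\<^sup>2 + 2 * (norm b)\<^sup>2"
proof -
  have "(norm (a + b))\<^sup>2 \<le> (norm a + norm b)\<^sup>2"
    by (intro power_mono norm_triangle_ineq) auto
  also have "\<dots> \<le> 2 * (norm a)\<^sup>2 + 2 * (norm b)\<^sup>2"
    using sum_squares_bound[of "norm a" "norm b"] by (simp add: power2_sum)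
  finally show ?thesis .
qed

lemma L2_dominated:
  assumes "g \<in> L2 \<mu>" "f \<in> borel_measurable \<mu>" "AE x in \<mu>. norm (f x) \<le> B * norm (g x)"
  shows "f \<in> L2 \<mu>"
proof -
  have "integrable \<mu> (\<lambda>x. (norm (f x))\<^sup>2)"
  proof (rule Bochner_Integration.integrable_bound)
    show "integrable \<mu> (\<lambda>x. B\<^sup>2 * (norm (g x))\<^sup>2)"
      using L2_integrable[OF assms(1)] by simp
    show "AE x in \<mu>. norm ((norm (f x))\<^sup>2) \<le> norm (B\<^sup>2 * (norm (g x))\<^sup>2)"
      using assms(3)
    proof (eventually_elim)
      case (elim x)
      then have "(norm (f x))\<^sup>2 \<le> (B * norm (g x))\<^sup>2" by (intro power_mono) auto
      then show ?case by (simp add: power_mult_distrib)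
    qed
  qed (use assms in measurable)
  with assms show ?thesis by (simp add: L2_iff)
qed

lemma L2_bounded_mult:
  assumes "f \<in> L2 \<mu>" "h \<in> borel_measurable \<mu>" "\<And>x. norm (h x) \<le> B"
  shows "(\<lambda>x. h x * f x) \<in> L2 \<mu>"
  by (rule L2_dominated[OF assms(1), of _ B])
     (use assms in \<open>auto simp: norm_mult intro!: mult_right_mono borel_measurable_times L2_measurable\<close>)

lemma L2_scale: "f \<in> L2 \<mu> \<Longrightarrow> (\<lambda>x. c * f x) \<in> L2 \<mu>"
  by (rule L2_bounded_mult[where B = "norm c"]) auto

lemma L2_AE_cong:
  assumes "g \<in> L2 \<mu>" "f \<in> borel_measurable \<mu>" "AE x in \<mu>. f x = g x"
  shows "f \<in> L2 \<mu>"
  by (rule L2_dominated[of g _ _ 1]) (use assms in auto)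

lemma L2_add:
  assumes [measurable]: "f \<in> L2 \<mu>" "g \<in> L2 \<mu>"
  shows "(\<lambda>x. f x + g x) \<in> L2 \<mu>"
proof -
  have "integrable \<mu> (\<lambda>x. (norm (f x + g x))\<^sup>2)"
  proof (rule Bochner_Integration.integrable_bound)
    show "integrable \<mu> (\<lambda>x. 2 * (norm (f x))\<^sup>2 + 2 * (norm (g x))\<^sup>2)"
      using assms by (intro Bochner_Integration.integrable_add integrable_mult_right L2_integrable)
    show "AE x in \<mu>. norm ((norm (f x + g x))\<^sup>2) \<le> norm (2 * (norm (f x))\<^sup>2 + 2 * (norm (g x))\<^sup>2)"
      using norm_add_sq_le by auto
  qed measurable
  then show ?thesis by (simp add: L2_iff)
qed

lemma L2_zero: "(\<lambda>x. 0) \<in> L2 \<mu>"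
  by (simp add: L2_iff)

lemma L2_sum: "(\<And>i. i \<in> I \<Longrightarrow> f i \<in> L2 \<mu>) \<Longrightarrow> (\<lambda>x. \<Sum>i\<in>I. f i x) \<in> L2 \<mu>"
  by (induction I rule: infinite_finite_induct) (auto intro: L2_add L2_zero)

lemma L2_diff: "f \<in> L2 \<mu> \<Longrightarrow> g \<in> L2 \<mu> \<Longrightarrow> (\<lambda>x. f x - g x) \<in> L2 \<mu>"
  using L2_add[of f \<mu> "\<lambda>x. -1 * g x"] L2_scale[of g \<mu> "-1"] by simp

lemma L2_indicator_mult:
  "f \<in> L2 \<mu> \<Longrightarrow> A \<in> sets \<mu> \<Longrightarrow> (\<lambda>x. indicator A x * f x) \<in> L2 \<mu>"
  by (rule L2_bounded_mult[where B = 1]) (auto simp: indicator_def)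

lemma L2_inner_integrable:
  assumes [measurable]: "f \<in> L2 \<mu>" "g \<in> L2 \<mu>"
  shows "integrable \<mu> (\<lambda>x. f x * cnj (g x))"
proof (rule Bochner_Integration.integrable_bound)
  show "integrable \<mu> (\<lambda>x. (norm (f x))\<^sup>2 + (norm (g x))\<^sup>2)"
    using assms by (intro Bochner_Integration.integrable_add L2_integrable)
  show "AE x in \<mu>. norm (f x * cnj (g x)) \<le> norm ((norm (f x))\<^sup>2 + (norm (g x))\<^sup>2)"
  proof (rule AE_I2)
    fix x
    have "2 * (norm (f x) * norm (g x)) \<le> (norm (f x))\<^sup>2 + (norm (g x))\<^sup>2"
      using sum_squares_bound[of "norm (f x)" "norm (g x)"] by (simp add: mult_ac)
    moreover have "norm (f x * cnj (g x)) = norm (f x) * norm (g x)" "0 \<le> norm (f x) * norm (g x)"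
      by (simp_all add: norm_mult)
    ultimately have "norm (f x * cnj (g x)) \<le> (norm (f x))\<^sup>2 + (norm (g x))\<^sup>2"
      by linarith
    then show "norm (f x * cnj (g x)) \<le> norm ((norm (f x))\<^sup>2 + (norm (g x))\<^sup>2)"
      by simp
  qed
qed measurable

lemma l2_inner_AE_cong:
  assumes [measurable]: "f \<in> borel_measurable \<mu>" "f' \<in> borel_measurable \<mu>"
    "g \<in> borel_measurable \<mu>" "g' \<in> borel_measurable \<mu>"
    and "AE x in \<mu>. f x = f' x" "AE x in \<mu>. g x = g' x"
  shows "l2_inner \<mu> f g = l2_inner \<mu> f' g'"
  unfolding l2_inner_def
proof (rule integral_cong_AE)
  show "AE x in \<mu>. f x * cnj (g x) = f' x * cnj (g' x)"
    using assms(5,6) by auto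
qed measurable

lemma l2_inner_self:
  "l2_inner \<mu> f f = complex_of_real (\<integral>x. (norm (f x))\<^sup>2 \<partial>\<mu>)"
  unfolding l2_inner_def complex_norm_square[symmetric] integral_complex_of_real[symmetric] by simp

lemma l2_inner_diff_left:
  assumes "f \<in> L2 \<mu>" "g \<in> L2 \<mu>" "h \<in> L2 \<mu>"
  shows "l2_inner \<mu> (\<lambda>x. f x - g x) h = l2_inner \<mu> f h - l2_inner \<mu> g h"
  unfolding l2_inner_def left_diff_distrib
  by (intro Bochner_Integration.integral_diff L2_inner_integrable assms)

lemma l2_norm_less_iff:
  "\<epsilon> > 0 \<Longrightarrow> l2_norm \<mu> f < \<epsilon> \<longleftrightarrow> (\<integral>x. (norm (f x))\<^sup>2 \<partial>\<mu>) < \<epsilon>\<^sup>2"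
  unfolding l2_norm_def
  by (metis real_sqrt_abs real_sqrt_less_iff abs_of_pos)

lemma L2_sq_zero_AE:
  assumes "f \<in> L2 \<mu>" "(\<integral>x. (norm (f x))\<^sup>2 \<partial>\<mu>) = 0"
  shows "AE x in \<mu>. f x = 0"
  using integral_nonneg_eq_0_iff_AE[OF L2_integrable[OF assms(1)]] assms(2) by simp

text \<open>Testing against the difference itself shows that it has norm zero. This turns identities
  between inner products into a.e. identities.\<close>

lemma L2_weak_eq_AE:
  assumes "f \<in> L2 \<mu>" "g \<in> L2 \<mu>" "\<And>h. h \<in> L2 \<mu> \<Longrightarrow> l2_inner \<mu> f h = l2_inner \<mu> g h"
  shows "AE x in \<mu>. f x = g x"
proof -
  let ?d = "\<lambda>x. f x - g x"
  have d: "?d \<in> L2 \<mu>" using assms by (intro L2_diff)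
  have "l2_inner \<mu> ?d ?d = 0"
    using l2_inner_diff_left[OF assms(1,2) d] assms(3)[OF d] by simp
  then have "(\<integral>x. (norm (?d x))\<^sup>2 \<partial>\<mu>) = 0"
    unfolding l2_inner_self by simp
  from L2_sq_zero_AE[OF d this] show ?thesis by simp
qed

text \<open>Minkowski's inequality is replaced by (a+b)^2 <= 2a^2 + 2b^2 under the integral; the
  factor 2 is harmless in density arguments and no square roots appear.\<close>

lemma L2_dist_triangle:
  assumes "f \<in> L2 \<mu>" "g \<in> L2 \<mu>" "h \<in> L2 \<mu>"
  shows "(\<integral>x. (norm (f x - h x))\<^sup>2 \<partial>\<mu>) \<le>
    2 * (\<integral>x. (norm (f x - g x))\<^sup>2 \<partial>\<mu>) + 2 * (\<integral>x. (norm (g x - h x))\<^sup>2 \<partial>\<mu>)"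
proof -
  have i: "integrable \<mu> (\<lambda>x. (norm (f x - g x))\<^sup>2)" "integrable \<mu> (\<lambda>x. (norm (g x - h x))\<^sup>2)"
    "integrable \<mu> (\<lambda>x. (norm (f x - h x))\<^sup>2)"
    using assms by (auto intro!: L2_integrable[OF L2_diff])
  have "(\<integral>x. (norm (f x - h x))\<^sup>2 \<partial>\<mu>) \<le>
    (\<integral>x. 2 * (norm (f x - g x))\<^sup>2 + 2 * (norm (g x - h x))\<^sup>2 \<partial>\<mu>)"
    using norm_add_sq_le[of "f x - g x" "g x - h x" for x] i by (intro integral_mono) auto
  also have "\<dots> = 2 * (\<integral>x. (norm (f x - g x))\<^sup>2 \<partial>\<mu>) + 2 * (\<integral>x. (norm (g x - h x))\<^sup>2 \<partial>\<mu>)"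
    using i by simp
  finally show ?thesis .
qed

text \<open>The limit inherits the bound B|g|, so the squared error is dominated by (2B|g|)^2 and
  tends to 0 a.e.\<close>

lemma L2_dominated_convergence:
  assumes g: "g \<in> L2 \<mu>" and f[measurable]: "f \<in> borel_measurable \<mu>"
    and F[measurable]: "\<And>n. F n \<in> borel_measurable \<mu>"
    and bound: "\<And>n. AE x in \<mu>. norm (F n x) \<le> B * norm (g x)"
    and lim: "AE x in \<mu>. (\<lambda>n. F n x) \<longlonglongrightarrow> f x"
  shows "f \<in> L2 \<mu>" and "(\<lambda>n. \<integral>x. (norm (f x - F n x))\<^sup>2 \<partial>\<mu>) \<longlonglongrightarrow> 0"
proof -
  have bf: "AE x in \<mu>. norm (f x) \<le> B * norm (g x)"
  proof -
    have "AE x in \<mu>. \<forall>n. norm (F n x) \<le> B * norm (g x)"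
      using bound by (simp add: AE_all_countable)
    with lim show ?thesis
    proof eventually_elim
      case (elim x)
      show ?case
        by (rule LIMSEQ_le_const2[OF tendsto_norm[OF elim(1)]]) (use elim(2) in blast)
    qed
  qed
  show "f \<in> L2 \<mu>" by (rule L2_dominated[OF g f bf])
  have "(\<lambda>n. \<integral>x. (norm (f x - F n x))\<^sup>2 \<partial>\<mu>) \<longlonglongrightarrow> (\<integral>x. 0 \<partial>\<mu>)"
  proof (rule integral_dominated_convergence)
    show "integrable \<mu> (\<lambda>x. 4 * B\<^sup>2 * (norm (g x))\<^sup>2)"
      using L2_integrable[OF g] by simp
    show "AE x in \<mu>. (\<lambda>n. (norm (f x - F n x))\<^sup>2) \<longlonglongrightarrow> 0"
      using lim
    proof eventually_elim
      case (elim x)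
      have "(\<lambda>n. (norm (f x - F n x))\<^sup>2) \<longlonglongrightarrow> (norm (f x - f x))\<^sup>2"
        by (intro tendsto_intros elim)
      then show ?case by simp
    qed
    fix n
    show "AE x in \<mu>. norm ((norm (f x - F n x))\<^sup>2) \<le> 4 * B\<^sup>2 * (norm (g x))\<^sup>2"
      using bf bound[of n]
    proof eventually_elim
      case (elim x)
      have "norm (f x - F n x) \<le> 2 * (B * norm (g x))"
        using elim norm_triangle_ineq4[of "f x" "F n x"] by linarith
      then have "(norm (f x - F n x))\<^sup>2 \<le> (2 * (B * norm (g x)))\<^sup>2"
        by (intro power_mono) auto
      then show ?case by (simp add: power_mult_distrib)
    qed
  qed measurable
  then show "(\<lambda>n. \<integral>x. (norm (f x - F n x))\<^sup>2 \<partial>\<mu>) \<longlonglongrightarrow> 0" by simp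
qed

section \<open>Linear combinations and closed spans\<close>

definition lin_combs :: "('a \<Rightarrow> complex) set \<Rightarrow> ('a \<Rightarrow> complex) set" where
  "lin_combs E = {\<lambda>x. \<Sum>e\<in>K. c e * e x | K c. finite K \<and> K \<subseteq> E}"

lemma lin_combs_base: "e \<in> E \<Longrightarrow> e \<in> lin_combs E"
  unfolding lin_combs_def by (intro CollectI exI[of _ "{e}"] exI[of _ "\<lambda>_. 1"]) auto

lemma lin_combs_scale: "f \<in> lin_combs E \<Longrightarrow> (\<lambda>x. a * f x) \<in> lin_combs E"
proof -
  assume "f \<in> lin_combs E"
  then obtain K c where "finite K" "K \<subseteq> E" "f = (\<lambda>x. \<Sum>e\<in>K. c e * e x)"
    by (auto simp: lin_combs_def)
  then show ?thesis unfolding lin_combs_def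
    by (intro CollectI exI[of _ K] exI[of _ "\<lambda>e. a * c e"]) (auto simp: sum_distrib_left mult_ac)
qed

lemma lin_combs_add: "f \<in> lin_combs E \<Longrightarrow> g \<in> lin_combs E \<Longrightarrow> (\<lambda>x. f x + g x) \<in> lin_combs E"
proof -
  assume "f \<in> lin_combs E" "g \<in> lin_combs E"
  then obtain K c L d where K: "finite K" "K \<subseteq> E" "f = (\<lambda>x. \<Sum>e\<in>K. c e * e x)"
    and L: "finite L" "L \<subseteq> E" "g = (\<lambda>x. \<Sum>e\<in>L. d e * e x)"
    by (auto simp: lin_combs_def)
  \<comment> \<open>Coefficients are indexed by the functions themselves, so a function in both
    \<open>K\<close> and \<open>L\<close> must receive the sum of its two coefficients.\<close>
  let ?c = "\<lambda>e. (if e \<in> K then c e else 0) + (if e \<in> L then d e else 0)"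
  have "f x + g x = (\<Sum>e\<in>K \<union> L. ?c e * e x)" for x
  proof -
    have "f x = (\<Sum>e\<in>K \<union> L. (if e \<in> K then c e else 0) * e x)"
      unfolding K(3) using K L by (intro sum.mono_neutral_cong_left) auto
    moreover have "g x = (\<Sum>e\<in>K \<union> L. (if e \<in> L then d e else 0) * e x)"
      unfolding L(3) using K L by (intro sum.mono_neutral_cong_left) auto
    ultimately show ?thesis by (simp add: sum.distrib distrib_right)
  qed
  then show ?thesis unfolding lin_combs_def using K L
    by (intro CollectI exI[of _ "K \<union> L"] exI[of _ ?c]) auto
qed

lemma lin_combs_L2: "E \<subseteq> L2 \<mu> \<Longrightarrow> f \<in> lin_combs E \<Longrightarrow> f \<in> L2 \<mu>"
  unfolding lin_combs_def by (auto intro!: L2_sum L2_scale)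

lemma l2_cspan_iff:
  "f \<in> l2_cspan \<mu> E \<longleftrightarrow> f \<in> L2 \<mu> \<and>
     (\<forall>\<epsilon>>0. \<exists>g\<in>lin_combs E. (\<integral>x. (norm (f x - g x))\<^sup>2 \<partial>\<mu>) < \<epsilon>)"
proof -
  have *: "(\<exists>K c. finite K \<and> K \<subseteq> E \<and> l2_norm \<mu> (\<lambda>x. f x - (\<Sum>e\<in>K. c e * e x)) < \<epsilon>) \<longleftrightarrow>
    (\<exists>g\<in>lin_combs E. (\<integral>x. (norm (f x - g x))\<^sup>2 \<partial>\<mu>) < \<epsilon>\<^sup>2)" if "\<epsilon> > 0" for \<epsilon>
    unfolding lin_combs_def l2_norm_less_iff[OF that] by (auto; blast)
  show ?thesis
  proof (safe)
    assume "f \<in> l2_cspan \<mu> E"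
    then show "f \<in> L2 \<mu>" by (simp add: l2_cspan_def)
    fix \<epsilon> :: real assume "\<epsilon> > 0"
    with \<open>f \<in> l2_cspan \<mu> E\<close> show "\<exists>g\<in>lin_combs E. (\<integral>x. (norm (f x - g x))\<^sup>2 \<partial>\<mu>) < \<epsilon>"
      using *[of "sqrt \<epsilon>"] by (simp add: l2_cspan_def)
  next
    assume "f \<in> L2 \<mu>" "\<forall>\<epsilon>>0. \<exists>g\<in>lin_combs E. (\<integral>x. (norm (f x - g x))\<^sup>2 \<partial>\<mu>) < \<epsilon>"
    then show "f \<in> l2_cspan \<mu> E"
      using * by (simp add: l2_cspan_def)
  qed
qed

lemma l2_cspan_L2: "f \<in> l2_cspan \<mu> E \<Longrightarrow> f \<in> L2 \<mu>"
  by (simp add: l2_cspan_def)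

lemma l2_cspan_lin_combs:
  "E \<subseteq> L2 \<mu> \<Longrightarrow> f \<in> lin_combs E \<Longrightarrow> f \<in> l2_cspan \<mu> E"
  unfolding l2_cspan_iff by (auto intro: lin_combs_L2 bexI[of _ f])

lemma l2_cspan_closed:
  assumes E: "E \<subseteq> L2 \<mu>" and f: "f \<in> L2 \<mu>"
    and "\<And>\<epsilon>. \<epsilon> > 0 \<Longrightarrow> \<exists>g\<in>l2_cspan \<mu> E. (\<integral>x. (norm (f x - g x))\<^sup>2 \<partial>\<mu>) < \<epsilon>"
  shows "f \<in> l2_cspan \<mu> E"
  unfolding l2_cspan_iff
proof (intro conjI f allI impI)
  fix \<epsilon> :: real assume "\<epsilon> > 0"
  \<comment> \<open>A quarter of \<epsilon> for each of two errors, since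
    \<open>L2_dist_triangle\<close> doubles both.\<close>
  then obtain g where g: "g \<in> l2_cspan \<mu> E" "(\<integral>x. (norm (f x - g x))\<^sup>2 \<partial>\<mu>) < \<epsilon> / 4"
    using assms(3)[of "\<epsilon> / 4"] by auto
  moreover obtain h where h: "h \<in> lin_combs E" "(\<integral>x. (norm (g x - h x))\<^sup>2 \<partial>\<mu>) < \<epsilon> / 4"
    using g(1) \<open>\<epsilon> > 0\<close> unfolding l2_cspan_iff by (meson divide_pos_pos zero_less_numeral)
  ultimately show "\<exists>g\<in>lin_combs E. (\<integral>x. (norm (f x - g x))\<^sup>2 \<partial>\<mu>) < \<epsilon>"
    using L2_dist_triangle[OF f l2_cspan_L2[OF g(1)] lin_combs_L2[OF E h(1)]]
    by (intro bexI[OF _ h(1)]) linarith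
qed

lemma l2_cspan_limit:
  assumes E: "E \<subseteq> L2 \<mu>" and f: "f \<in> L2 \<mu>" and F: "\<And>n::nat. F n \<in> l2_cspan \<mu> E"
    and lim: "(\<lambda>n. \<integral>x. (norm (f x - F n x))\<^sup>2 \<partial>\<mu>) \<longlonglongrightarrow> 0"
  shows "f \<in> l2_cspan \<mu> E"
proof (rule l2_cspan_closed[OF E f])
  fix \<epsilon> :: real assume "\<epsilon> > 0"
  then have "eventually (\<lambda>n. (\<integral>x. (norm (f x - F n x))\<^sup>2 \<partial>\<mu>) < \<epsilon>) sequentially"
    by (rule order_tendstoD(2)[OF lim])
  then obtain n where "(\<integral>x. (norm (f x - F n x))\<^sup>2 \<partial>\<mu>) < \<epsilon>"
    by (auto simp: eventually_sequentially)
  with F show "\<exists>g\<in>l2_cspan \<mu> E. (\<integral>x. (norm (f x - g x))\<^sup>2 \<partial>\<mu>) < \<epsilon>" by blast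
qed

lemma l2_cspan_AE_cong:
  assumes E: "E \<subseteq> L2 \<mu>" and f: "f \<in> borel_measurable \<mu>" and g: "g \<in> l2_cspan \<mu> E"
    and "AE x in \<mu>. f x = g x"
  shows "f \<in> l2_cspan \<mu> E"
proof -
  have f2: "f \<in> L2 \<mu>" by (rule L2_AE_cong[OF l2_cspan_L2[OF g] f assms(4)])
  have "(\<integral>x. (norm (f x - g x))\<^sup>2 \<partial>\<mu>) = (\<integral>x. 0 \<partial>\<mu>)"
    by (rule integral_cong_AE) (use assms(4) f l2_cspan_L2[OF g, THEN L2_measurable] in auto)
  then show ?thesis
    by (intro l2_cspan_closed[OF E f2] bexI[OF _ g]) auto
qed

lemma l2_cspan_lincomb:
  assumes E: "E \<subseteq> L2 \<mu>" and f: "f \<in> l2_cspan \<mu> E" and g: "g \<in> l2_cspan \<mu> E"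
  shows "(\<lambda>x. c * f x + g x) \<in> l2_cspan \<mu> E"
proof (rule l2_cspan_closed[OF E])
  show cf: "(\<lambda>x. c * f x + g x) \<in> L2 \<mu>"
    using f g by (intro L2_add L2_scale l2_cspan_L2)
  fix \<epsilon> :: real assume \<epsilon>: "\<epsilon> > 0"
  have pos: "2 * (norm c)\<^sup>2 + 2 > 0" by (simp add: add_nonneg_pos)
  \<comment> \<open>Chosen so that the two errors, weighted by 2|c|^2 and 2, add up to \<epsilon>;
    the summand 2 keeps the denominator positive for c = 0.\<close>
  define \<delta> where "\<delta> = \<epsilon> / (2 * (norm c)\<^sup>2 + 2)"
  have \<delta>: "\<delta> > 0" using pos \<epsilon> by (simp add: \<delta>_def)
  obtain f' where f': "f' \<in> lin_combs E" "(\<integral>x. (norm (f x - f' x))\<^sup>2 \<partial>\<mu>) < \<delta>"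
    using f \<delta> unfolding l2_cspan_iff by blast
  obtain g' where g': "g' \<in> lin_combs E" "(\<integral>x. (norm (g x - g' x))\<^sup>2 \<partial>\<mu>) < \<delta>"
    using g \<delta> unfolding l2_cspan_iff by blast
  have L: "f \<in> L2 \<mu>" "g \<in> L2 \<mu>" "f' \<in> L2 \<mu>" "g' \<in> L2 \<mu>"
    using f g f'(1) g'(1) E by (auto intro: l2_cspan_L2 lin_combs_L2)
  have i: "integrable \<mu> (\<lambda>x. (norm (f x - f' x))\<^sup>2)" "integrable \<mu> (\<lambda>x. (norm (g x - g' x))\<^sup>2)"
    "integrable \<mu> (\<lambda>x. (norm (c * f x + g x - (c * f' x + g' x)))\<^sup>2)"
    using L by (auto intro!: L2_integrable L2_diff L2_add L2_scale)
  have "(\<integral>x. (norm (c * f x + g x - (c * f' x + g' x)))\<^sup>2 \<partial>\<mu>)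
     \<le> (\<integral>x. 2 * (norm c)\<^sup>2 * (norm (f x - f' x))\<^sup>2 + 2 * (norm (g x - g' x))\<^sup>2 \<partial>\<mu>)"
  proof (rule integral_mono)
    fix x
    have "(norm (c * f x + g x - (c * f' x + g' x)))\<^sup>2 = (norm (c * (f x - f' x) + (g x - g' x)))\<^sup>2"
      by (simp add: algebra_simps)
    also have "\<dots> \<le> 2 * (norm (c * (f x - f' x)))\<^sup>2 + 2 * (norm (g x - g' x))\<^sup>2"
      by (rule norm_add_sq_le)
    finally show "(norm (c * f x + g x - (c * f' x + g' x)))\<^sup>2
      \<le> 2 * (norm c)\<^sup>2 * (norm (f x - f' x))\<^sup>2 + 2 * (norm (g x - g' x))\<^sup>2"
      by (simp add: norm_mult power_mult_distrib)
  qed (use i in auto)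
  also have "\<dots> = 2 * (norm c)\<^sup>2 * (\<integral>x. (norm (f x - f' x))\<^sup>2 \<partial>\<mu>) + 2 * (\<integral>x. (norm (g x - g' x))\<^sup>2 \<partial>\<mu>)"
    using i by simp
  also have "\<dots> < 2 * (norm c)\<^sup>2 * \<delta> + 2 * \<delta>"
    using f'(2) g'(2) by (intro add_le_less_mono mult_left_mono) auto
  also have "\<dots> = (2 * (norm c)\<^sup>2 + 2) * \<delta>" by (simp add: algebra_simps)
  also have "\<dots> = \<epsilon>" using pos by (simp add: \<delta>_def)
  finally show "\<exists>h\<in>l2_cspan \<mu> E. (\<integral>x. (norm (c * f x + g x - h x))\<^sup>2 \<partial>\<mu>) < \<epsilon>"
    by (intro bexI[of _ "\<lambda>x. c * f' x + g' x"] l2_cspan_lin_combs[OF E]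
          lin_combs_add lin_combs_scale f'(1) g'(1))
qed

lemma l2_cspan_zero: "(\<lambda>x. 0) \<in> l2_cspan \<mu> E"
  unfolding l2_cspan_iff lin_combs_def
  by (auto simp: L2_zero intro!: exI[of _ "{}"])

lemma l2_cspan_sum:
  assumes E: "E \<subseteq> L2 \<mu>" and "\<And>i. i \<in> I \<Longrightarrow> f i \<in> l2_cspan \<mu> E"
  shows "(\<lambda>x. \<Sum>i\<in>I. c i * f i x) \<in> l2_cspan \<mu> E"
  using assms(2)
  by (induction I rule: infinite_finite_induct) (auto intro: l2_cspan_lincomb[OF E] l2_cspan_zero)

text \<open>Surjectivity a.e. supplies a preimage, so the choice operator returns one; what is known
  about it afterwards is this a.e. equation.\<close>

lemma l2_inv_unitary:
  assumes "l2_unitary \<mu> A" "f \<in> L2 \<mu>"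
  shows "l2_inv \<mu> A f \<in> L2 \<mu>" "AE x in \<mu>. A (l2_inv \<mu> A f) x = f x"
proof -
  have "\<exists>g. g \<in> L2 \<mu> \<and> (AE x in \<mu>. A g x = f x)"
    using assms unfolding l2_unitary_def by blast
  from someI_ex[OF this] show "l2_inv \<mu> A f \<in> L2 \<mu>" "AE x in \<mu>. A (l2_inv \<mu> A f) x = f x"
    by (auto simp: l2_inv_def)
qed

subsection \<open>Exponentials and trigonometric approximation\<close>

definition ch :: "int \<Rightarrow> real \<Rightarrow> complex" where
  "ch k x = cis (2 * pi * of_int k * x)"

lemma ch_mult: "ch j x * ch k x = ch (j + k) x"
  by (simp add: ch_def cis_mult algebra_simps)

lemma ch_0 [simp]: "ch 0 x = 1"
  by (simp add: ch_def)

lemma norm_ch [simp]: "norm (ch k x) = 1"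
  by (simp add: ch_def)

lemma cnj_ch: "cnj (ch k x) = ch (- k) x"
  by (simp add: ch_def cis_cnj)

lemma ch_add_int: "ch k (x + of_int n) = ch k x"
proof -
  have "ch k (x + of_int n) = cis (2 * pi * of_int k * x) * cis (2 * pi * of_int (k * n))"
    unfolding ch_def cis_mult by (simp add: algebra_simps)
  then show ?thesis by (simp only: cis_multiple_2pi[OF Ints_of_int] ch_def mult_1_right)
qed

lemma ch_double: "ch k (2 * x) = ch (2 * k) x"
  by (simp add: ch_def mult_ac)

lemma ch_1_eqD: "ch 1 x = ch 1 y \<Longrightarrow> \<exists>n::int. x = y + of_int n"
proof -
  assume "ch 1 x = ch 1 y"
  then have "sin (2 * pi * x) = sin (2 * pi * y) \<and> cos (2 * pi * x) = cos (2 * pi * y)"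
    by (auto simp: ch_def complex_eq_iff)
  then obtain n :: int where "2 * pi * x = 2 * pi * y + 2 * pi * of_int n"
    unfolding sin_cos_eq_iff by (auto simp: algebra_simps)
  then have "2 * pi * x = 2 * pi * (y + of_int n)" by (simp only: distrib_left)
  then have "x = y + of_int n" by (simp del: distrib_left)
  then show ?thesis by blast
qed

lemma continuous_on_ch [continuous_intros]: "continuous_on A (ch k)"
  unfolding ch_def by (intro continuous_intros)

lemma ch_borel [measurable]: "ch k \<in> borel_measurable borel"
  by (intro borel_measurable_continuous_onI continuous_intros)

text \<open>The two rules copy the closure properties demanded of \<open>Q\<close> in
  \<open>trig_class_indicator\<close>, so induction transfers \<open>Q\<close> at once; closure
  under products is derived separately for Stone-Weierstrass.\<close>

inductive trig_poly :: "(real \<Rightarrow> complex) \<Rightarrow> bool" where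
  base: "trig_poly (ch k)"
| lin: "trig_poly f \<Longrightarrow> trig_poly g \<Longrightarrow> trig_poly (\<lambda>x. c * f x + g x)"

lemma trig_poly_zero: "trig_poly (\<lambda>x. 0)"
  using trig_poly.lin[OF trig_poly.base[of 0] trig_poly.base[of 0], of "-1"] by simp

lemma trig_poly_scale: "trig_poly f \<Longrightarrow> trig_poly (\<lambda>x. c * f x)"
  using trig_poly.lin[OF _ trig_poly_zero, of f c] by simp

lemma trig_poly_add: "trig_poly f \<Longrightarrow> trig_poly g \<Longrightarrow> trig_poly (\<lambda>x. f x + g x)"
  using trig_poly.lin[of f g 1] by simp

lemma trig_poly_const: "trig_poly (\<lambda>x. c)"
  using trig_poly_scale[OF trig_poly.base[of 0], of c] by simp

lemma trig_poly_ch_mult: "trig_poly f \<Longrightarrow> trig_poly (\<lambda>x. ch k x * f x)"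
proof (induction rule: trig_poly.induct)
  case (base j)
  then show ?case by (simp add: ch_mult trig_poly.base)
next
  case (lin f g c)
  from trig_poly.lin[OF lin.IH, of c] show ?case by (simp add: algebra_simps)
qed

lemma trig_poly_mult: "trig_poly f \<Longrightarrow> trig_poly g \<Longrightarrow> trig_poly (\<lambda>x. f x * g x)"
proof (induction rule: trig_poly.induct)
  case (base j)
  then show ?case by (rule trig_poly_ch_mult)
next
  case (lin f h c)
  from trig_poly.lin[OF lin.IH(1)[OF lin.prems] lin.IH(2)[OF lin.prems], of c]
  show ?case by (simp add: algebra_simps)
qed

text \<open>Real polynomial functions on the plane are generated by real-linear functionals. On the
  circle these are combinations of z and its conjugate, that is, of \<open>ch 1\<close> and
  \<open>ch (-1)\<close>.\<close>

lemma trig_poly_real_polynomial: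
  "real_polynomial_function p \<Longrightarrow> trig_poly (\<lambda>x. complex_of_real (p (ch 1 x)))"
proof (induction rule: real_polynomial_function.induct)
  case (linear f)
  interpret bounded_linear f by fact
  have f: "f z = Re z * f 1 + Im z * f \<i>" for z
  proof -
    have "f z = f (Re z *\<^sub>R 1 + Im z *\<^sub>R \<i>)"
      by (rule arg_cong[of _ _ f]) (simp add: complex_eq_iff)
    then show ?thesis by (simp only: add scaleR) simp
  qed
  have re: "complex_of_real (Re z) = 1/2 * z + 1/2 * cnj z"
    and im: "complex_of_real (Im z) = - \<i>/2 * z + \<i>/2 * cnj z" for z
    by (auto simp: complex_eq_iff)
  have "complex_of_real (f (ch 1 x)) = (f 1/2 - \<i>/2 * f \<i>) * ch 1 x + (f 1/2 + \<i>/2 * f \<i>) * ch (-1) x" for x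
    unfolding f[of "ch 1 x"] of_real_add of_real_mult re im cnj_ch by (simp add: algebra_simps)
  then show ?case
    by (simp only:) (intro trig_poly.lin trig_poly_scale trig_poly.base)
next
  case (const c)
  show ?case by (rule trig_poly_const)
next
  case (add f g)
  from trig_poly_add[OF add.IH] show ?case by simp
next
  case (mult f g)
  from trig_poly_mult[OF mult.IH] show ?case by simp
qed

text \<open>A monotone class argument. Bounded limits carry \<open>Q\<close> from trigonometric
  polynomials to continuous functions on the circle (Stone-Weierstrass), to indicators of intervals,
  to Borel sets, and finally to Lebesgue sets. Convergence is tested only a.e. on [0,1), where the
  first coordinate of \<open>lam M\<close> lives.\<close>

lemma trig_class_indicator:
  fixes Q :: "(real \<Rightarrow> complex) \<Rightarrow> bool"
  assumes ch: "\<And>k. Q (ch k)"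
    and lin: "\<And>f g c. Q f \<Longrightarrow> Q g \<Longrightarrow> Q (\<lambda>x. c * f x + g x)"
    and lim: "\<And>F f B. (\<And>n::nat. Q (F n)) \<Longrightarrow> f \<in> borel_measurable lebesgue \<Longrightarrow>
      (\<And>n x. norm (F n x) \<le> B) \<Longrightarrow>
      (AE x in lebesgue. x \<in> {0..<1} \<longrightarrow> (\<lambda>n. F n x) \<longlonglongrightarrow> f x) \<Longrightarrow> Q f"
    and E: "E \<in> sets lebesgue"
  shows "Q (indicator E)"
proof -
  have trig: "Q f" if "trig_poly f" for f
    using that by induction (auto intro: ch lin)
  have zero: "Q (\<lambda>x. 0)" by (rule trig[OF trig_poly_zero])
  have cont: "Q (\<lambda>x. complex_of_real (f (ch 1 x)))"
    if f: "continuous_on UNIV f" "\<And>z. \<bar>f z\<bar> \<le> 1" for f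
  proof -
    have "\<exists>p. real_polynomial_function p \<and> (\<forall>z\<in>sphere 0 1. \<bar>f z - p z\<bar> < inverse (real (Suc n)))" for n
      by (rule Stone_Weierstrass_real_polynomial_function[of "sphere (0::complex) 1" f "inverse (real (Suc n))"])
         (auto intro: continuous_on_subset[OF f(1)])
    then obtain p where p: "\<And>n. real_polynomial_function (p n)"
      "\<And>n z. z \<in> sphere 0 1 \<Longrightarrow> \<bar>f z - p n z\<bar> < inverse (real (Suc n))" by metis
    have pb: "\<bar>f (ch 1 x) - p n (ch 1 x)\<bar> < inverse (real (Suc n))" for n x
      by (rule p) simp
    show ?thesis
    proof (rule lim)
      show "Q (\<lambda>x. complex_of_real (p n (ch 1 x)))" for n
        by (rule trig[OF trig_poly_real_polynomial[OF p(1)]])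
      have [measurable]: "f \<in> borel_measurable borel"
        by (rule borel_measurable_continuous_onI[OF f(1)])
      have "(\<lambda>x. complex_of_real (f (ch 1 x))) \<in> borel_measurable borel" by measurable
      then show "(\<lambda>x. complex_of_real (f (ch 1 x))) \<in> borel_measurable lebesgue"
        by (simp add: measurable_completion)
      \<comment> \<open>The function is bounded by 1 and the approximation error is at most
        1.\<close>
      show "norm (complex_of_real (p n (ch 1 x))) \<le> 2" for n x
      proof -
        have "inverse (real (Suc n)) \<le> 1" by (simp add: inverse_le_1_iff)
        with pb[of x n] f(2)[of "ch 1 x"] show ?thesis by simp
      qed
      have "(\<lambda>n. complex_of_real (p n (ch 1 x))) \<longlonglongrightarrow> complex_of_real (f (ch 1 x))" for x
      proof (rule tendsto_of_real, rule LIM_zero_cancel, rule Lim_null_comparison)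
        show "\<forall>\<^sub>F n in sequentially. norm (p n (ch 1 x) - f (ch 1 x)) \<le> inverse (real (Suc n))"
          using pb[of x] by (intro always_eventually allI) (simp add: abs_minus_commute less_imp_le)
        show "(\<lambda>n. inverse (real (Suc n))) \<longlonglongrightarrow> 0" by (rule LIMSEQ_inverse_real_of_nat)
      qed
      then show "AE x in lebesgue. x \<in> {0..<1} \<longrightarrow>
        (\<lambda>n. complex_of_real (p n (ch 1 x))) \<longlonglongrightarrow> complex_of_real (f (ch 1 x))" by simp
    qed
  qed
  have nz: "AE x in lebesgue. x \<noteq> (0::real)"
    by (rule AE_completion) (rule AE_lborel_singleton)
  have interval: "Q (indicator {a<..<b})" for a b :: real
  proof -
    \<comment> \<open>Clipping to the open unit interval leaves 0 and 1, which the circle glues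
      together, in the complement. So \<open>K\<close> is a nonempty compact set, and inside (0,1)
      it detects membership in the interval.\<close>
    define I where "I = {max a 0<..<min b 1}"
    define K where "K = ch 1 ` ({0..1} - I)"
    have cK: "closed K" unfolding K_def I_def
      by (intro compact_imp_closed compact_continuous_image continuous_intros compact_diff) auto
    have "0 \<in> {0..1} - I" by (auto simp: I_def)
    then have ne: "K \<noteq> {}" unfolding K_def by blast
    have mem: "ch 1 x \<in> K \<longleftrightarrow> x \<notin> {a<..<b}" if x: "0 < x" "x < 1" for x
    proof
      assume "x \<notin> {a<..<b}"
      then show "ch 1 x \<in> K" using x by (auto simp: K_def I_def)
    next
      assume "ch 1 x \<in> K"
      then obtain y where y: "y \<in> {0..1}" "y \<notin> I" "ch 1 x = ch 1 y" by (auto simp: K_def)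
      then obtain n :: int where n: "x = y + of_int n" using ch_1_eqD by blast
      then have "-1 < real_of_int n" "real_of_int n < 1" using x y(1) by auto
      then have "n = 0" by linarith
      with n y x show "x \<notin> {a<..<b}" by (auto simp: I_def)
    qed
    \<comment> \<open>Truncated multiples of the distance to \<open>K\<close> are continuous and
      increase to the indicator of the complement of the closed set \<open>K\<close>.\<close>
    define F where "F n z = min 1 (real n * infdist z K)" for n z
    show ?thesis
    proof (rule lim)
      show "Q (\<lambda>x. complex_of_real (F n (ch 1 x)))" for n
      proof (rule cont)
        show "continuous_on UNIV (F n)" unfolding F_def
          by (intro continuous_intros)
        show "\<bar>F n z\<bar> \<le> 1" for z by (auto simp: F_def infdist_nonneg)
      qed
      have "(indicator {a<..<b} :: real \<Rightarrow> complex) \<in> borel_measurable borel" by measurable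
      then show "(indicator {a<..<b} :: real \<Rightarrow> complex) \<in> borel_measurable lebesgue"
        by (simp add: measurable_completion)
      show "norm (complex_of_real (F n (ch 1 x))) \<le> 1" for n x
        by (auto simp: F_def infdist_nonneg)
      have "(\<lambda>n. complex_of_real (F n (ch 1 x))) \<longlonglongrightarrow> indicator {a<..<b} x" if x: "0 < x" "x < 1" for x
      proof (cases "x \<in> {a<..<b}")
        case True
        then have "infdist (ch 1 x) K > 0"
          using mem[OF x] infdist_pos_not_in_closed[OF cK ne] by blast
        then obtain N :: nat where N: "real N * infdist (ch 1 x) K > 1"
          using reals_Archimedean3 by blast
        have "F n (ch 1 x) = 1" if "n \<ge> N" for n
        proof -
          have "real N * infdist (ch 1 x) K \<le> real n * infdist (ch 1 x) K"
            using that by (intro mult_right_mono infdist_nonneg) auto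
          then show ?thesis using N by (simp add: F_def)
        qed
        then have "\<forall>\<^sub>F n in sequentially. complex_of_real (F n (ch 1 x)) = indicator {a<..<b} x"
          using True by (auto simp: eventually_sequentially)
        then show ?thesis by (rule tendsto_eventually)
      next
        case False
        then have "F n (ch 1 x) = 0" for n
          using mem[OF x] by (simp add: F_def)
        then show ?thesis using False by simp
      qed
      then show "AE x in lebesgue. x \<in> {0..<1} \<longrightarrow>
        (\<lambda>n. complex_of_real (F n (ch 1 x))) \<longlonglongrightarrow> indicator {a<..<b} x"
        using nz by (auto simp: less_le)
    qed
  qed
  have borel: "Q (indicator A)" if "A \<in> sets borel" for A :: "real set"
  proof -
    \<comment> \<open>Dynkin's argument: the open intervals generate the Borel sets and are stable
      under intersection, so complements and disjoint countable unions suffice.\<close>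
    have eq: "sets borel = sigma_sets UNIV (range (\<lambda>(a, b). {a<..<b::real}))"
      unfolding box_real(1)[symmetric] by (subst borel_eq_box) (simp add: sets_measure_of)
    have stable: "Int_stable (range (\<lambda>(a, b). {a<..<b::real}))"
    proof (rule Int_stableI)
      fix a b assume "a \<in> range (\<lambda>(a, b). {a<..<b::real})" "b \<in> range (\<lambda>(a, b). {a<..<b::real})"
      then obtain s t u v where "a = {s<..<t}" "b = {u<..<v}" by auto
      then show "a \<inter> b \<in> range (\<lambda>(a, b). {a<..<b::real})"
        by (intro image_eqI[of _ _ "(max s u, min t v)"]) auto
    qed
    have "A \<in> sigma_sets UNIV (range (\<lambda>(a, b). {a<..<b::real}))" using that eq by simp
    with stable subset_UNIV[of "range (\<lambda>(a, b). {a<..<b::real})", folded Pow_UNIV] show ?thesis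
    proof (induction rule: sigma_sets_induct_disjoint)
      case (basic A)
      then show ?case using interval by auto
    next
      case empty
      then show ?case using zero by (simp add: indicator_def[abs_def])
    next
      case (compl A)
      from lin[OF compl(2) ch[of 0], of "-1"]
      show ?case by (rule back_subst[of Q]) (auto simp: indicator_def)
    next
      case (union A)
      have A: "A i \<in> sets borel" for i using union(2) eq by auto
      have sum: "(\<Sum>i<n. indicator (A i) x) = (indicator (\<Union>i<n. A i) x :: complex)" for n x
        by (rule indicator_UN_disjoint[symmetric])
           (use union(1) in \<open>auto simp: disjoint_family_on_def\<close>)
      show ?case
      proof (rule lim)
        show "Q (\<lambda>x. \<Sum>i<n. indicator (A i) x)" for n
        proof (induction n)
          case 0
          then show ?case using zero by simp
        next
          case (Suc n)
          from lin[OF Suc union(3)[of n], of 1] show ?case by (simp add: add.commute)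
        qed
        have "(indicator (\<Union> (range A)) :: real \<Rightarrow> complex) \<in> borel_measurable borel"
          using A by measurable
        then show "(indicator (\<Union> (range A)) :: real \<Rightarrow> complex) \<in> borel_measurable lebesgue"
          by (simp add: measurable_completion)
        show "norm (\<Sum>i<n. indicator (A i) x :: complex) \<le> 1" for n x
          unfolding sum by (simp add: indicator_def)
        have "(\<lambda>n. \<Sum>i<n. indicator (A i) x :: complex) \<longlonglongrightarrow> indicator (\<Union> (range A)) x" for x
          unfolding sum by (rule LIMSEQ_indicator_UN)
        then show "AE x in lebesgue. x \<in> {0..<1} \<longrightarrow>
            (\<lambda>n. \<Sum>i<n. indicator (A i) x :: complex) \<longlonglongrightarrow> indicator (\<Union> (range A)) x"
          by simp
      qed
    qed
  qed
  obtain S N N' where *: "E = S \<union> N" "N \<subseteq> N'" "N' \<in> null_sets lborel" "S \<in> sets lborel"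
    using E by (elim sets_completionE)
  show ?thesis
  \<comment> \<open>A Lebesgue set differs from a Borel set by part of a null set, so a constant
    sequence converges to its indicator a.e.\<close>
  proof (rule lim[of "\<lambda>_. indicator S"])
    show "Q (indicator S)" using *(4) by (intro borel) simp
    show "(indicator E :: real \<Rightarrow> complex) \<in> borel_measurable lebesgue" using E by measurable
    show "norm (indicator S x :: complex) \<le> 1" for x by (simp add: indicator_def)
    have "AE x in lebesgue. x \<notin> N'"
      by (rule AE_completion) (rule AE_not_in[OF *(3)])
    then show "AE x in lebesgue. x \<in> {0..<1} \<longrightarrow> (\<lambda>n. indicator S x :: complex) \<longlonglongrightarrow> indicator E x"
      by eventually_elim (use *(1,2) in \<open>auto simp: indicator_def\<close>)
  qed
qed

section \<open>Affine maps, the halving branches and words under completed Lebesgue measure\<close>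

lemma lebesgue_real_affine_measurable:
  "c \<noteq> 0 \<Longrightarrow> (\<lambda>x::real. t + c * x) \<in> lebesgue \<rightarrow>\<^sub>M lebesgue"
  using lebesgue_affine_measurable[of "\<lambda>_. c" t] by simp

lemma AE_lebesgue_real_affine:
  assumes c: "c \<noteq> 0" and P: "AE x::real in lebesgue. P x"
  shows "AE x in lebesgue. P (t + c * x)"
proof -
  obtain N where N: "N \<in> null_sets lebesgue" "{x. \<not> P x} \<subseteq> N"
    using P unfolding eventually_ae_filter by auto
  let ?N = "(\<lambda>x. t + c * x) -` N"
  have m: "?N \<in> sets lebesgue"
    using measurable_sets[OF lebesgue_real_affine_measurable[OF c] null_setsD2[OF N(1)], of t] by simp
  have "(\<integral>\<^sup>+x. indicator N x \<partial>lebesgue) = ennreal \<bar>c\<bar> * (\<integral>\<^sup>+x. indicator N (t + c * x) \<partial>lebesgue)"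
    by (rule nn_integral_real_affine_lebesgue) (use N(1) c in auto)
  also have "(\<integral>\<^sup>+x. indicator N (t + c * x) \<partial>lebesgue) = (\<integral>\<^sup>+x. indicator ?N x \<partial>lebesgue)"
    by (intro nn_integral_cong) (auto simp: indicator_def)
  finally have "?N \<in> null_sets lebesgue"
    using m N(1) c by (auto simp: null_sets_def)
  then show ?thesis by (rule AE_I') (use N(2) in auto)
qed

text \<open>Measurability into the completed sets does not follow from Borel measurability, because
  preimages of null sets must be measurable too. Between consecutive integers \<open>frac\<close> is
  a translation, where this is known.\<close>

lemma frac_lebesgue_measurable: "(frac :: real \<Rightarrow> real) \<in> lebesgue \<rightarrow>\<^sub>M lebesgue"
proof (rule measurableI)
  fix A :: "real set" assume A: "A \<in> sets lebesgue"
  have "frac -` A \<inter> space lebesgue =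
    (\<Union>k::int. {of_int k..<of_int k + 1} \<inter> ((\<lambda>x. - of_int k + 1 * x) -` A \<inter> space lebesgue))"
  proof (intro set_eqI iffI)
    fix x assume "x \<in> frac -` A \<inter> space lebesgue"
    then show "x \<in> (\<Union>k::int. {of_int k..<of_int k + 1} \<inter> ((\<lambda>x. - of_int k + 1 * x) -` A \<inter> space lebesgue))"
      by (intro UN_I[of "\<lfloor>x\<rfloor>"]) (auto simp: frac_def)
  next
    fix x assume "x \<in> (\<Union>k::int. {of_int k..<of_int k + 1} \<inter> ((\<lambda>x. - of_int k + 1 * x) -` A \<inter> space lebesgue))"
    then obtain k :: int where k: "of_int k \<le> x" "x < of_int k + 1" "x - of_int k \<in> A" by auto
    then have "\<lfloor>x\<rfloor> = k" by linarith
    with k show "x \<in> frac -` A \<inter> space lebesgue" by (simp add: frac_def)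
  qed
  also have "\<dots> \<in> sets lebesgue"
    by (intro sets.countable_UN'' sets.Int measurable_sets[OF lebesgue_real_affine_measurable A]) auto
  finally show "frac -` A \<inter> space lebesgue \<in> sets lebesgue" .
qed auto

lemma tau_measurable [measurable]: "tau b \<in> lebesgue \<rightarrow>\<^sub>M lebesgue"
  using lebesgue_real_affine_measurable[of "1/2" "dig b / 2"]
  by (simp add: tau_def[abs_def] add_divide_distrib add.commute)

lemma AE_tau: "AE x in lebesgue. P x \<Longrightarrow> AE x in lebesgue. P (tau b x)"
  using AE_lebesgue_real_affine[of "1/2" P "dig b / 2"]
  by (simp add: tau_def add_divide_distrib add.commute)

lemma tau_list_Nil [simp]: "tau_list [] x = x"
  by (simp add: tau_list_def)

lemma tau_list_Cons [simp]: "tau_list (b # eta) x = tau_list eta (tau b x)"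
  by (simp add: tau_list_def)

lemma tau_list_measurable [measurable]: "tau_list eta \<in> lebesgue \<rightarrow>\<^sub>M lebesgue"
proof (induction eta)
  case (Cons b eta)
  have "(\<lambda>x. tau_list eta (tau b x)) \<in> lebesgue \<rightarrow>\<^sub>M lebesgue"
    by (rule measurable_compose[OF tau_measurable Cons.IH])
  moreover have "tau_list (b # eta) = (\<lambda>x. tau_list eta (tau b x))" by auto
  ultimately show ?case by simp
qed (simp add: tau_list_def)

lemma AE_tau_list: "AE x in lebesgue. P x \<Longrightarrow> AE x in lebesgue. P (tau_list eta x)"
proof (induction eta)
  case (Cons b eta)
  from AE_tau[OF Cons.IH[OF Cons.prems], of b] show ?case by simp
qed simp

lemma rr_measurable [measurable]: "rr \<in> lebesgue \<rightarrow>\<^sub>M lebesgue"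
  unfolding rr_def[abs_def]
  using measurable_compose[OF lebesgue_real_affine_measurable[of 2 0] frac_lebesgue_measurable] by simp

lemma tau_in: "x \<in> {0..<1} \<Longrightarrow> tau b x \<in> {0..<1}"
  by (auto simp: tau_def dig_def)

lemma rr_in [simp]: "0 \<le> rr x" "rr x < 1"
  by (auto simp: rr_def frac_lt_1)

lemma rr_tau: "x \<in> {0..<1} \<Longrightarrow> rr (tau b x) = x"
  by (auto simp: tau_def dig_def rr_def frac_eq frac_1_eq add_divide_distrib)

lemma digit_tau: "x \<in> {0..<1} \<Longrightarrow> digit_of (tau b x) = b"
  by (auto simp: tau_def dig_def digit_of_def)

lemma rr_eq: "x \<in> {0..<1} \<Longrightarrow> rr x = 2 * x - dig (digit_of x)"
proof (cases "x \<ge> 1/2")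
  case True
  assume "x \<in> {0..<1}"
  then have "frac (2 * x) = 2 * x - 1" using True frac_1_eq[of "2 * x - 1"] by (simp add: frac_eq)
  then show ?thesis using True by (simp add: rr_def dig_def digit_of_def)
next
  case False
  assume "x \<in> {0..<1}"
  then show ?thesis using False by (simp add: rr_def dig_def digit_of_def frac_eq)
qed

lemma tau_digit_rr: "x \<in> {0..<1} \<Longrightarrow> tau (digit_of x) (rr x) = x"
  by (simp add: rr_eq tau_def)

lemma space_Omega_M [simp]: "space Omega_M = UNIV"
  by (simp add: Omega_M_def space_PiM PiE_UNIV_domain)

lemma Omega_component [measurable]: "(\<lambda>w. w n) \<in> Omega_M \<rightarrow>\<^sub>M count_space UNIV"
  unfolding Omega_M_def by (rule measurable_component_singleton) simp

lemma measurable_OmegaI: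
  "(\<And>n. (\<lambda>x. f x n) \<in> N \<rightarrow>\<^sub>M count_space UNIV) \<Longrightarrow> f \<in> N \<rightarrow>\<^sub>M Omega_M"
  unfolding Omega_M_def by (rule measurable_PiM_single') auto

lemma prepend_Nil [simp]: "prepend [] w = w"
  by (auto simp: prepend_def)

lemma prepend_Cons: "prepend (b # eta) w = case_nat b (prepend eta w)"
  by (auto simp: prepend_def fun_eq_iff split: nat.split)

text \<open>The enumeration may repeat values, so each value is counted at the first index where it
  occurs. Needed because different prefixes can produce the same word of A(x).\<close>

lemma nn_integral_count_space_range:
  fixes g :: "nat \<Rightarrow> 'a" and h :: "'a \<Rightarrow> ennreal"
  shows "(\<integral>\<^sup>+w. indicator (range g) w * h w \<partial>count_space UNIV) =
    (\<Sum>i. if \<forall>j<i. g j \<noteq> g i then h (g i) else 0)"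
proof -
  let ?I = "{i. \<forall>j<i. g j \<noteq> g i}"
  have bij: "bij_betw g ?I (range g)"
  proof (rule bij_betw_imageI)
    show "inj_on g ?I"
    proof (rule inj_onI)
      fix i j assume "i \<in> ?I" "j \<in> ?I" "g i = g j"
      then show "i = j" by (cases i j rule: linorder_cases) auto
    qed
    show "g ` ?I = range g"
    proof (intro set_eqI iffI)
      fix w assume "w \<in> range g"
      then have ex: "\<exists>i. g i = w" by auto
      define i where "i = (LEAST i. g i = w)"
      have "g i = w" unfolding i_def using ex by (rule LeastI_ex)
      moreover have "g j \<noteq> w" if "j < i" for j
        using that unfolding i_def by (rule not_less_Least)
      ultimately show "w \<in> g ` ?I" by (intro image_eqI[of _ _ i]) auto
    qed auto
  qed
  have "(\<integral>\<^sup>+w. indicator (range g) w * h w \<partial>count_space UNIV) = (\<integral>\<^sup>+w. h w \<partial>count_space (range g))"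
    by (simp add: nn_integral_count_space_indicator mult.commute)
  also have "\<dots> = (\<integral>\<^sup>+i. h (g i) \<partial>count_space ?I)"
    by (rule nn_integral_bij_count_space[OF bij, symmetric])
  also have "\<dots> = (\<integral>\<^sup>+i. h (g i) * indicator ?I i \<partial>count_space UNIV)"
    by (simp add: nn_integral_count_space_indicator)
  also have "\<dots> = (\<Sum>i. h (g i) * indicator ?I i)"
    by (rule nn_integral_count_space_nat)
  also have "(\<lambda>i. h (g i) * indicator ?I i) = (\<lambda>i. if \<forall>j<i. g j \<noteq> g i then h (g i) else 0)"
    by (auto simp: fun_eq_iff indicator_def)
  finally show ?thesis .
qed

subsection \<open>The measure on the fibred space\<close>

locale measurable_tile =
  fixes M :: "real set"
  assumes M_meas [measurable]: "M \<in> sets lebesgue"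
begin

text \<open>For a fixed prefix this is a measurable section of the fibred space; the fibre A(x) is
  covered by countably many such sections.\<close>

definition sel :: "bool list \<Rightarrow> real \<Rightarrow> word" where
  "sel eta x = prepend eta (chosen M (tau_list eta x))"

definition fibre_count :: "pt set \<Rightarrow> real \<Rightarrow> ennreal" where
  "fibre_count S x = (\<integral>\<^sup>+ w. indicator (Aset M x) w * indicator S (x, w) \<partial>count_space UNIV)"

lemma Aset_eq: "Aset M x = range (\<lambda>eta. sel eta x)"
  by (auto simp: Aset_def sel_def)

lemma choose_dig_measurable [measurable]: "choose_dig M \<in> lebesgue \<rightarrow>\<^sub>M count_space UNIV"
  unfolding choose_dig_def[abs_def] by measurable

lemma path_pt_measurable [measurable]: "(\<lambda>x. path_pt M x n) \<in> lebesgue \<rightarrow>\<^sub>M lebesgue"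
proof (induction n)
  case (Suc n)
  have [measurable]: "(\<lambda>y. if choose_dig M y then tau True y else tau False y) \<in> lebesgue \<rightarrow>\<^sub>M lebesgue"
    by measurable
  have "(\<lambda>y. tau (choose_dig M y) y) = (\<lambda>y. if choose_dig M y then tau True y else tau False y)"
    by auto
  then have "(\<lambda>y. tau (choose_dig M y) y) \<in> lebesgue \<rightarrow>\<^sub>M lebesgue" by simp
  from measurable_compose[OF Suc this] show ?case by (simp add: path_pt_def)
qed (simp add: path_pt_def)

lemma chosen_measurable [measurable]: "chosen M \<in> lebesgue \<rightarrow>\<^sub>M Omega_M"
  by (rule measurable_OmegaI) (simp add: chosen_def)

lemma sel_measurable [measurable]: "sel eta \<in> lebesgue \<rightarrow>\<^sub>M Omega_M"
proof (rule measurable_OmegaI)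
  fix n
  show "(\<lambda>x. sel eta x n) \<in> lebesgue \<rightarrow>\<^sub>M count_space UNIV"
    by (cases "n < length eta") (simp_all add: sel_def prepend_def)
qed

lemma space_lam [simp]: "space (lam M) = UNIV"
  by (simp add: lam_def space_measure_of_conv)

lemma sets_lam [measurable_cong]: "sets (lam M) = sets (lebesgue \<Otimes>\<^sub>M Omega_M)"
proof -
  interpret sigma_algebra "UNIV" "sets (lebesgue \<Otimes>\<^sub>M Omega_M :: pt measure)"
    using sets.sigma_algebra_axioms[of "lebesgue \<Otimes>\<^sub>M Omega_M :: pt measure"] by (simp add: space_pair_measure)
  show ?thesis unfolding lam_def by (rule sets_measure_of_eq)
qed

text \<open>Enumerating the prefixes turns an integral over an uncountable word space into a series
  of functions that are visibly measurable in x.\<close>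

lemma fibre_count_suminf:
  "fibre_count S x = (\<Sum>i. if \<forall>j<i. sel (from_nat j) x \<noteq> sel (from_nat i) x
     then indicator S (x, sel (from_nat i) x) else 0)"
proof -
  have "Aset M x = range (\<lambda>i. sel (from_nat i) x)"
    unfolding Aset_eq surj_from_nat[symmetric, where 'a = "bool list"] image_image ..
  then show ?thesis
    by (simp add: fibre_count_def nn_integral_count_space_range)
qed

lemma sel_eq_measurable [measurable]: "Measurable.pred lebesgue (\<lambda>x. sel eta x = sel eta' x)"
  unfolding fun_eq_iff by measurable

lemma fibre_count_measurable [measurable]:
  assumes [measurable]: "S \<in> sets (lam M)"
  shows "fibre_count S \<in> borel_measurable lebesgue"
  unfolding fibre_count_suminf[abs_def] by measurable

text \<open>The formula behind \<open>lam M\<close> is its value once it is shown countably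
  additive: on disjoint sets the word counts add in every fibre.\<close>

lemma emeasure_lam:
  assumes "S \<in> sets (lam M)"
  shows "emeasure (lam M) S = (\<integral>\<^sup>+x. indicator {0..<1} x * fibre_count S x \<partial>lebesgue)"
proof -
  have "emeasure (measure_of UNIV (sets (lebesgue \<Otimes>\<^sub>M Omega_M))
      (\<lambda>S. \<integral>\<^sup>+x. indicator {0..<1} x * fibre_count S x \<partial>lebesgue)) S =
    (\<integral>\<^sup>+x. indicator {0..<1} x * fibre_count S x \<partial>lebesgue)"
  proof (rule emeasure_measure_of_sigma)
    show "sigma_algebra UNIV (sets (lebesgue \<Otimes>\<^sub>M Omega_M :: pt measure))"
      using sets.sigma_algebra_axioms[of "lebesgue \<Otimes>\<^sub>M Omega_M :: pt measure"] by (simp add: space_pair_measure)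
    show "positive (sets (lebesgue \<Otimes>\<^sub>M Omega_M)) (\<lambda>S. \<integral>\<^sup>+x. indicator {0..<1} x * fibre_count S x \<partial>lebesgue)"
      by (simp add: positive_def fibre_count_def)
    show "countably_additive (sets (lebesgue \<Otimes>\<^sub>M Omega_M)) (\<lambda>S. \<integral>\<^sup>+x. indicator {0..<1} x * fibre_count S x \<partial>lebesgue)"
    proof (rule countably_additiveI)
      fix A :: "nat \<Rightarrow> pt set"
      assume A: "range A \<subseteq> sets (lebesgue \<Otimes>\<^sub>M Omega_M)" and disj: "disjoint_family A"
      have [measurable]: "A i \<in> sets (lam M)" for i using A by (auto simp: sets_lam)
      have fm: "fibre_count (A i) \<in> borel_measurable lebesgue" for i
        by (rule fibre_count_measurable) measurable
      have "fibre_count (\<Union>i. A i) x = (\<Sum>i. fibre_count (A i) x)" for x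
        unfolding fibre_count_def suminf_indicator[OF disj, symmetric]
        by (subst nn_integral_suminf[symmetric]) (auto intro!: nn_integral_cong)
      then have "(\<integral>\<^sup>+x. indicator {0..<1} x * fibre_count (\<Union>i. A i) x \<partial>lebesgue)
        = (\<integral>\<^sup>+x. (\<Sum>i. indicator {0..<1} x * fibre_count (A i) x) \<partial>lebesgue)"
        by simp
      also have "\<dots> = (\<Sum>i. \<integral>\<^sup>+x. indicator {0..<1} x * fibre_count (A i) x \<partial>lebesgue)"
        by (intro nn_integral_suminf borel_measurable_times_ennreal fm borel_measurable_indicator) simp
      finally show "(\<Sum>i. \<integral>\<^sup>+x. indicator {0..<1} x * fibre_count (A i) x \<partial>lebesgue) =
        (\<integral>\<^sup>+x. indicator {0..<1} x * fibre_count (\<Union>i. A i) x \<partial>lebesgue)" by simp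
    qed
  qed (use assms in \<open>simp add: sets_lam\<close>)
  then show ?thesis unfolding lam_def fibre_count_def by simp
qed

lemma fst_measurable_lam [measurable]: "fst \<in> lam M \<rightarrow>\<^sub>M lebesgue"
  by measurable

lemma measurable_into_lam:
  "(\<lambda>x. fst (f x)) \<in> N \<rightarrow>\<^sub>M lebesgue \<Longrightarrow> (\<lambda>x. snd (f x)) \<in> N \<rightarrow>\<^sub>M Omega_M \<Longrightarrow> f \<in> N \<rightarrow>\<^sub>M lam M"
  by (simp add: measurable_cong_sets[OF refl sets_lam] measurable_pair_iff comp_def)

text \<open>The exceptional set has fibre count zero over almost every x, since only the words of
  A(x) are counted.\<close>

lemma AE_lamI:
  assumes [measurable]: "Measurable.pred (lam M) P"
    and "AE x in lebesgue. x \<in> {0..<1} \<longrightarrow> (\<forall>w\<in>Aset M x. P (x, w))"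
  shows "AE p in lam M. P p"
proof -
  let ?S = "{p. \<not> P p}"
  have S: "?S \<in> sets (lam M)" using pred_Collect_borel
    by (metis (no_types, lifting) Collect_cong UNIV_I assms(1) pred_def pred_intros_logic(2) space_lam)
  have "emeasure (lam M) ?S = (\<integral>\<^sup>+(x::real). 0 \<partial>lebesgue)"
    unfolding emeasure_lam[OF S]
  proof (rule nn_integral_cong_AE)
    show "AE x in lebesgue. indicator {0..<1} x * fibre_count ?S x = 0"
      using assms(2)
    proof eventually_elim
      case (elim x)
      show ?case
      proof (cases "x \<in> {0..<1}")
        case True
        with elim have "fibre_count ?S x = (\<integral>\<^sup>+ (w::word). 0 \<partial>count_space UNIV)"
          unfolding fibre_count_def by (intro nn_integral_cong) (auto simp: indicator_def)
        then show ?thesis by simp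
      qed (auto simp: indicator_def)
    qed
  qed
  then have "?S \<in> null_sets (lam M)" using S by (auto simp: null_sets_def)
  from AE_not_in[OF this] show ?thesis by simp
qed

lemma AE_lam_fst:
  assumes "AE x in lebesgue. P x"
  shows "AE p in lam M. P (fst p)"
proof -
  obtain N where N: "N \<in> null_sets lebesgue" "{x. \<not> P x} \<subseteq> N"
    using assms unfolding eventually_ae_filter by auto
  note [measurable] = null_setsD2[OF N(1)]
  have "AE p in lam M. fst p \<notin> N"
    by (rule AE_lamI) (use AE_not_in[OF N(1)] in auto)
  then show ?thesis by eventually_elim (use N(2) in auto)
qed

lemma pred_fst_lam [measurable]: "A \<in> sets lebesgue \<Longrightarrow> Measurable.pred (lam M) (\<lambda>p. fst p \<in> A)"
  by (rule pred_sets2[OF _ fst_measurable_lam])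

lemma pred_graph_sel [measurable]: "Measurable.pred (lam M) (\<lambda>p. snd p = sel eta (fst p))"
  unfolding fun_eq_iff by measurable

lemma AE_lam_Y: "AE p in lam M. fst p \<in> {0..<1}"
  by (rule AE_lamI, rule pred_fst_lam) auto

lemma Xt_iff: "p \<in> Xt M \<longleftrightarrow> fst p \<in> {0..<1} \<and> (\<exists>eta. snd p = sel eta (fst p))"
  by (cases p) (auto simp: Xt_def Aset_eq)

lemma AE_lam_Xt: "AE p in lam M. p \<in> Xt M"
proof (rule AE_lamI)
  show "Measurable.pred (lam M) (\<lambda>p. p \<in> Xt M)"
    unfolding Xt_iff by (intro pred_intros_logic pred_intros_countable pred_fst_lam pred_graph_sel) auto
qed (auto simp: Xt_def)

end

subsection \<open>Dilation\<close>

text \<open>The inverse of \<open>rt\<close> over [0,1): the first letter of the word selects the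
  branch and is consumed.\<close>

definition ri :: "pt \<Rightarrow> pt" where
  "ri p = (tau (snd p 0) (fst p), \<lambda>n. snd p (Suc n))"

lemma rt_ri: "fst p \<in> {0..<1} \<Longrightarrow> rt (ri p) = p"
  by (cases p) (auto simp: rt_def ri_def rr_tau digit_tau fun_eq_iff split: nat.split)

lemma ri_rt: "fst p \<in> {0..<1} \<Longrightarrow> ri (rt p) = p"
  by (cases p) (auto simp: rt_def ri_def tau_digit_rr)

lemma fst_rt: "fst (rt p) \<in> {0..<1}"
  by (simp add: rt_def)

lemma fst_ri: "fst p \<in> {0..<1} \<Longrightarrow> fst (ri p) \<in> {0..<1}"
  unfolding ri_def fst_conv by (rule tau_in)

lemma chosen_unfold: "chosen M y = case_nat (choose_dig M y) (chosen M (tau (choose_dig M y) y))"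
proof
  fix n
  show "chosen M y n = case_nat (choose_dig M y) (chosen M (tau (choose_dig M y) y)) n"
    by (cases n) (simp_all add: chosen_def path_pt_def funpow_Suc_right del: funpow.simps(2))
qed

text \<open>A prefix admissible at x can be preceded by the digit of x, because the corresponding
  branch sends r(x) back to x. Conversely the first letter of the prefix is forced; for an empty
  prefix it is supplied by unfolding one step of the chosen path.\<close>

lemma Aset_rr:
  assumes x: "x \<in> {0..<1}"
  shows "case_nat (digit_of x) w \<in> Aset M (rr x) \<longleftrightarrow> w \<in> Aset M x"
proof
  assume "w \<in> Aset M x"
  then obtain eta where "w = prepend eta (chosen M (tau_list eta x))" by (auto simp: Aset_def)
  then have "case_nat (digit_of x) w = prepend (digit_of x # eta) (chosen M (tau_list (digit_of x # eta) (rr x)))"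
    using tau_digit_rr[OF x] by (simp add: prepend_Cons)
  then show "case_nat (digit_of x) w \<in> Aset M (rr x)" unfolding Aset_def by blast
next
  assume "case_nat (digit_of x) w \<in> Aset M (rr x)"
  then obtain eta where e: "case_nat (digit_of x) w = prepend eta (chosen M (tau_list eta (rr x)))"
    by (auto simp: Aset_def)
  have inj: "b = b' \<and> v = v'" if "case_nat b v = case_nat b' v'" for b b' :: bool and v v' :: word
    using fun_cong[OF that, of 0] fun_cong[OF that, of "Suc n" for n] by auto
  show "w \<in> Aset M x"
  proof (cases eta)
    case Nil
    with e have "case_nat (digit_of x) w =
        case_nat (choose_dig M (rr x)) (chosen M (tau (choose_dig M (rr x)) (rr x)))"
      using chosen_unfold[of M "rr x"] by simp
    from inj[OF this] have "w = chosen M x" using tau_digit_rr[OF x] by auto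
    then have "w = prepend [] (chosen M (tau_list [] x))" by simp
    then show ?thesis unfolding Aset_def by blast
  next
    case (Cons b eta')
    with e have "case_nat (digit_of x) w = case_nat b (prepend eta' (chosen M (tau_list eta' (tau b (rr x)))))"
      by (simp add: prepend_Cons)
    from inj[OF this] have "w = prepend eta' (chosen M (tau_list eta' x))"
      using tau_digit_rr[OF x] by auto
    then show ?thesis unfolding Aset_def by blast
  qed
qed

text \<open>The action of the integers by dilation; the group law holds over [0,1), where
  \<open>ri\<close> is a two-sided inverse of \<open>rt\<close>.\<close>

definition Rz :: "int \<Rightarrow> pt \<Rightarrow> pt" where
  "Rz j = (if j \<ge> 0 then rt ^^ nat j else ri ^^ nat (- j))"

lemma Rz_0 [simp]: "Rz 0 p = p"
  by (simp add: Rz_def)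

lemma fst_Rz: "fst p \<in> {0..<1} \<Longrightarrow> fst (Rz j p) \<in> {0..<1}"
proof -
  assume p: "fst p \<in> {0..<1}"
  have "fst ((rt ^^ n) p) \<in> {0..<1}" for n
    using p fst_rt by (induction n) (auto simp del: atLeastLessThan_iff)
  moreover have "fst ((ri ^^ n) p) \<in> {0..<1}" for n
    using p fst_ri by (induction n) (auto simp del: atLeastLessThan_iff)
  ultimately show ?thesis by (simp add: Rz_def del: atLeastLessThan_iff)
qed

lemma rt_Rz: "fst p \<in> {0..<1} \<Longrightarrow> rt (Rz j p) = Rz (j + 1) p"
proof (cases "j \<ge> 0")
  case True
  then have "nat (j + 1) = Suc (nat j)" by simp
  then show ?thesis using True by (simp add: Rz_def)
next
  case False
  assume p: "fst p \<in> {0..<1}"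
  have "nat (- j) = Suc (nat (- (j + 1)))" using False by simp
  then have "Rz j p = ri (Rz (j + 1) p)" using False
    by (cases "j = -1") (auto simp: Rz_def)
  then show ?thesis using rt_ri fst_Rz[OF p] by simp
qed

lemma ri_Rz: "fst p \<in> {0..<1} \<Longrightarrow> ri (Rz j p) = Rz (j - 1) p"
  using rt_Rz[of p "j - 1"] ri_rt[of "Rz (j - 1) p"] fst_Rz[of p "j - 1"] by simp

lemma Rz_Rz: "fst p \<in> {0..<1} \<Longrightarrow> Rz i (Rz j p) = Rz (i + j) p"
proof (induction i rule: int_induct[where k = 0])
  case (step1 i)
  then show ?case
    using rt_Rz[of p "i + j"] rt_Rz[of "Rz j p" i] fst_Rz[of p j] by (simp add: algebra_simps)
next
  case (step2 i)
  then show ?case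
    using ri_Rz[of p "i + j"] ri_Rz[of "Rz j p" i] fst_Rz[of p j] by (simp add: algebra_simps)
qed simp

lemma Tt_ch: "Tt f p = ch 1 (fst p) * f p"
  by (simp add: Tt_def ch_def cis_conv_exp mult_ac)

context measurable_tile begin

lemma fibre_count_add:
  "fibre_count (S \<inter> {p. snd p 0 = False}) x + fibre_count (S \<inter> {p. snd p 0 = True}) x = fibre_count S x"
  unfolding fibre_count_def
  by (subst nn_integral_add[symmetric]) (auto intro!: nn_integral_cong simp: indicator_def)

text \<open>Prepending the digit of x is a bijection from all words onto the words with that first
  letter, and by \<open>Aset_rr\<close> it matches the two fibres.\<close>

lemma fibre_count_rt_vimage:
  assumes x: "x \<in> {0..<1}"
  shows "fibre_count (rt -` S) x = fibre_count (S \<inter> {p. snd p 0 = digit_of x}) (rr x)"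
proof -
  let ?g = "case_nat (digit_of x) :: word \<Rightarrow> word"
  let ?f = "\<lambda>v. indicator (Aset M (rr x)) v * indicator (S \<inter> {p. snd p 0 = digit_of x}) (rr x, v) :: ennreal"
  have inj: "inj ?g"
  proof (rule injI)
    fix v v' assume e: "?g v = ?g v'"
    show "v = v'" using fun_cong[OF e, of "Suc n" for n] by auto
  qed
  have "fibre_count (rt -` S) x = (\<integral>\<^sup>+w. ?f (?g w) \<partial>count_space UNIV)"
    unfolding fibre_count_def
    by (intro nn_integral_cong) (auto simp: indicator_def Aset_rr[OF x] rt_def)
  also have "\<dots> = (\<integral>\<^sup>+v. ?f v \<partial>count_space (range ?g))"
    by (rule nn_integral_bij_count_space) (use inj in \<open>simp add: bij_betw_def\<close>)
  also have "\<dots> = (\<integral>\<^sup>+v. ?f v * indicator (range ?g) v \<partial>count_space UNIV)"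
    by (simp add: nn_integral_count_space_indicator)
  also have "\<dots> = (\<integral>\<^sup>+v. ?f v \<partial>count_space UNIV)"
  proof (intro nn_integral_cong)
    fix v :: word
    have "v = ?g (\<lambda>n. v (Suc n))" if "v 0 = digit_of x"
      using that by (auto simp: fun_eq_iff split: nat.split)
    then have "v \<in> range ?g" if "v 0 = digit_of x" using that by blast
    then show "?f v * indicator (range ?g) v = ?f v" by (auto simp: indicator_def)
  qed
  finally show ?thesis by (simp add: fibre_count_def)
qed

lemma rt_measurable [measurable]: "rt \<in> lam M \<rightarrow>\<^sub>M lam M"
proof (rule measurable_into_lam)
  show "(\<lambda>p. fst (rt p)) \<in> lam M \<rightarrow>\<^sub>M lebesgue"
    unfolding rt_def fst_conv by measurable
  have [measurable]: "Measurable.pred (lam M) (\<lambda>p. digit_of (fst p))"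
    using pred_fst_lam[of "{1/2..}"] by (simp add: digit_of_def)
  show "(\<lambda>p. snd (rt p)) \<in> lam M \<rightarrow>\<^sub>M Omega_M"
  proof (rule measurable_OmegaI)
    fix n show "(\<lambda>p. snd (rt p) n) \<in> lam M \<rightarrow>\<^sub>M count_space UNIV"
      by (cases n) (simp_all add: rt_def)
  qed
qed

lemma ri_measurable [measurable]: "ri \<in> lam M \<rightarrow>\<^sub>M lam M"
proof (rule measurable_into_lam)
  have "(\<lambda>p. if snd p 0 then tau True (fst p) else tau False (fst p)) \<in> lam M \<rightarrow>\<^sub>M lebesgue"
    by measurable
  moreover have "(\<lambda>p. fst (ri p)) = (\<lambda>p. if snd p 0 then tau True (fst p) else tau False (fst p))"
    by (auto simp: ri_def)
  ultimately show "(\<lambda>p. fst (ri p)) \<in> lam M \<rightarrow>\<^sub>M lebesgue" by simp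
  show "(\<lambda>p. snd (ri p)) \<in> lam M \<rightarrow>\<^sub>M Omega_M"
    by (rule measurable_OmegaI) (simp add: ri_def)
qed

lemma Rz_measurable [measurable]: "Rz j \<in> lam M \<rightarrow>\<^sub>M lam M"
proof -
  have "(rt ^^ n) \<in> lam M \<rightarrow>\<^sub>M lam M" "(ri ^^ n) \<in> lam M \<rightarrow>\<^sub>M lam M" for n
    by (induction n) (auto simp: id_def intro: measurable_comp[OF _ rt_measurable] measurable_comp[OF _ ri_measurable])
  then show ?thesis by (simp add: Rz_def)
qed

text \<open>On the half of [0,1) with leading digit b the map r is x -> 2x - b, and the words over x
  correspond to the words over r(x) that begin with b. Each substitution halves the length, and the
  two choices of b together recover the full fibre count.\<close>

lemma emeasure_rt_vimage:
  assumes S[measurable]: "S \<in> sets (lam M)"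
  shows "2 * emeasure (lam M) (rt -` S) = emeasure (lam M) S"
proof -
  define C where "C b y = (indicator {0..<1} y * fibre_count (S \<inter> {p. snd p 0 = b}) y)" for b y
  have "{p. snd p 0 = b} \<in> sets (lam M)" for b
  proof -
    have "{p \<in> space (lam M). snd p 0 = b} \<in> sets (lam M)" by measurable
    then show ?thesis by simp
  qed
  then have "S \<inter> {p. snd p 0 = b} \<in> sets (lam M)" for b using S by blast
  then have C[measurable]: "C b \<in> borel_measurable lebesgue" for b
    unfolding C_def[abs_def]
    by (intro borel_measurable_times_ennreal fibre_count_measurable borel_measurable_indicator) auto
  have m: "rt -` S \<in> sets (lam M)"
    using measurable_sets[OF rt_measurable S] by simp
  \<comment> \<open>The cut-off to [0,1) inside \<open>C\<close> leaves exactly one nonzero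
    candidate for each x in [0,1): the first on the left half, the second on the right half.\<close>
  have "emeasure (lam M) (rt -` S) = (\<integral>\<^sup>+x. C False (0 + 2 * x) + C True (-1 + 2 * x) \<partial>lebesgue)"
    unfolding emeasure_lam[OF m]
  proof (rule nn_integral_cong)
    fix x :: real
    show "indicator {0..<1} x * fibre_count (rt -` S) x = C False (0 + 2 * x) + C True (-1 + 2 * x)"
    proof (cases "x \<in> {0..<1}")
      case True
      then show ?thesis
        using rr_eq[OF True]
        by (cases "x \<ge> 1/2") (auto simp: fibre_count_rt_vimage[OF True] C_def digit_of_def dig_def add.commute)
    qed (auto simp: C_def)
  qed
  also have "\<dots> = (\<integral>\<^sup>+x. C False (0 + 2 * x) \<partial>lebesgue) + (\<integral>\<^sup>+x. C True (-1 + 2 * x) \<partial>lebesgue)"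
    by (intro nn_integral_add measurable_compose[OF lebesgue_real_affine_measurable C]) auto
  also have "2 * \<dots> = (\<integral>\<^sup>+x. C False x \<partial>lebesgue) + (\<integral>\<^sup>+x. C True x \<partial>lebesgue)"
    using nn_integral_real_affine_lebesgue[OF C, of 2 False 0] nn_integral_real_affine_lebesgue[OF C, of 2 True "-1"]
    by (simp add: distrib_left)
  also have "\<dots> = (\<integral>\<^sup>+x. C False x + C True x \<partial>lebesgue)"
    by (rule nn_integral_add[symmetric]) auto
  also have "\<dots> = emeasure (lam M) S"
    unfolding emeasure_lam[OF S] C_def distrib_left[symmetric] fibre_count_add ..
  finally show ?thesis .
qed

text \<open>As an identity of measures, the doubling formula can be fed to the density and image
  measure rules for Bochner integrals.\<close>

lemma lam_density_distr_rt: "lam M = density (distr (lam M) (lam M) rt) (\<lambda>_. ennreal 2)"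
proof (rule measure_eqI)
  fix A assume A: "A \<in> sets (lam M)"
  have "emeasure (density (distr (lam M) (lam M) rt) (\<lambda>_. ennreal 2)) A = 2 * emeasure (lam M) (rt -` A)"
    using A by (simp add: emeasure_density nn_integral_cmult_indicator emeasure_distr)
  then show "emeasure (lam M) A = emeasure (density (distr (lam M) (lam M) rt) (\<lambda>_. ennreal 2)) A"
    by (simp add: emeasure_rt_vimage[OF A])
qed simp

lemma integral_rt:
  fixes f :: "pt \<Rightarrow> 'b::{banach, second_countable_topology}"
  assumes [measurable]: "f \<in> borel_measurable (lam M)"
  shows "(\<integral>p. f (rt p) \<partial>lam M) = (1/2) *\<^sub>R (\<integral>p. f p \<partial>lam M)"
    and "integrable (lam M) (\<lambda>p. f (rt p)) \<longleftrightarrow> integrable (lam M) f"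
proof -
  have "(\<integral>p. f p \<partial>lam M) = (\<integral>p. f p \<partial>density (distr (lam M) (lam M) rt) (\<lambda>_. ennreal 2))"
    using lam_density_distr_rt by simp
  also have "\<dots> = 2 *\<^sub>R (\<integral>p. f (rt p) \<partial>lam M)"
    by (subst integral_density) (simp_all add: integral_distr)
  finally show "(\<integral>p. f (rt p) \<partial>lam M) = (1/2) *\<^sub>R (\<integral>p. f p \<partial>lam M)" by simp
  have "integrable (lam M) f \<longleftrightarrow> integrable (density (distr (lam M) (lam M) rt) (\<lambda>_. ennreal 2)) f"
    using lam_density_distr_rt by simp
  also have "\<dots> \<longleftrightarrow> integrable (lam M) (\<lambda>p. 2 *\<^sub>R f (rt p))"
    by (subst integrable_density) (simp_all add: integrable_distr_eq)
  also have "\<dots> \<longleftrightarrow> integrable (lam M) (\<lambda>p. f (rt p))"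
    using integrable_scaleR_right[of "1/2" "lam M" "\<lambda>p. 2 *\<^sub>R f (rt p)"]
      integrable_scaleR_right[of 2 "lam M" "\<lambda>p. f (rt p)"] by auto
  finally show "integrable (lam M) (\<lambda>p. f (rt p)) \<longleftrightarrow> integrable (lam M) f" by simp
qed

lemma AE_lam_rt:
  assumes "AE p in lam M. P p" shows "AE p in lam M. P (rt p)"
proof -
  obtain N where N: "N \<in> null_sets (lam M)" "{p. \<not> P p} \<subseteq> N"
    using assms unfolding eventually_ae_filter by auto
  have "2 * emeasure (lam M) (rt -` N) = 0"
    using emeasure_rt_vimage[of N] N(1) by (auto simp: null_sets_def)
  moreover have "rt -` N \<in> sets (lam M)"
    using measurable_sets[OF rt_measurable null_setsD2[OF N(1)]] by simp
  ultimately have "rt -` N \<in> null_sets (lam M)" by (simp add: null_sets_def)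
  then show ?thesis by (rule AE_I') (use N(2) in auto)
qed

text \<open>The doubling formula is read backwards: the preimage of a null set under
  \<open>ri\<close>, pulled back once more by \<open>rt\<close>, is the original null set over
  [0,1).\<close>

lemma AE_lam_ri:
  assumes "AE p in lam M. P p" shows "AE p in lam M. P (ri p)"
proof -
  obtain N where N: "N \<in> null_sets (lam M)" "{p. \<not> P p} \<subseteq> N"
    using assms unfolding eventually_ae_filter by auto
  have m: "ri -` N \<in> sets (lam M)"
    using measurable_sets[OF ri_measurable null_setsD2[OF N(1)]] by simp
  have m2: "rt -` (ri -` N) \<in> sets (lam M)"
    using measurable_sets[OF rt_measurable m] by simp
  have "AE p in lam M. p \<notin> rt -` (ri -` N)"
    using AE_lam_Y AE_not_in[OF N(1)] by eventually_elim (simp add: ri_rt)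
  then have "rt -` (ri -` N) \<in> null_sets (lam M)"
    using m2 by (simp add: AE_iff_null_sets)
  then have "ri -` N \<in> null_sets (lam M)"
    using emeasure_rt_vimage[OF m] m by (simp add: null_sets_def)
  then show ?thesis by (rule AE_I') (use N(2) in auto)
qed

lemma AE_lam_Rz:
  assumes "AE p in lam M. P p" shows "AE p in lam M. P (Rz j p)"
proof -
  have "AE p in lam M. P ((rt ^^ n) p)" for n
  proof (induction n)
    case (Suc n)
    from AE_lam_rt[OF this] show ?case by (simp add: funpow_swap1)
  qed (use assms in simp)
  moreover have "AE p in lam M. P ((ri ^^ n) p)" for n
  proof (induction n)
    case (Suc n)
    from AE_lam_ri[OF this] show ?case by (simp add: funpow_swap1)
  qed (use assms in simp)
  ultimately show ?thesis by (simp add: Rz_def)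
qed

lemma integral_ri:
  fixes f :: "pt \<Rightarrow> 'b::{banach, second_countable_topology}"
  assumes [measurable]: "f \<in> borel_measurable (lam M)"
  shows "(\<integral>p. f (ri p) \<partial>lam M) = 2 *\<^sub>R (\<integral>p. f p \<partial>lam M)"
    and "integrable (lam M) (\<lambda>p. f (ri p)) \<longleftrightarrow> integrable (lam M) f"
proof -
  have eq: "AE p in lam M. f (ri (rt p)) = f p"
    using AE_lam_Y by eventually_elim (simp add: ri_rt)
  have "(\<integral>p. f (ri (rt p)) \<partial>lam M) = (\<integral>p. f p \<partial>lam M)"
    by (rule integral_cong_AE[OF _ _ eq]) measurable
  then have "(1/2) *\<^sub>R (\<integral>p. f (ri p) \<partial>lam M) = (\<integral>p. f p \<partial>lam M)"
    using integral_rt(1)[of "\<lambda>p. f (ri p)"] by simp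
  from this[symmetric] show "(\<integral>p. f (ri p) \<partial>lam M) = 2 *\<^sub>R (\<integral>p. f p \<partial>lam M)" by simp
  have "integrable (lam M) (\<lambda>p. f (ri (rt p))) \<longleftrightarrow> integrable (lam M) f"
    by (rule integrable_cong_AE[OF _ _ eq]) measurable
  then show "integrable (lam M) (\<lambda>p. f (ri p)) \<longleftrightarrow> integrable (lam M) f"
    using integral_rt(2)[of "\<lambda>p. f (ri p)"] by simp
qed

lemma integral_Rz:
  fixes f :: "pt \<Rightarrow> 'b::{banach, second_countable_topology}"
  assumes "f \<in> borel_measurable (lam M)"
  shows "(\<integral>p. f (Rz j p) \<partial>lam M) = (2 powr (- real_of_int j)) *\<^sub>R (\<integral>p. f p \<partial>lam M)
    \<and> (integrable (lam M) (\<lambda>p. f (Rz j p)) \<longleftrightarrow> integrable (lam M) f)"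
  using assms
proof (induction j arbitrary: f rule: int_induct[where k = 0])
  case base
  then show ?case by simp
next
  case (step1 i)
  note [measurable] = step1.prems
  have eq: "AE p in lam M. f (rt (Rz i p)) = f (Rz (i + 1) p)"
    using AE_lam_Y by eventually_elim (simp add: rt_Rz)
  have "(\<integral>p. f (Rz (i + 1) p) \<partial>lam M) = (\<integral>p. f (rt (Rz i p)) \<partial>lam M)"
    by (rule integral_cong_AE[symmetric, OF _ _ eq]) measurable
  moreover have "integrable (lam M) (\<lambda>p. f (Rz (i + 1) p)) \<longleftrightarrow> integrable (lam M) (\<lambda>p. f (rt (Rz i p)))"
    by (rule integrable_cong_AE[symmetric, OF _ _ eq]) measurable
  moreover have "2 powr (- real_of_int (i + 1)) = 2 powr (- real_of_int i) * (1/2)"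
    by (simp add: powr_add powr_diff powr_minus field_simps)
  ultimately show ?case
    using step1.IH[of "\<lambda>p. f (rt p)"] integral_rt[OF step1.prems] by simp
next
  case (step2 i)
  note [measurable] = step2.prems
  have eq: "AE p in lam M. f (ri (Rz i p)) = f (Rz (i - 1) p)"
    using AE_lam_Y by eventually_elim (simp add: ri_Rz)
  have "(\<integral>p. f (Rz (i - 1) p) \<partial>lam M) = (\<integral>p. f (ri (Rz i p)) \<partial>lam M)"
    by (rule integral_cong_AE[symmetric, OF _ _ eq]) measurable
  moreover have "integrable (lam M) (\<lambda>p. f (Rz (i - 1) p)) \<longleftrightarrow> integrable (lam M) (\<lambda>p. f (ri (Rz i p)))"
    by (rule integrable_cong_AE[symmetric, OF _ _ eq]) measurable
  moreover have "2 powr (- real_of_int (i - 1)) = 2 powr (- real_of_int i) * 2"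
    by (simp add: powr_add powr_diff powr_minus field_simps)
  ultimately show ?case
    using step2.IH[of "\<lambda>p. f (ri p)"] integral_ri[OF step2.prems] by simp
qed

end

text \<open>For k different from 0 a primitive is the exponential divided by its frequency, which
  takes equal values at both endpoints. The point 1 is added so that the fundamental theorem applies
  on a closed interval.\<close>

lemma integral_ch_unit:
  "(\<integral>x. indicator {0..<1} x *\<^sub>R ch k x \<partial>lebesgue) = (if k = 0 then 1 else 0)"
proof -
  have ae: "AE x in lebesgue. x \<noteq> (1::real)"
    by (rule AE_completion) (rule AE_lborel_singleton)
  have m: "(\<lambda>x. indicator {0..1} x *\<^sub>R ch k x) \<in> borel_measurable borel"
    "(\<lambda>x. indicator {0..<1} x *\<^sub>R ch k x) \<in> borel_measurable borel" by measurable
  have m': "(\<lambda>x. indicator {0..1} x *\<^sub>R ch k x) \<in> borel_measurable lebesgue"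
    "(\<lambda>x. indicator {0..<1} x *\<^sub>R ch k x) \<in> borel_measurable lebesgue"
    using m by (auto intro: measurable_completion)
  have "(\<integral>x. indicator {0..<1} x *\<^sub>R ch k x \<partial>lebesgue) = (\<integral>x. indicator {0..1} x *\<^sub>R ch k x \<partial>lebesgue)"
    by (rule integral_cong_AE[OF m'(2,1)]) (use ae in eventually_elim, auto simp: indicator_def)
  also have "\<dots> = (\<integral>x. indicator {0..1} x *\<^sub>R ch k x \<partial>lborel)"
    by (rule integral_completion) (use m(1) in simp)
  also have "\<dots> = (if k = 0 then 1 else 0)"
  proof (cases "k = 0")
    case True
    have "(\<integral>x. indicator {0..1::real} x *\<^sub>R (1::complex) \<partial>lborel) = measure lborel {0..1::real} *\<^sub>R 1"
      by (subst integral_scaleR_left) (auto simp: integrable_indicator_iff)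
    then show ?thesis using True by simp
  next
    case False
    define c where "c = 2 * pi * real_of_int k"
    have c: "c \<noteq> 0" using False by (simp add: c_def)
    have ck: "ch k = (\<lambda>x. cis (c * x))" by (simp add: ch_def[abs_def] c_def)
    have "(\<integral>x. indicator {0..1} x *\<^sub>R ch k x \<partial>lborel) = ch k 1 / (\<i> * c) - ch k 0 / (\<i> * c)"
    proof (rule integral_FTC_Icc)
      fix x :: real
      have "((\<lambda>x. exp (\<i> * of_real (c * x))) has_vector_derivative (\<i> * c) * exp (\<i> * of_real (c * x))) (at x within {0..1})"
        by (rule has_vector_derivative_real_field[THEN has_vector_derivative_at_within, of "\<lambda>z. exp (\<i> * (c * z))" for x, unfolded of_real_mult[symmetric]])
           (auto intro!: derivative_eq_intros)
      then have "((\<lambda>x. exp (\<i> * of_real (c * x)) / (\<i> * c)) has_vector_derivative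
          ((\<i> * c) * exp (\<i> * of_real (c * x))) / (\<i> * c)) (at x within {0..1})"
        by (rule has_vector_derivative_divide)
      then show "((\<lambda>x. ch k x / (\<i> * c)) has_vector_derivative ch k x) (at x within {0..1})"
        using c by (simp add: ck cis_conv_exp)
    qed (auto intro: continuous_intros)
    also have "ch k 1 = ch k 0" using ch_add_int[of k 0 1] by simp
    finally show ?thesis using False by simp
  qed
  finally show ?thesis .
qed

lemma unit_interval_sets [measurable]: "{0..<1::real} \<in> sets lebesgue"
  by simp

section \<open>Translation and dilation as unitary operators\<close>

context measurable_tile begin

lemma ch_fst_measurable [measurable]: "(\<lambda>p. ch k (fst p)) \<in> borel_measurable (lam M)"
  by (rule measurable_compose[OF fst_measurable_lam]) (rule measurable_completion, simp)

lemma unitary_Tt: "l2_unitary (lam M) Tt"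
proof -
  have L: "Tt f \<in> L2 (lam M)" if "f \<in> L2 (lam M)" for f
    unfolding Tt_ch[abs_def] by (rule L2_bounded_mult[OF that, where B = 1]) auto
  have sur: "\<exists>f\<in>L2 (lam M). AE x in lam M. Tt f x = g x" if "g \<in> L2 (lam M)" for g
    by (rule bexI[of _ "\<lambda>p. ch (-1) (fst p) * g p"])
       (use that in \<open>auto simp: Tt_ch mult.assoc[symmetric] ch_mult intro: L2_bounded_mult[where B = 1]\<close>)
  have inner: "l2_inner (lam M) (Tt f) (Tt g) = l2_inner (lam M) f g" for f g
  proof -
    have "ch 1 x * a * cnj (ch 1 x * b) = a * cnj b" for a b x
    proof -
      have "ch 1 x * a * cnj (ch 1 x * b) = (ch 1 x * ch (-1) x) * (a * cnj b)"
        by (simp add: cnj_ch)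
      then show ?thesis by (simp add: ch_mult)
    qed
    then show ?thesis by (simp only: l2_inner_def Tt_ch)
  qed
  show ?thesis unfolding l2_unitary_def l2_operator_def
    using L sur inner by (auto simp: Tt_ch algebra_simps)
qed

text \<open>An explicit representative of the integer powers of \<open>Ut\<close>. It is free of the
  choices hidden in \<open>l2_inv\<close>, and its factor compensates the scaling of
  \<open>lam M\<close> under \<open>Rz j\<close>.\<close>

definition dil :: "int \<Rightarrow> (pt \<Rightarrow> complex) \<Rightarrow> pt \<Rightarrow> complex" where
  "dil j f p = complex_of_real (2 powr (real_of_int j / 2)) * f (Rz j p)"

lemma dil_factor_sq: "(2 powr (real_of_int j / 2))\<^sup>2 = 2 powr real_of_int j"
  by (simp add: power2_eq_square powr_add[symmetric])

lemma dil_L2: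
  assumes f: "f \<in> L2 (lam M)" shows "dil j f \<in> L2 (lam M)"
proof -
  note [measurable] = f[THEN L2_measurable]
  have "integrable (lam M) (\<lambda>p. (norm (f (Rz j p)))\<^sup>2)"
    using integral_Rz[of "\<lambda>p. (norm (f p))\<^sup>2" j] L2_integrable[OF f] by simp
  then have "(\<lambda>p. f (Rz j p)) \<in> L2 (lam M)" by (simp add: L2_iff)
  then show ?thesis unfolding dil_def[abs_def] by (rule L2_scale)
qed

lemma l2_inner_dil:
  assumes "f \<in> L2 (lam M)" "g \<in> L2 (lam M)"
  shows "l2_inner (lam M) (dil j f) (dil j g) = l2_inner (lam M) f g"
proof -
  note [measurable] = assms[THEN L2_measurable]
  let ?c = "2 powr (real_of_int j / 2)"
  have "l2_inner (lam M) (dil j f) (dil j g) = (\<integral>p. (?c\<^sup>2) *\<^sub>R (f (Rz j p) * cnj (g (Rz j p))) \<partial>lam M)"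
    unfolding l2_inner_def dil_def
    by (intro Bochner_Integration.integral_cong) (auto simp: scaleR_conv_of_real power2_eq_square mult_ac)
  also have "\<dots> = (2 powr real_of_int j * 2 powr (- real_of_int j)) *\<^sub>R l2_inner (lam M) f g"
    using integral_Rz[of "\<lambda>p. f p * cnj (g p)" j] by (simp add: l2_inner_def dil_factor_sq)
  also have "\<dots> = l2_inner (lam M) f g" by (simp add: powr_add[symmetric])
  finally show ?thesis .
qed

lemma dil_norm_sq:
  assumes "f \<in> L2 (lam M)"
  shows "(\<integral>p. (norm (dil j f p))\<^sup>2 \<partial>lam M) = (\<integral>p. (norm (f p))\<^sup>2 \<partial>lam M)"
  using l2_inner_dil[OF assms assms, of j] by (simp add: l2_inner_self)

lemma dil_dil: "AE p in lam M. dil i (dil j f) p = dil (i + j) f p"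
  using AE_lam_Y
  by eventually_elim (simp add: dil_def Rz_Rz add.commute add_divide_distrib powr_add)

lemma dil_AE_cong: "AE p in lam M. f p = g p \<Longrightarrow> AE p in lam M. dil j f p = dil j g p"
  using AE_lam_Rz[of "\<lambda>p. f p = g p" j] by (auto simp: dil_def)

lemma Ut_dil: "Ut f = dil 1 f"
  by (auto simp: Ut_def dil_def Rz_def powr_half_sqrt)

lemma unitary_Ut: "l2_unitary (lam M) Ut"
proof -
  have sur: "\<exists>f\<in>L2 (lam M). AE x in lam M. Ut f x = g x" if "g \<in> L2 (lam M)" for g
    unfolding Ut_dil by (rule bexI[OF _ dil_L2[OF that, of "-1"]]) (use dil_dil[of 1 "-1" g] in \<open>simp add: dil_def\<close>)
  have lin: "dil 1 (\<lambda>y. c * f y + g y) p = c * dil 1 f p + dil 1 g p" for f g c p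
    by (simp add: dil_def algebra_simps)
  have U: "Ut = dil 1" by (intro ext) (simp add: Ut_dil)
  show ?thesis unfolding l2_unitary_def l2_operator_def
    using sur by (simp add: U dil_L2 l2_inner_dil dil_AE_cong lin)
qed

lemma l2_inv_Ut:
  assumes "g \<in> L2 (lam M)"
  shows "AE p in lam M. l2_inv (lam M) Ut g p = dil (-1) g p"
proof -
  let ?f = "l2_inv (lam M) Ut g"
  from dil_AE_cong[OF l2_inv_unitary(2)[OF unitary_Ut assms], of "-1"]
  have "AE p in lam M. dil (-1) (dil 1 ?f) p = dil (-1) g p" by (simp add: Ut_dil)
  with dil_dil[of "-1" 1 ?f] show ?thesis by eventually_elim (simp add: dil_def)
qed

lemma l2_zpow_Ut:
  assumes f: "f \<in> L2 (lam M)"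
  shows "l2_zpow (lam M) Ut j f \<in> L2 (lam M)"
    and "AE p in lam M. l2_zpow (lam M) Ut j f p = dil j f p"
proof -
  have pos: "(Ut ^^ n) f \<in> L2 (lam M) \<and> (AE p in lam M. (Ut ^^ n) f p = dil (int n) f p)" for n
  proof (induction n)
    case 0
    then show ?case using f by (simp add: dil_def)
  next
    case (Suc n)
    from dil_AE_cong[OF conjunct2[OF Suc], of 1] dil_dil[of 1 "int n" f]
    have "AE p in lam M. dil 1 ((Ut ^^ n) f) p = dil (int (Suc n)) f p"
      by eventually_elim simp
    moreover have "(Ut ^^ Suc n) f = dil 1 ((Ut ^^ n) f)"
      by (simp add: Ut_dil[of "(Ut ^^ n) f"])
    ultimately show ?case using dil_L2[OF conjunct1[OF Suc], of 1] by simp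
  qed
  have neg: "(l2_inv (lam M) Ut ^^ n) f \<in> L2 (lam M) \<and>
    (AE p in lam M. (l2_inv (lam M) Ut ^^ n) f p = dil (- int n) f p)" for n
  proof (induction n)
    case 0
    then show ?case using f by (simp add: dil_def)
  next
    case (Suc n)
    from dil_AE_cong[OF conjunct2[OF Suc], of "-1"] dil_dil[of "-1" "- int n" f]
      l2_inv_Ut[OF conjunct1[OF Suc]]
    have "AE p in lam M. l2_inv (lam M) Ut ((l2_inv (lam M) Ut ^^ n) f) p = dil (- int (Suc n)) f p"
      by eventually_elim simp
    then show ?case using Suc l2_inv_unitary(1)[OF unitary_Ut] by simp
  qed
  show "l2_zpow (lam M) Ut j f \<in> L2 (lam M)" "AE p in lam M. l2_zpow (lam M) Ut j f p = dil j f p"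
    using pos[of "nat j"] neg[of "nat (- j)"] by (auto simp: l2_zpow_def)
qed

lemma l2_inv_Tt:
  assumes "g \<in> L2 (lam M)"
  shows "AE p in lam M. l2_inv (lam M) Tt g p = ch (-1) (fst p) * g p"
  using l2_inv_unitary(2)[OF unitary_Tt assms]
proof eventually_elim
  case (elim p)
  have "l2_inv (lam M) Tt g p = (ch (-1) (fst p) * ch 1 (fst p)) * l2_inv (lam M) Tt g p"
    by (simp add: ch_mult)
  also have "\<dots> = ch (-1) (fst p) * g p" using elim by (simp add: Tt_ch mult.assoc)
  finally show ?case .
qed

lemma l2_zpow_Tt:
  assumes f: "f \<in> L2 (lam M)"
  shows "l2_zpow (lam M) Tt k f \<in> L2 (lam M)"
    and "AE p in lam M. l2_zpow (lam M) Tt k f p = ch k (fst p) * f p"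
proof -
  have pos: "(Tt ^^ n) f \<in> L2 (lam M) \<and> (AE p in lam M. (Tt ^^ n) f p = ch (int n) (fst p) * f p)" for n
  proof (induction n)
    case 0
    then show ?case using f by simp
  next
    case (Suc n)
    have "Tt ((Tt ^^ n) f) \<in> L2 (lam M)"
      using unitary_Tt Suc by (auto simp: l2_unitary_def l2_operator_def)
    moreover have "AE p in lam M. Tt ((Tt ^^ n) f) p = ch (int (Suc n)) (fst p) * f p"
      using conjunct2[OF Suc] by eventually_elim (subst Tt_ch, simp add: mult.assoc[symmetric] ch_mult)
    ultimately show ?case by simp
  qed
  have neg: "(l2_inv (lam M) Tt ^^ n) f \<in> L2 (lam M) \<and>
    (AE p in lam M. (l2_inv (lam M) Tt ^^ n) f p = ch (- int n) (fst p) * f p)" for n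
  proof (induction n)
    case 0
    then show ?case using f by simp
  next
    case (Suc n)
    have "AE p in lam M. l2_inv (lam M) Tt ((l2_inv (lam M) Tt ^^ n) f) p = ch (- int (Suc n)) (fst p) * f p"
      using conjunct2[OF Suc] l2_inv_Tt[OF conjunct1[OF Suc]]
      by eventually_elim (simp add: mult.assoc[symmetric] ch_mult)
    then show ?case using Suc l2_inv_unitary(1)[OF unitary_Tt] by simp
  qed
  show "l2_zpow (lam M) Tt k f \<in> L2 (lam M)" "AE p in lam M. l2_zpow (lam M) Tt k f p = ch k (fst p) * f p"
    using pos[of "nat k"] neg[of "nat (- k)"] by (auto simp: l2_zpow_def)
qed

subsection \<open>Functions supported on a graph\<close>

definition supp_space :: "pt set \<Rightarrow> (pt \<Rightarrow> complex) set" where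
  "supp_space G = {f \<in> L2 (lam M). AE p in lam M. p \<notin> G \<longrightarrow> f p = 0}"

text \<open>The part of f outside \<open>G\<close> is no larger than the distance from f to any
  linear combination, since all of these vanish there a.e.\<close>

lemma cspan_supp_subset:
  assumes E: "E \<subseteq> supp_space G" and G[measurable]: "G \<in> sets (lam M)"
  shows "l2_cspan (lam M) E \<subseteq> supp_space G"
proof
  fix f assume f: "f \<in> l2_cspan (lam M) E"
  have fL: "f \<in> L2 (lam M)" by (rule l2_cspan_L2[OF f])
  have EL: "E \<subseteq> L2 (lam M)" using E by (auto simp: supp_space_def)
  let ?h = "\<lambda>p. indicator (- G) p * f p"
  have hL: "?h \<in> L2 (lam M)"
    by (rule L2_indicator_mult[OF fL]) (use G in \<open>simp add: Compl_eq_Diff_UNIV sets.compl_sets[of _ "lam M", simplified]\<close>)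
  have lin: "AE p in lam M. p \<notin> G \<longrightarrow> g p = 0" if "g \<in> lin_combs E" for g
  proof -
    obtain K c where K: "finite K" "K \<subseteq> E" "g = (\<lambda>x. \<Sum>e\<in>K. c e * e x)"
      using \<open>g \<in> lin_combs E\<close> by (auto simp: lin_combs_def)
    have "AE p in lam M. \<forall>e\<in>K. p \<notin> G \<longrightarrow> e p = 0"
      using K E by (intro AE_finite_allI) (auto simp: supp_space_def)
    then show ?thesis by eventually_elim (auto intro!: sum.neutral simp: K(3))
  qed
  have "(\<integral>p. (norm (?h p))\<^sup>2 \<partial>lam M) \<le> \<epsilon>" if "\<epsilon> > 0" for \<epsilon>
  proof -
    obtain g where g: "g \<in> lin_combs E" "(\<integral>p. (norm (f p - g p))\<^sup>2 \<partial>lam M) < \<epsilon>"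
      using f \<open>\<epsilon> > 0\<close> unfolding l2_cspan_iff by blast
    have "(\<integral>p. (norm (?h p))\<^sup>2 \<partial>lam M) \<le> (\<integral>p. (norm (f p - g p))\<^sup>2 \<partial>lam M)"
    proof (rule integral_mono_AE)
      show "integrable (lam M) (\<lambda>p. (norm (?h p))\<^sup>2)" by (rule L2_integrable[OF hL])
      show "integrable (lam M) (\<lambda>p. (norm (f p - g p))\<^sup>2)"
        by (rule L2_integrable[OF L2_diff[OF fL lin_combs_L2[OF EL g(1)]]])
      show "AE p in lam M. (norm (?h p))\<^sup>2 \<le> (norm (f p - g p))\<^sup>2"
        using lin[OF g(1)] by eventually_elim (auto simp: indicator_def)
    qed
    with g(2) show ?thesis by simp
  qed
  then have "(\<integral>p. (norm (?h p))\<^sup>2 \<partial>lam M) \<le> 0" by (rule field_le_epsilon[of _ 0, simplified])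
  then have "(\<integral>p. (norm (?h p))\<^sup>2 \<partial>lam M) = 0" by (intro antisym) auto
  from L2_sq_zero_AE[OF hL this] have "AE p in lam M. p \<notin> G \<longrightarrow> f p = 0"
    by eventually_elim (auto simp: indicator_def)
  with fL show "f \<in> supp_space G" by (simp add: supp_space_def)
qed

lemma graph_sets:
  assumes [measurable]: "s \<in> lebesgue \<rightarrow>\<^sub>M Omega_M"
  shows "{p. fst p \<in> {0..<1} \<and> snd p = s (fst p)} \<in> sets (lam M)"
proof -
  have "Measurable.pred (lam M) (\<lambda>p. \<forall>n. snd p n = s (fst p) n)" by measurable
  then have "Measurable.pred (lam M) (\<lambda>p. fst p \<in> {0..<1} \<and> snd p = s (fst p))"
    unfolding fun_eq_iff by (intro pred_intros_logic pred_fst_lam) auto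
  then show ?thesis by (simp add: pred_def)
qed

text \<open>Each fibre meets the graph in the single word \<open>s x\<close>, which is admissible
  and so has count one. Stated for an arbitrary measurable section because both
  \<open>chosen M\<close> and \<open>other\<close> are needed.\<close>

lemma lam_on_graph:
  assumes s[measurable]: "s \<in> lebesgue \<rightarrow>\<^sub>M Omega_M" and sA: "\<And>x. x \<in> {0..<1} \<Longrightarrow> s x \<in> Aset M x"
    and G: "G = {p. fst p \<in> {0..<1} \<and> snd p = s (fst p)}"
  shows "density (lam M) (\<lambda>p. ennreal (indicator G p)) =
    distr (density lebesgue (\<lambda>x. ennreal (indicator {0..<1} x))) (lam M) (\<lambda>x. (x, s x))"
proof (rule measure_eqI)
  have Gm[measurable]: "G \<in> sets (lam M)" unfolding G by (rule graph_sets[OF s])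
  have sm: "(\<lambda>x. (x, s x)) \<in> lebesgue \<rightarrow>\<^sub>M lam M"
    by (rule measurable_into_lam) simp_all
  fix S assume "S \<in> sets (density (lam M) (\<lambda>p. ennreal (indicator G p)))"
  then have S[measurable]: "S \<in> sets (lam M)" by simp
  have m: "(\<lambda>x. (x, s x)) -` S \<in> sets lebesgue"
    using measurable_sets[OF sm S] by simp
  have "emeasure (density (lam M) (\<lambda>p. ennreal (indicator G p))) S = emeasure (lam M) (G \<inter> S)"
  proof -
    have "emeasure (density (lam M) (\<lambda>p. ennreal (indicator G p))) S =
        (\<integral>\<^sup>+p. ennreal (indicator G p) * indicator S p \<partial>lam M)"
      by (rule emeasure_density) auto
    also have "\<dots> = (\<integral>\<^sup>+p. indicator (G \<inter> S) p \<partial>lam M)"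
      by (intro nn_integral_cong) (simp add: indicator_inter_arith ennreal_indicator)
    finally show ?thesis by simp
  qed
  also have "\<dots> = (\<integral>\<^sup>+x. indicator {0..<1} x * indicator ((\<lambda>x. (x, s x)) -` S) x \<partial>lebesgue)"
  proof (subst emeasure_lam)
    show "(\<integral>\<^sup>+x. indicator {0..<1} x * fibre_count (G \<inter> S) x \<partial>lebesgue) =
       (\<integral>\<^sup>+x. indicator {0..<1} x * indicator ((\<lambda>x. (x, s x)) -` S) x \<partial>lebesgue)"
    proof (rule nn_integral_cong)
      fix x :: real
      have "fibre_count (G \<inter> S) x = indicator ((\<lambda>x. (x, s x)) -` S) x" if "x \<in> {0..<1}"
        unfolding fibre_count_def
        using sA[OF that] that
        by (subst nn_integral_count_space'[of "{s x}"]) (auto simp: G indicator_def)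
      then show "indicator {0..<1} x * fibre_count (G \<inter> S) x =
        indicator {0..<1} x * indicator ((\<lambda>x. (x, s x)) -` S) x" by (auto simp: indicator_def)
    qed
  qed measurable
  also have "\<dots> = emeasure (distr (density lebesgue (\<lambda>x. ennreal (indicator {0..<1} x))) (lam M) (\<lambda>x. (x, s x))) S"
    using sm m by (simp add: emeasure_distr emeasure_density ennreal_indicator)
  finally show "emeasure (density (lam M) (\<lambda>p. ennreal (indicator G p))) S =
    emeasure (distr (density lebesgue (\<lambda>x. ennreal (indicator {0..<1} x))) (lam M) (\<lambda>x. (x, s x))) S" .
qed simp

lemma integral_graph:
  fixes f :: "pt \<Rightarrow> 'b::{banach, second_countable_topology}"
  assumes s[measurable]: "s \<in> lebesgue \<rightarrow>\<^sub>M Omega_M" and sA: "\<And>x. x \<in> {0..<1} \<Longrightarrow> s x \<in> Aset M x"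
    and G: "G = {p. fst p \<in> {0..<1} \<and> snd p = s (fst p)}"
    and f[measurable]: "f \<in> borel_measurable (lam M)"
  shows "(\<integral>p. indicator G p *\<^sub>R f p \<partial>lam M) = (\<integral>x. indicator {0..<1} x *\<^sub>R f (x, s x) \<partial>lebesgue)"
    and "integrable (lam M) (\<lambda>p. indicator G p *\<^sub>R f p) \<longleftrightarrow>
      integrable lebesgue (\<lambda>x. indicator {0..<1} x *\<^sub>R f (x, s x))"
proof -
  have Gm[measurable]: "G \<in> sets (lam M)" unfolding G by (rule graph_sets[OF s])
  have sm[measurable]: "(\<lambda>x. (x, s x)) \<in> lebesgue \<rightarrow>\<^sub>M lam M"
    by (rule measurable_into_lam) simp_all
  have fs[measurable]: "(\<lambda>x. f (x, s x)) \<in> borel_measurable lebesgue"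
    by (rule measurable_compose[OF sm f])
  have sm': "(\<lambda>x. (x, s x)) \<in> density lebesgue (\<lambda>x. ennreal (indicator {0..<1} x)) \<rightarrow>\<^sub>M lam M"
    by simp
  let ?D = "distr (density lebesgue (\<lambda>x. ennreal (indicator {0..<1} x))) (lam M) (\<lambda>x. (x, s x))"
  have "(\<integral>p. indicator G p *\<^sub>R f p \<partial>lam M) = (\<integral>p. f p \<partial>density (lam M) (\<lambda>p. ennreal (indicator G p)))"
    by (subst integral_density) auto
  also have "\<dots> = (\<integral>p. f p \<partial>?D)" by (simp only: lam_on_graph[OF s sA G])
  also have "\<dots> = (\<integral>x. indicator {0..<1} x *\<^sub>R f (x, s x) \<partial>lebesgue)"
    by (subst integral_distr[OF sm' f], subst integral_density) auto
  finally show "(\<integral>p. indicator G p *\<^sub>R f p \<partial>lam M) = (\<integral>x. indicator {0..<1} x *\<^sub>R f (x, s x) \<partial>lebesgue)" .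
  have "integrable (lam M) (\<lambda>p. indicator G p *\<^sub>R f p) \<longleftrightarrow> integrable (density (lam M) (\<lambda>p. ennreal (indicator G p))) f"
    by (subst integrable_density) auto
  also have "\<dots> \<longleftrightarrow> integrable ?D f" by (simp only: lam_on_graph[OF s sA G])
  also have "\<dots> \<longleftrightarrow> integrable lebesgue (\<lambda>x. indicator {0..<1} x *\<^sub>R f (x, s x))"
    by (subst integrable_distr_eq[OF sm' f], subst integrable_density) auto
  finally show "integrable (lam M) (\<lambda>p. indicator G p *\<^sub>R f p) \<longleftrightarrow>
      integrable lebesgue (\<lambda>x. indicator {0..<1} x *\<^sub>R f (x, s x))" .
qed

lemma indicator_graph_L2:
  assumes s: "s \<in> lebesgue \<rightarrow>\<^sub>M Omega_M" and sA: "\<And>x. x \<in> {0..<1} \<Longrightarrow> s x \<in> Aset M x"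
    and G: "G = {p. fst p \<in> {0..<1} \<and> snd p = s (fst p)}"
  shows "indicator G \<in> L2 (lam M)"
proof -
  have Gm[measurable]: "G \<in> sets (lam M)" unfolding G by (rule graph_sets[OF s])
  have "integrable lebesgue (\<lambda>x::real. indicator {0..<1} x *\<^sub>R (1::real))"
    by (simp add: integrable_completion integrable_indicator_iff)
  then have "integrable (lam M) (\<lambda>p. indicator G p *\<^sub>R (1::real))"
    using integral_graph(2)[OF s sA G, of "\<lambda>_. 1::real"] by simp
  moreover have "(norm (indicator G p :: complex))\<^sup>2 = indicator G p *\<^sub>R 1" for p
    by (simp add: indicator_def)
  ultimately show ?thesis by (simp add: L2_iff)
qed

lemma graph_orthonormal:
  assumes s: "s \<in> lebesgue \<rightarrow>\<^sub>M Omega_M" and sA: "\<And>x. x \<in> {0..<1} \<Longrightarrow> s x \<in> Aset M x"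
    and G: "G = {p. fst p \<in> {0..<1} \<and> snd p = s (fst p)}"
    and eL: "\<And>k. e k \<in> L2 (lam M)" and e: "\<And>k. AE p in lam M. e k p = ch k (fst p) * indicator G p"
  shows "l2_inner (lam M) (e j) (e k) = (if j = k then 1 else 0)"
proof -
  have Gm[measurable]: "G \<in> sets (lam M)" unfolding G by (rule graph_sets[OF s])
  have "l2_inner (lam M) (e j) (e k) =
      l2_inner (lam M) (\<lambda>p. ch j (fst p) * indicator G p) (\<lambda>p. ch k (fst p) * indicator G p)"
    by (rule l2_inner_AE_cong[OF L2_measurable[OF eL] _ L2_measurable[OF eL] _ e e]) measurable
  also have "\<dots> = (\<integral>p. indicator G p *\<^sub>R ch (j - k) (fst p) \<partial>lam M)"
    unfolding l2_inner_def
    by (intro Bochner_Integration.integral_cong refl) (auto simp: indicator_def cnj_ch ch_mult)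
  also have "\<dots> = (\<integral>x. indicator {0..<1} x *\<^sub>R ch (j - k) x \<partial>lebesgue)"
    by (subst integral_graph(1)[OF s sA G]) auto
  also have "\<dots> = (if j = k then 1 else 0)"
    by (simp only: integral_ch_unit) simp
  finally show ?thesis .
qed

text \<open>For the harder inclusion, \<open>trig_class_indicator\<close> gives all indicators of
  sets of x times the indicator of \<open>G\<close>. Simple functions and dominated convergence then
  give every function supported on \<open>G\<close>. The family is known only a.e., as powers of
  \<open>Tt\<close> are.\<close>

lemma graph_cspan:
  assumes s[measurable]: "s \<in> lebesgue \<rightarrow>\<^sub>M Omega_M" and sA: "\<And>x. x \<in> {0..<1} \<Longrightarrow> s x \<in> Aset M x"
    and G: "G = {p. fst p \<in> {0..<1} \<and> snd p = s (fst p)}"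
    and eL: "\<And>k::int. e k \<in> L2 (lam M)" and e: "\<And>k. AE p in lam M. e k p = ch k (fst p) * indicator G p"
  shows "l2_cspan (lam M) (range e) = supp_space G"
proof
  have Gm[measurable]: "G \<in> sets (lam M)" unfolding G by (rule graph_sets[OF s])
  have GL: "indicator G \<in> L2 (lam M)" by (rule indicator_graph_L2[OF s sA G])
  have sm[measurable]: "(\<lambda>x. (x, s x)) \<in> lebesgue \<rightarrow>\<^sub>M lam M"
    by (rule measurable_into_lam) simp_all
  let ?V = "l2_cspan (lam M) (range e)"
  have EL: "range e \<subseteq> L2 (lam M)" using eL by auto
  have "e k \<in> supp_space G" for k
    using eL e[of k] by (auto simp: supp_space_def)
  then show "?V \<subseteq> supp_space G" by (intro cspan_supp_subset Gm) auto
  have mult: "(\<lambda>p. indicator E (fst p) * indicator G p) \<in> ?V" if "E \<in> sets lebesgue" for E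
  proof (rule trig_class_indicator[where Q = "\<lambda>g. (\<lambda>p. g (fst p) * indicator G p) \<in> ?V", OF _ _ _ that])
    show "(\<lambda>p. ch k (fst p) * indicator G p) \<in> ?V" for k
    proof (rule l2_cspan_AE_cong[OF EL])
      show "e k \<in> ?V" by (rule l2_cspan_lin_combs[OF EL lin_combs_base]) simp
      show "AE p in lam M. ch k (fst p) * indicator G p = e k p" using e[of k] by eventually_elim simp
    qed measurable
  next
    fix f g :: "real \<Rightarrow> complex" and c
    assume "(\<lambda>p. f (fst p) * indicator G p) \<in> ?V" "(\<lambda>p. g (fst p) * indicator G p) \<in> ?V"
    from l2_cspan_lincomb[OF EL this, of c]
    show "(\<lambda>p. (c * f (fst p) + g (fst p)) * indicator G p) \<in> ?V"
      by (simp add: algebra_simps)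
  next
    fix F :: "nat \<Rightarrow> real \<Rightarrow> complex" and f B
    assume F: "\<And>n. (\<lambda>p. F n (fst p) * indicator G p) \<in> ?V" and f[measurable]: "f \<in> borel_measurable lebesgue"
      and B: "\<And>n x. norm (F n x) \<le> B"
      and lim: "AE x in lebesgue. x \<in> {0..<1} \<longrightarrow> (\<lambda>n. F n x) \<longlonglongrightarrow> f x"
    have fm: "(\<lambda>p. f (fst p) * indicator G p) \<in> borel_measurable (lam M)"
      by (intro borel_measurable_times measurable_compose[OF fst_measurable_lam f]) measurable
    have lm: "AE p in lam M. (\<lambda>n. F n (fst p) * indicator G p) \<longlonglongrightarrow> f (fst p) * indicator G p"
      using AE_lam_fst[OF lim] AE_lam_Y by eventually_elim (auto intro: tendsto_intros)
    have bd: "AE p in lam M. norm (F n (fst p) * indicator G p) \<le> B * norm (indicator G p :: complex)" for n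
      using B by (auto simp: norm_mult intro!: mult_right_mono)
    note dc = L2_dominated_convergence[where F = "\<lambda>n p. F n (fst p) * indicator G p",
        OF GL fm L2_measurable[OF l2_cspan_L2[OF F]] bd lm]
    show "(\<lambda>p. f (fst p) * indicator G p) \<in> ?V"
      by (rule l2_cspan_limit[OF EL dc(1) F dc(2)])
  qed
  \<comment> \<open>A point of the graph is determined by x, so on \<open>G\<close> a measurable set
    of points is cut out by a measurable set of first coordinates.\<close>
  have mult': "(\<lambda>p. indicator A p * indicator G p) \<in> ?V" if A[measurable]: "A \<in> sets (lam M)" for A
  proof -
    have m: "(\<lambda>x. (x, s x)) -` A \<in> sets lebesgue"
      using measurable_sets[OF sm A] by simp
    have "(\<lambda>p. indicator A p * indicator G p) = (\<lambda>p. indicator ((\<lambda>x. (x, s x)) -` A) (fst p) * indicator G p :: complex)"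
    proof (rule ext)
      fix p
      have "p = (fst p, s (fst p))" if "p \<in> G" using that by (cases p) (simp add: G)
      then show "indicator A p * indicator G p = (indicator ((\<lambda>x. (x, s x)) -` A) (fst p) * indicator G p :: complex)"
        by (cases "p \<in> G") (auto simp: indicator_def)
    qed
    then show ?thesis using mult[OF m] by simp
  qed
  show "supp_space G \<subseteq> ?V"
  proof
    fix f assume "f \<in> supp_space G"
    then have f: "f \<in> L2 (lam M)" and f0: "AE p in lam M. p \<notin> G \<longrightarrow> f p = 0"
      by (auto simp: supp_space_def)
    note [measurable] = f[THEN L2_measurable]
    \<comment> \<open>With base point 0 the metric estimate is the domination of the approximants by
      \<open>2 * norm (f p)\<close>.\<close>
    obtain S where S: "\<And>i. simple_function (lam M) (S i)"
      "\<And>p. (\<lambda>i. S i p) \<longlonglongrightarrow> f p" "\<And>i p. dist (S i p) 0 \<le> 2 * dist (f p) 0"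
      using borel_measurable_implies_sequence_metric[OF L2_measurable[OF f], of 0] by auto
    have SV: "(\<lambda>p. S i p * indicator G p) \<in> ?V" for i
    proof -
      have "(\<lambda>p. \<Sum>y\<in>range (S i). y * (indicator (S i -` {y}) p * indicator G p)) \<in> ?V"
        using S(1)[of i] by (intro l2_cspan_sum[OF EL] mult') (auto dest: simple_functionD)
      moreover have "S i p * indicator G p = (\<Sum>y\<in>range (S i). y * (indicator (S i -` {y}) p * indicator G p))" for p
      proof -
        have "S i p * indicator G p = (\<Sum>y\<in>range (S i). indicator (S i -` {y}) p *\<^sub>R y) * indicator G p"
          by (subst simple_function_indicator_representation_banach[OF S(1)[of i], of p]) simp_all
        also have "\<dots> = (\<Sum>y\<in>range (S i). y * (indicator (S i -` {y}) p * indicator G p))"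
          unfolding sum_distrib_right by (intro sum.cong refl) (simp add: indicator_def)
        finally show ?thesis .
      qed
      ultimately show ?thesis by simp
    qed
    have bd: "AE p in lam M. norm (S i p * indicator G p) \<le> 2 * norm (f p)" for i
    proof (rule AE_I2)
      fix p
      have "norm (S i p * indicator G p) \<le> norm (S i p)" by (simp add: norm_mult indicator_def)
      then show "norm (S i p * indicator G p) \<le> 2 * norm (f p)" using S(3)[of i p] by simp
    qed
    have lm: "AE p in lam M. (\<lambda>i. S i p * indicator G p) \<longlonglongrightarrow> f p"
      using f0
    proof eventually_elim
      case (elim p)
      have "(\<lambda>i. S i p * indicator G p) \<longlonglongrightarrow> f p * indicator G p" by (intro tendsto_intros S(2))
      then show ?case using elim by (cases "p \<in> G") auto
    qed
    note dc = L2_dominated_convergence[where F = "\<lambda>i p. S i p * indicator G p",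
        OF f L2_measurable[OF f] L2_measurable[OF l2_cspan_L2[OF SV]] bd lm]
    show "f \<in> ?V" by (rule l2_cspan_limit[OF EL f SV dc(2)])
  qed
qed

subsection \<open>Multiresolution analysis and wavelet\<close>

lemma Ft_eq: "Ft M = {p. fst p \<in> {0..<1} \<and> snd p = chosen M (fst p)}"
  by (auto simp: Ft_def)

lemma chosen_in_Aset: "chosen M x \<in> Aset M x"
  unfolding Aset_def by (rule CollectI, rule exI[of _ "[]"]) simp

lemma Ft_sets [measurable]: "Ft M \<in> sets (lam M)"
  unfolding Ft_eq by (rule graph_sets) measurable

definition other :: "real \<Rightarrow> word" where
  "other x = sel [\<not> choose_dig M x] x"

lemma other_measurable [measurable]: "other \<in> lebesgue \<rightarrow>\<^sub>M Omega_M"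
proof -
  have "other = (\<lambda>x. if choose_dig M x then sel [False] x else sel [True] x)"
    by (auto simp: other_def fun_eq_iff)
  then show ?thesis by simp
qed

lemma other_in_Aset: "other x \<in> Aset M x"
  by (auto simp: other_def Aset_eq)

text \<open>A tail of the chosen path is the chosen path of the point reached. This one-sided
  invariance is what makes the levels nested.\<close>

lemma ri_Ft: "p \<in> Ft M \<Longrightarrow> ri p \<in> Ft M"
proof -
  assume p: "p \<in> Ft M"
  then have w: "snd p = case_nat (choose_dig M (fst p)) (chosen M (tau (choose_dig M (fst p)) (fst p)))"
    using chosen_unfold[of M "fst p"] by (simp add: Ft_eq)
  have "fst (ri p) \<in> {0..<1}" using p by (intro fst_ri) (simp add: Ft_eq)
  then show ?thesis by (simp add: Ft_eq ri_def w)
qed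

lemma Pt_iff: "p \<in> Pt M \<longleftrightarrow> fst p \<in> {0..<1} \<and> ri p \<in> Ft M \<and> p \<notin> Ft M"
proof
  assume "p \<in> Pt M"
  then obtain q where q: "q \<in> Ft M" "p = rt q" "p \<notin> Ft M" by (auto simp: Pt_def)
  then show "fst p \<in> {0..<1} \<and> ri p \<in> Ft M \<and> p \<notin> Ft M"
    using fst_rt[of q] ri_rt[of q] by (simp add: Ft_eq)
next
  assume p: "fst p \<in> {0..<1} \<and> ri p \<in> Ft M \<and> p \<notin> Ft M"
  then have "p = rt (ri p)" using rt_ri[of p] by simp
  then have "p \<in> rt ` Ft M" using p by blast
  with p show "p \<in> Pt M" by (simp add: Pt_def)
qed

lemma case_nat_eq_iff:
  fixes w v :: word
  shows "w = case_nat b v \<longleftrightarrow> w 0 = b \<and> (\<lambda>n. w (Suc n)) = v"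
  by (auto simp: fun_eq_iff split: nat.split)

text \<open>A point of the image of \<open>Ft M\<close> has a word whose tail is chosen after its
  first letter; being off \<open>Ft M\<close> then forces that letter to be the rejected
  digit.\<close>

lemma Pt_eq: "Pt M = {p. fst p \<in> {0..<1} \<and> snd p = other (fst p)}"
proof (intro set_eqI)
  fix p
  show "p \<in> Pt M \<longleftrightarrow> p \<in> {p. fst p \<in> {0..<1} \<and> snd p = other (fst p)}"
  proof (cases "fst p \<in> {0..<1}")
    case True
    let ?x = "fst p" and ?w = "snd p"
    have r: "ri p \<in> Ft M \<longleftrightarrow> (\<lambda>n. ?w (Suc n)) = chosen M (tau (?w 0) ?x)"
      using fst_ri[OF True] by (auto simp: Ft_eq ri_def)
    have f: "p \<in> Ft M \<longleftrightarrow> ?w 0 = choose_dig M ?x \<and> (\<lambda>n. ?w (Suc n)) = chosen M (tau (choose_dig M ?x) ?x)"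
      unfolding Ft_eq case_nat_eq_iff[symmetric] chosen_unfold[of M ?x, symmetric] using True by simp
    have o: "?w = other ?x \<longleftrightarrow> ?w 0 = (\<not> choose_dig M ?x) \<and> (\<lambda>n. ?w (Suc n)) = chosen M (tau (\<not> choose_dig M ?x) ?x)"
      unfolding other_def sel_def prepend_Cons prepend_Nil tau_list_Cons tau_list_Nil case_nat_eq_iff ..
    show ?thesis unfolding Pt_iff r f mem_Collect_eq o using True
      by (cases "?w 0"; cases "choose_dig M ?x") (simp_all del: atLeastLessThan_iff)
  next
    case False
    then show ?thesis by (simp only: Pt_iff mem_Collect_eq) simp
  qed
qed

lemma Pt_sets [measurable]: "Pt M \<in> sets (lam M)"
  unfolding Pt_eq by (rule graph_sets) measurable

lemma phit_L2: "phit M \<in> L2 (lam M)"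
  unfolding phit_def by (rule indicator_graph_L2[OF chosen_measurable chosen_in_Aset Ft_eq])

text \<open>The image of \<open>Ft M\<close> under the dilation to the power -j, written as a
  preimage so that measurability is immediate. In this indexing the sets decrease as j
  grows.\<close>

definition level :: "int \<Rightarrow> pt set" where
  "level j = {p. fst p \<in> {0..<1} \<and> Rz j p \<in> Ft M}"

lemma Collect_Rz_sets:
  "G \<in> sets (lam M) \<Longrightarrow> {p. fst p \<in> {0..<1} \<and> Rz j p \<in> G} \<in> sets (lam M)"
proof -
  assume [measurable]: "G \<in> sets (lam M)"
  have "Measurable.pred (lam M) (\<lambda>p. fst p \<in> {0..<1} \<and> Rz j p \<in> G)"
    by (intro pred_intros_logic pred_fst_lam) measurable
  then show ?thesis by (simp add: pred_def)
qed

lemma level_sets [measurable]: "level j \<in> sets (lam M)"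
  unfolding level_def by (rule Collect_Rz_sets) measurable

lemma level_antimono_step: "level (j + 1) \<subseteq> level j"
proof
  fix p assume p: "p \<in> level (j + 1)"
  then show "p \<in> level j"
    using ri_Rz[of p "j + 1"] ri_Ft[of "Rz (j + 1) p"] by (simp add: level_def)
qed

lemma level_antimono: "i \<le> j \<Longrightarrow> level j \<subseteq> level i"
proof (induction j rule: int_ge_induct)
  case (step j)
  then show ?case using level_antimono_step[of j] by blast
qed simp

lemma dil_supp:
  assumes "f \<in> supp_space G"
  shows "dil j f \<in> supp_space {p. fst p \<in> {0..<1} \<and> Rz j p \<in> G}"
proof -
  have "AE p in lam M. p \<notin> G \<longrightarrow> f p = 0" using assms by (simp add: supp_space_def)
  from AE_lam_Rz[OF this, of j] AE_lam_Y
  have "AE p in lam M. p \<notin> {p. fst p \<in> {0..<1} \<and> Rz j p \<in> G} \<longrightarrow> dil j f p = 0"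
    by eventually_elim (auto simp: dil_def)
  then show ?thesis using assms by (simp add: supp_space_def dil_L2)
qed

lemma dil_uminus_supp:
  assumes "f \<in> supp_space {p. fst p \<in> {0..<1} \<and> Rz j p \<in> G}"
  shows "dil (- j) f \<in> supp_space G"
proof -
  have f: "AE p in lam M. p \<notin> {p. fst p \<in> {0..<1} \<and> Rz j p \<in> G} \<longrightarrow> f p = 0"
    using assms by (simp add: supp_space_def)
  from AE_lam_Rz[OF f, of "- j"] AE_lam_Y
  have "AE p in lam M. p \<notin> G \<longrightarrow> dil (- j) f p = 0"
    by eventually_elim (auto simp: dil_def Rz_Rz)
  then show ?thesis using assms by (simp add: supp_space_def dil_L2)
qed

lemma V0_eq: "V0 M = supp_space (Ft M)"
  unfolding V0_def
proof (rule graph_cspan[OF chosen_measurable chosen_in_Aset Ft_eq])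
  show "l2_zpow (lam M) Tt k (phit M) \<in> L2 (lam M)" for k
    by (rule l2_zpow_Tt(1)[OF phit_L2])
  show "AE p in lam M. l2_zpow (lam M) Tt k (phit M) p = ch k (fst p) * indicator (Ft M) p" for k
    using l2_zpow_Tt(2)[OF phit_L2, of k] by (simp add: phit_def)
qed

lemma Tt_phit_orthonormal: "l2_orthonormal (lam M) (\<lambda>k. l2_zpow (lam M) Tt k (phit M))"
  unfolding l2_orthonormal_def
proof (intro conjI allI)
  show "l2_zpow (lam M) Tt k (phit M) \<in> L2 (lam M)" for k
    by (rule l2_zpow_Tt(1)[OF phit_L2])
  then show "l2_inner (lam M) (l2_zpow (lam M) Tt j (phit M)) (l2_zpow (lam M) Tt k (phit M)) = (if j = k then 1 else 0)" for j k
    using l2_zpow_Tt(2)[OF phit_L2]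
    by (intro graph_orthonormal[OF chosen_measurable chosen_in_Aset Ft_eq]) (auto simp: phit_def)
qed

lemma Vn_eq: "Vn M n = supp_space (level (- n))"
proof (intro set_eqI iffI)
  fix f assume "f \<in> Vn M n"
  then obtain g where f: "f \<in> L2 (lam M)" and g: "g \<in> supp_space (Ft M)"
    and fg: "AE p in lam M. f p = l2_zpow (lam M) Ut (- n) g p"
    by (auto simp: Vn_def V0_eq)
  have gL: "g \<in> L2 (lam M)" using g by (simp add: supp_space_def)
  have "AE p in lam M. p \<notin> level (- n) \<longrightarrow> dil (- n) g p = 0"
    using dil_supp[OF g, of "- n"] by (simp add: supp_space_def level_def)
  with fg l2_zpow_Ut(2)[OF gL, of "- n"]
  have "AE p in lam M. p \<notin> level (- n) \<longrightarrow> f p = 0" by eventually_elim simp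
  with f show "f \<in> supp_space (level (- n))" by (simp add: supp_space_def)
next
  fix f assume f: "f \<in> supp_space (level (- n))"
  then have fL: "f \<in> L2 (lam M)" by (simp add: supp_space_def)
  have g: "dil n f \<in> V0 M"
    using dil_uminus_supp[of f "- n"] f by (simp add: V0_eq level_def)
  from l2_zpow_Ut(2)[OF dil_L2[OF fL], of "- n" n] dil_dil[of "- n" n f]
  have "AE p in lam M. f p = l2_zpow (lam M) Ut (- n) (dil n f) p"
    by eventually_elim (simp add: dil_def)
  with g fL show "f \<in> Vn M n" unfolding Vn_def by blast
qed

lemma Vn_subset: "Vn M n \<subseteq> Vn M (n + 1)"
  unfolding Vn_eq using level_antimono[of "- (n + 1)" "- n"] by (auto simp: supp_space_def)

text \<open>Each application of \<open>ri\<close> consumes one letter of the prefix; when the prefix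
  is used up, the chosen path remains.\<close>

lemma Xt_level: "p \<in> Xt M \<Longrightarrow> \<exists>n::nat. p \<in> level (- int n)"
proof -
  assume p: "p \<in> Xt M"
  have *: "fst p \<in> {0..<1} \<Longrightarrow> snd p = sel eta (fst p) \<Longrightarrow> (ri ^^ length eta) p \<in> Ft M" for eta
  proof (induction eta arbitrary: p)
    case Nil
    then show ?case by (simp add: Ft_eq sel_def)
  next
    case (Cons b eta)
    have "snd p = case_nat b (sel eta (tau b (fst p)))"
      using Cons.prems(2) by (simp add: sel_def prepend_Cons)
    then have "fst (ri p) = tau b (fst p)" "snd (ri p) = sel eta (fst (ri p))"
      by (auto simp: ri_def)
    then have "(ri ^^ length eta) (ri p) \<in> Ft M"
      using Cons.IH[of "ri p"] fst_ri[OF Cons.prems(1)] by simp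
    then show ?case by (simp add: funpow_Suc_right del: funpow.simps(2))
  qed
  from p obtain eta where eta: "fst p \<in> {0..<1}" "snd p = sel eta (fst p)" by (auto simp: Xt_iff)
  have "Rz (- int (length eta)) p = (ri ^^ length eta) p"
    by (cases "length eta = 0") (simp_all add: Rz_def)
  then show ?thesis using *[OF eta] eta(1) by (auto simp: level_def intro!: exI[of _ "length eta"])
qed

lemma level_approx:
  assumes f: "f \<in> L2 (lam M)"
  shows "(\<lambda>n. \<integral>p. (norm (f p - indicator (level (- int n)) p * f p))\<^sup>2 \<partial>lam M) \<longlonglongrightarrow> 0"
proof (rule L2_dominated_convergence(2)[OF f L2_measurable[OF f], where B = 1])
  show "(\<lambda>p. indicator (level (- int n)) p * f p) \<in> borel_measurable (lam M)" for n
    by (rule L2_measurable[OF L2_indicator_mult[OF f]]) measurable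
  show "AE p in lam M. norm (indicator (level (- int n)) p * f p) \<le> 1 * norm (f p)" for n
    by (rule AE_I2) (simp add: indicator_def)
  show "AE p in lam M. (\<lambda>n. indicator (level (- int n)) p * f p) \<longlonglongrightarrow> f p"
    using AE_lam_Xt
  proof eventually_elim
    case (elim p)
    then obtain N :: nat where N: "p \<in> level (- int N)" using Xt_level by blast
    have "indicator (level (- int n)) p * f p = f p" if "n \<ge> N" for n
      using N level_antimono[of "- int n" "- int N"] that by auto
    then have "\<forall>\<^sub>F n in sequentially. indicator (level (- int n)) p * f p = f p"
      unfolding eventually_sequentially by blast
    then show ?case by (rule tendsto_eventually)
  qed
qed

lemma Vn_dense:
  assumes f: "f \<in> L2 (lam M)" and "\<epsilon> > 0"
  shows "\<exists>n. \<exists>g\<in>Vn M n. l2_norm (lam M) (\<lambda>p. f p - g p) < \<epsilon>"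
proof -
  have "\<forall>\<^sub>F n in sequentially. (\<integral>p. (norm (f p - indicator (level (- int n)) p * f p))\<^sup>2 \<partial>lam M) < \<epsilon>\<^sup>2"
    by (rule order_tendstoD(2)[OF level_approx[OF f]]) (use assms in simp)
  then obtain n :: nat where n: "(\<integral>p. (norm (f p - indicator (level (- int n)) p * f p))\<^sup>2 \<partial>lam M) < \<epsilon>\<^sup>2"
    by (auto simp: eventually_sequentially)
  have "(\<lambda>p. indicator (level (- int n)) p * f p) \<in> Vn M (int n)"
    unfolding Vn_eq supp_space_def using L2_indicator_mult[OF f level_sets] by auto
  with n show ?thesis using l2_norm_less_iff[OF \<open>\<epsilon> > 0\<close>] by blast
qed

text \<open>By the scaling of integrals, the n-th level has 2^(-n) times the finite measure of
  \<open>Ft M\<close>, so the intersection of all levels is null. Both the trivial intersection of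
  the resolution spaces and the wavelet partition depend on this.\<close>

lemma AE_not_all_levels: "AE p in lam M. \<exists>j. p \<notin> level j"
proof -
  let ?N = "\<Inter>n::nat. level (int n)"
  let ?I = "indicator (Ft M) :: pt \<Rightarrow> real"
  have int: "integrable (lam M) ?I"
  proof -
    have "(norm (phit M p))\<^sup>2 = ?I p" for p by (simp add: phit_def indicator_def)
    then show ?thesis using L2_integrable[OF phit_L2] by simp
  qed
  have Rint: "integrable (lam M) (\<lambda>p. ?I (Rz j p))" for j
    using integral_Rz[of ?I j] int by simp
  have N[measurable]: "?N \<in> sets (lam M)" by measurable
  have le: "indicator ?N p \<le> ?I (Rz (int n) p)" for n p
    by (auto simp: indicator_def level_def)
  have Nint: "integrable (lam M) (indicator ?N :: pt \<Rightarrow> real)"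
  proof (rule Bochner_Integration.integrable_bound[OF Rint[of "int 0"] borel_measurable_indicator[OF N]])
    show "AE p in lam M. norm (indicator ?N p :: real) \<le> norm (?I (Rz (int 0) p))"
      using le[of _ 0] by (intro AE_I2) simp
  qed
  have "(\<integral>p. indicator ?N p \<partial>lam M) \<le> 2 powr (- real n) * (\<integral>p. ?I p \<partial>lam M)" for n
  proof -
    have "(\<integral>p. indicator ?N p \<partial>lam M) \<le> (\<integral>p. ?I (Rz (int n) p) \<partial>lam M)"
      by (rule integral_mono[OF Nint Rint le])
    then show ?thesis using integral_Rz[of ?I "int n"] by simp
  qed
  moreover have "(\<lambda>n. 2 powr (- real n) * (\<integral>p. ?I p \<partial>lam M)) \<longlonglongrightarrow> 0"
  proof -
    have "(\<lambda>n. (1/2) ^ n * (\<integral>p. ?I p \<partial>lam M)) \<longlonglongrightarrow> 0 * (\<integral>p. ?I p \<partial>lam M)"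
      by (intro tendsto_intros LIMSEQ_power_zero) simp
    then show ?thesis by (simp add: powr_minus powr_realpow power_one_over inverse_eq_divide)
  qed
  ultimately have "(\<integral>p. indicator ?N p \<partial>lam M) \<le> (0::real)"
    by (intro LIMSEQ_le_const[of _ 0]) auto
  then have "(\<integral>p. indicator ?N p \<partial>lam M) = (0::real)"
    by (intro antisym integral_nonneg_AE) auto
  then have "AE p in lam M. indicator ?N p = (0::real)"
    using integral_nonneg_eq_0_iff_AE[OF Nint] by simp
  then show ?thesis by eventually_elim (auto simp: indicator_def)
qed

lemma Vn_Inter:
  assumes "\<And>n. f \<in> Vn M n"
  shows "AE p in lam M. f p = 0"
proof -
  have "AE p in lam M. p \<notin> level j \<longrightarrow> f p = 0" for j
    using assms[of "- j"] by (simp add: Vn_eq supp_space_def)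
  then have "AE p in lam M. \<forall>j. p \<notin> level j \<longrightarrow> f p = 0" unfolding AE_all_countable by blast
  with AE_not_all_levels show ?thesis by eventually_elim auto
qed

section \<open>The dilates of the wavelet set and the orthonormal wavelet basis\<close>

definition wlevel :: "int \<Rightarrow> pt set" where
  "wlevel j = {p. fst p \<in> {0..<1} \<and> Rz j p \<in> Pt M}"

lemma wlevel_sets [measurable]: "wlevel j \<in> sets (lam M)"
  unfolding wlevel_def by (rule Collect_Rz_sets) measurable

text \<open>By \<open>Pt_iff\<close> the wavelet set consists of points one step of
  \<open>ri\<close> away from \<open>Ft M\<close> but off it, so its dilates are the successive
  differences of a decreasing chain.\<close>

lemma wlevel_eq: "wlevel j = level (j - 1) - level j"
  unfolding wlevel_def level_def Pt_iff
  using ri_Rz[of _ j] fst_Rz[of _ j] by (auto simp del: atLeastLessThan_iff)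

lemma wlevel_disjoint: "p \<in> wlevel i \<Longrightarrow> p \<in> wlevel j \<Longrightarrow> i = j"
proof (induction i j rule: linorder_wlog)
  case (le i j)
  show ?case
  proof (rule ccontr)
    assume "i \<noteq> j"
    then have "level (j - 1) \<subseteq> level i" using le(1) by (intro level_antimono) simp
    then show False using le by (auto simp: wlevel_eq)
  qed
qed auto

lemma AE_wlevel: "AE p in lam M. \<exists>j. p \<in> wlevel j"
  using AE_lam_Xt AE_not_all_levels
proof eventually_elim
  case (elim p)
  then obtain a b where a: "p \<in> level a" and b: "p \<notin> level b" using Xt_level by blast
  then have "a < b" using level_antimono[of b a] by (cases "a < b") auto
  \<comment> \<open>The first place where p leaves the decreasing chain, counted from a level
    containing p so that the search runs over the naturals; hence it cannot be 0.\<close>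
  define n where "n = (LEAST n. p \<notin> level (a + int n))"
  have "a + int (nat (b - a)) = b" using \<open>a < b\<close> by simp
  then have ex: "p \<notin> level (a + int (nat (b - a)))" using b by (simp only: not_False_eq_True)
  have n1: "p \<notin> level (a + int n)" unfolding n_def by (rule LeastI[of "\<lambda>n. p \<notin> level (a + int n)", OF ex])
  then have "n \<noteq> 0" using a by (auto intro: ccontr)
  then have "p \<in> level (a + int (n - 1))"
    using not_less_Least[of "n - 1" "\<lambda>n. p \<notin> level (a + int n)"] by (auto simp: n_def)
  moreover have "a + int (n - 1) = (a + int n) - 1" using \<open>n \<noteq> 0\<close> by simp
  ultimately have "p \<in> level ((a + int n) - 1)" by (simp only:)
  then have "p \<in> wlevel (a + int n)" unfolding wlevel_eq using n1 by blast
  then show ?case by blast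
qed

text \<open>Different scales are orthogonal by disjoint supports. Within one scale, dilation
  transports the basis on \<open>Pt M\<close>, and summing over finitely many scales converges
  because almost every point lies in a single scale. Stated for any function equal a.e. to the
  indicator, since \<open>psit M\<close> is defined by a choice.\<close>

lemma wavelet_basis:
  assumes psi: "psi \<in> L2 (lam M)" "AE p in lam M. psi p = indicator (Pt M) p"
  shows "l2_onb_of (lam M) (\<lambda>(j, k). l2_zpow (lam M) Ut j (l2_zpow (lam M) Tt k psi)) (L2 (lam M))"
proof -
  define t where "t k = l2_zpow (lam M) Tt k psi" for k
  define e where "e = (\<lambda>(j, k). l2_zpow (lam M) Ut j (t k))"
  have tL: "t k \<in> L2 (lam M)" for k unfolding t_def by (rule l2_zpow_Tt(1)[OF psi(1)])
  have tP: "AE p in lam M. t k p = ch k (fst p) * indicator (Pt M) p" for k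
    using l2_zpow_Tt(2)[OF psi(1), of k] psi(2) unfolding t_def by eventually_elim simp
  have eL: "e i \<in> L2 (lam M)" for i by (cases i) (simp add: e_def l2_zpow_Ut(1)[OF tL])
  have eD: "AE p in lam M. e (j, k) p = dil j (t k) p" for j k
    unfolding e_def using l2_zpow_Ut(2)[OF tL] by simp
  have EL: "range e \<subseteq> L2 (lam M)" using eL by auto
  have inner: "l2_inner (lam M) (t j) (t k) = (if j = k then 1 else 0)" for j k
    by (rule graph_orthonormal[OF other_measurable other_in_Aset Pt_eq tL tP])
  have tS: "t k \<in> supp_space (Pt M)" for k
    using tL tP[of k] by (auto simp: supp_space_def)
  have dS: "dil j (t k) \<in> supp_space (wlevel j)" for j k
    using dil_supp[OF tS] by (simp add: wlevel_def)
  have orth: "l2_orthonormal (lam M) e"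
    unfolding l2_orthonormal_def
  proof (intro conjI allI eL)
    fix a b :: "int \<times> int"
    obtain i k j l where ab: "a = (i, k)" "b = (j, l)" by (cases a, cases b)
    have "l2_inner (lam M) (e a) (e b) = l2_inner (lam M) (dil i (t k)) (dil j (t l))"
      unfolding ab by (intro l2_inner_AE_cong L2_measurable eL dil_L2 tL eD)
    also have "\<dots> = (if a = b then 1 else 0)"
    proof (cases "i = j")
      case True
      then show ?thesis by (simp add: ab l2_inner_dil[OF tL tL] inner)
    next
      case False
      have s1: "AE p in lam M. p \<notin> wlevel i \<longrightarrow> dil i (t k) p = 0"
        and s2: "AE p in lam M. p \<notin> wlevel j \<longrightarrow> dil j (t l) p = 0"
        using dS by (auto simp: supp_space_def)
      have "AE p in lam M. dil i (t k) p * cnj (dil j (t l) p) = 0"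
        using s1 s2 by eventually_elim (use False wlevel_disjoint in force)
      then have "l2_inner (lam M) (dil i (t k)) (dil j (t l)) = 0"
        unfolding l2_inner_def by (rule integral_eq_zero_AE)
      then show ?thesis using False by (simp add: ab)
    qed
    finally show "l2_inner (lam M) (e a) (e b) = (if a = b then 1 else 0)" .
  qed
  let ?W = "l2_cspan (lam M) (range e)"
  have tspan: "l2_cspan (lam M) (range t) = supp_space (Pt M)"
    by (rule graph_cspan[OF other_measurable other_in_Aset Pt_eq tL tP])
  have eW: "e a \<in> ?W" for a by (rule l2_cspan_lin_combs[OF EL lin_combs_base]) simp
  have piece: "(\<lambda>p. indicator (wlevel j) p * f p) \<in> ?W" if f: "f \<in> L2 (lam M)" for f j
  proof -
    let ?h = "\<lambda>p. indicator (wlevel j) p * f p"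
    have hL: "?h \<in> L2 (lam M)" by (rule L2_indicator_mult[OF f wlevel_sets])
    have "?h \<in> supp_space {p. fst p \<in> {0..<1} \<and> Rz j p \<in> Pt M}"
      unfolding supp_space_def wlevel_def[symmetric] using hL by simp
    from dil_uminus_supp[OF this] have gs: "dil (- j) ?h \<in> l2_cspan (lam M) (range t)"
      by (simp add: tspan)
    have gL: "dil (- j) ?h \<in> L2 (lam M)" by (rule dil_L2[OF hL])
    show ?thesis
    proof (rule l2_cspan_closed[OF EL hL])
      fix \<epsilon> :: real assume "\<epsilon> > 0"
      then obtain u where u: "u \<in> lin_combs (range t)"
        "(\<integral>p. (norm (dil (- j) ?h p - u p))\<^sup>2 \<partial>lam M) < \<epsilon>"
        using gs unfolding l2_cspan_iff by blast
      have uL: "u \<in> L2 (lam M)" by (rule lin_combs_L2[OF _ u(1)]) (use tL in auto)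
      obtain K c where K: "finite K" "K \<subseteq> range t" "u = (\<lambda>p. \<Sum>g\<in>K. c g * g p)"
        using u(1) by (auto simp: lin_combs_def)
      have "dil j g \<in> ?W" if "g \<in> K" for g
      proof -
        obtain k where "g = t k" using K(2) \<open>g \<in> K\<close> by auto
        moreover have "dil j (t k) \<in> ?W"
        proof (rule l2_cspan_AE_cong[OF EL L2_measurable[OF dil_L2[OF tL]] eW])
          show "AE p in lam M. dil j (t k) p = e (j, k) p"
            using eD[of j k] by eventually_elim simp
        qed
        ultimately show ?thesis by simp
      qed
      then have "(\<lambda>p. \<Sum>g\<in>K. c g * dil j g p) \<in> ?W" by (intro l2_cspan_sum[OF EL])
      moreover have "(\<lambda>p. \<Sum>g\<in>K. c g * dil j g p) = dil j u"
        by (auto simp: dil_def K(3) sum_distrib_left mult_ac)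
      ultimately have dW: "dil j u \<in> ?W" by simp
      have "AE p in lam M. (norm (?h p - dil j u p))\<^sup>2 = (norm (dil j (\<lambda>p. dil (- j) ?h p - u p) p))\<^sup>2"
        using dil_dil[of j "- j" ?h]
      proof eventually_elim
        case (elim p)
        have "dil j (\<lambda>p. dil (- j) ?h p - u p) p = dil j (dil (- j) ?h) p - dil j u p"
          by (simp add: dil_def[of j] algebra_simps)
        also have "\<dots> = ?h p - dil j u p" using elim by (simp add: dil_def[of 0])
        finally show ?case by simp
      qed
      then have "(\<integral>p. (norm (?h p - dil j u p))\<^sup>2 \<partial>lam M)
          = (\<integral>p. (norm (dil j (\<lambda>p. dil (- j) ?h p - u p) p))\<^sup>2 \<partial>lam M)"
        by (rule integral_cong_AE[OF
              borel_measurable_integrable[OF L2_integrable[OF L2_diff[OF hL dil_L2[OF uL]]]]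
              borel_measurable_integrable[OF L2_integrable[OF dil_L2[OF L2_diff[OF gL uL]]]]])
      also have "\<dots> = (\<integral>p. (norm (dil (- j) ?h p - u p))\<^sup>2 \<partial>lam M)"
        by (rule dil_norm_sq[OF L2_diff[OF gL uL]])
      finally show "\<exists>g\<in>?W. (\<integral>p. (norm (?h p - g p))\<^sup>2 \<partial>lam M) < \<epsilon>"
        using u(2) dW by (intro bexI[of _ "dil j u"]) auto
    qed
  qed
  have "L2 (lam M) \<subseteq> ?W"
  proof
    fix f assume f: "f \<in> L2 (lam M)"
    \<comment> \<open>The factor 1 gives the sum the shape of a combination with coefficients, as in
      \<open>l2_cspan_sum\<close>.\<close>
    define F where "F n p = (\<Sum>j\<in>{- int n..int n}. 1 * (indicator (wlevel j) p * f p))" for n p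
    have FW: "F n \<in> ?W" for n
      unfolding F_def[abs_def] by (rule l2_cspan_sum[OF EL piece[OF f]])
    have Fval: "F n p = (if j \<in> {- int n..int n} then f p else 0)" if "p \<in> wlevel j" for n p j
    proof -
      have "F n p = (\<Sum>i\<in>{- int n..int n}. if i = j then f p else 0)"
        unfolding F_def
      proof (intro sum.cong refl)
        fix i
        have "p \<in> wlevel i \<longleftrightarrow> i = j" using that wlevel_disjoint by blast
        then show "1 * (indicator (wlevel i) p * f p) = (if i = j then f p else 0)"
          by (simp add: indicator_def)
      qed
      then show ?thesis by simp
    qed
    have bd: "AE p in lam M. norm (F n p) \<le> 1 * norm (f p)" for n
      using AE_wlevel by eventually_elim (auto simp: Fval)
    have lm: "AE p in lam M. (\<lambda>n. F n p) \<longlonglongrightarrow> f p"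
      using AE_wlevel
    proof eventually_elim
      case (elim p)
      then obtain j where j: "p \<in> wlevel j" by blast
      have "F n p = f p" if "n \<ge> nat \<bar>j\<bar>" for n
      proof -
        have "j \<in> {- int n..int n}" using that by auto
        then show ?thesis by (simp only: Fval[OF j] if_True)
      qed
      then have "\<forall>\<^sub>F n in sequentially. F n p = f p" unfolding eventually_sequentially by blast
      then show ?case by (rule tendsto_eventually)
    qed
    note dc = L2_dominated_convergence(2)[OF f L2_measurable[OF f] L2_measurable[OF l2_cspan_L2[OF FW]] bd lm]
    show "f \<in> ?W" by (rule l2_cspan_limit[OF EL f FW dc])
  qed
  then have "?W = L2 (lam M)" using l2_cspan_L2 by blast
  with orth show ?thesis unfolding l2_onb_of_def e_def t_def by simp
qed

end

section \<open>The tiling condition, the scaling identity and the wavelet function\<close>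

lemma Per_eq_frac:
  assumes "M \<subseteq> {0..<1}"
  shows "Per M x = indicator M (frac x)"
proof -
  have "(\<Sum>\<^sub>\<infinity>k::int. indicator M (x + of_int k)) = (\<Sum>\<^sub>\<infinity>k\<in>{- \<lfloor>x\<rfloor>}. indicator M (x + of_int k) :: real)"
  proof (rule infsum_cong_neutral)
    fix k assume k: "k \<in> UNIV - {- \<lfloor>x\<rfloor>}"
    have "x + of_int k \<notin> M"
    proof
      assume "x + of_int k \<in> M"
      then have "0 \<le> x + of_int k" "x + of_int k < 1" using assms by auto
      then have "k = - \<lfloor>x\<rfloor>" by linarith
      with k show False by simp
    qed
    then show "indicator M (x + of_int k) = (0::real)" by simp
  qed auto
  then show ?thesis by (simp add: Per_def frac_def)
qed

locale scaling_tile = measurable_tile +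
  assumes M_sub: "M \<subseteq> {0..<1}"
    and M_disj: "M \<inter> ss ` M \<in> null_sets lebesgue"
    and M_cover: "{0..<1} - (M \<union> ss ` M) \<in> null_sets lebesgue"
begin

lemma m0_unit: "x \<in> {0..<1} \<Longrightarrow> m0 M x = indicator M x"
  using M_sub by (simp add: m0_def Per_eq_frac frac_eq)

lemma ss_eq: "x \<in> {0..<1} \<Longrightarrow> ss x = (if x < 1/2 then x + 1/2 else x - 1/2)"
proof (cases "x < 1/2")
  case False
  assume "x \<in> {0..<1}"
  then show ?thesis using False frac_1_eq[of "x - 1/2"] by (simp add: ss_def frac_eq add.commute)
qed (simp add: ss_def frac_eq)

lemma ss_image: "x \<in> {0..<1} \<Longrightarrow> x \<in> ss ` M \<longleftrightarrow> ss x \<in> M"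
proof
  assume x: "x \<in> {0..<1}" and "x \<in> ss ` M"
  then obtain y where y: "y \<in> M" "x = ss y" by auto
  then have "y \<in> {0..<1}" using M_sub by auto
  then have "ss x = y" using y(2) ss_eq[of y] ss_eq[OF x] by (auto split: if_splits)
  then show "ss x \<in> M" using y by simp
next
  assume x: "x \<in> {0..<1}" and m: "ss x \<in> M"
  then have "ss x \<in> {0..<1}" using M_sub by auto
  then have "ss (ss x) = x" using x ss_eq[OF x] ss_eq[of "ss x"] by (auto split: if_splits)
  then show "x \<in> ss ` M" using m by (metis image_eqI)
qed

text \<open>The left branch of r(x) is x or its half-translate, according to the digit of x, and
  a.e. exactly one of these two lies in \<open>M\<close>. So the convention in
  \<open>choose_dig\<close> selects x precisely when x belongs to \<open>M\<close>.\<close>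

lemma AE_choose_iff:
  "AE x in lebesgue. x \<in> {0..<1} \<longrightarrow> (choose_dig M (rr x) = digit_of x \<longleftrightarrow> x \<in> M)"
  using AE_not_in[OF M_disj] AE_not_in[OF M_cover]
proof eventually_elim
  case (elim x)
  show ?case
  proof
    assume x: "x \<in> {0..<1}"
    then have xor: "x \<in> M \<longleftrightarrow> ss x \<notin> M" using elim ss_image[OF x] by blast
    show "choose_dig M (rr x) = digit_of x \<longleftrightarrow> x \<in> M"
    proof (cases "digit_of x")
      case False
      then show ?thesis using tau_digit_rr[OF x] by (simp add: choose_dig_def)
    next
      case True
      then have "tau False (rr x) = ss x"
        using rr_eq[OF x] ss_eq[OF x] by (auto simp: tau_def dig_def digit_of_def)
      then show ?thesis using True xor by (simp add: choose_dig_def)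
    qed
  qed
qed

lemma rt_Ft_iff:
  assumes x: "fst q \<in> {0..<1}"
  shows "rt q \<in> Ft M \<longleftrightarrow> q \<in> Ft M \<and> choose_dig M (rr (fst q)) = digit_of (fst q)"
proof -
  have "rt q \<in> Ft M \<longleftrightarrow> case_nat (digit_of (fst q)) (snd q) = chosen M (rr (fst q))"
    by (simp add: Ft_eq rt_def)
  also have "\<dots> \<longleftrightarrow> choose_dig M (rr (fst q)) = digit_of (fst q) \<and> chosen M (tau (choose_dig M (rr (fst q))) (rr (fst q))) = snd q"
  proof -
    have inj: "case_nat a u = case_nat b v \<longleftrightarrow> b = a \<and> v = u" for a b and u v :: word
      by (subst case_nat_eq_iff) auto
    show ?thesis
      by (subst chosen_unfold) (rule inj)
  qed
  also have "\<dots> \<longleftrightarrow> q \<in> Ft M \<and> choose_dig M (rr (fst q)) = digit_of (fst q)"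
    using tau_digit_rr[OF x] x by (auto simp: Ft_eq)
  finally show ?thesis .
qed

lemma AE_rt_Ft: "AE q in lam M. rt q \<in> Ft M \<longleftrightarrow> q \<in> Ft M \<and> fst q \<in> M"
  using AE_lam_fst[OF AE_choose_iff] AE_lam_Y by eventually_elim (auto simp: rt_Ft_iff)

lemma Ut_phit: "AE p in lam M. Ut (phit M) p = complex_of_real (sqrt 2 * m0 M (fst p)) * phit M p"
  using AE_rt_Ft AE_lam_Y
  by eventually_elim (auto simp: Ut_def phit_def m0_unit indicator_def)

text \<open>The factors sqrt 2 and 2^(-1/2) cancel, leaving the condition that \<open>ri p\<close>
  lies on \<open>Ft M\<close> with first coordinate outside \<open>M\<close>. Reading
  \<open>AE_rt_Ft\<close> at \<open>ri p\<close> turns the latter into p being off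
  \<open>Ft M\<close>.\<close>

lemma psit_L2: "psit M \<in> L2 (lam M)"
  and psit_AE: "AE p in lam M. psit M p = indicator (Pt M) p"
proof -
  let ?g = "\<lambda>p. complex_of_real (sqrt 2 * (1 - m0 M (fst p))) * phit M p"
  have gm: "?g \<in> borel_measurable (lam M)"
  proof -
    have "(\<lambda>p. complex_of_real (sqrt 2) * (1 - indicator M (fst p)) * phit M p) \<in> borel_measurable (lam M)"
      unfolding phit_def by (intro borel_measurable_times borel_measurable_diff
          measurable_compose[OF fst_measurable_lam borel_measurable_indicator]) measurable
    moreover have "?g = (\<lambda>p. complex_of_real (sqrt 2) * (1 - indicator M (fst p)) * phit M p)"
      by (auto simp: fun_eq_iff phit_def Ft_eq m0_unit indicator_def)
    ultimately show ?thesis by simp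
  qed
  have gL: "?g \<in> L2 (lam M)"
    by (rule L2_dominated[OF phit_L2 gm, where B = "sqrt 2"])
       (auto simp: phit_def Ft_eq m0_unit indicator_def)
  show "psit M \<in> L2 (lam M)" unfolding psit_def by (rule l2_inv_unitary(1)[OF unitary_Ut gL])
  have R1: "Rz (-1) p = ri p" for p by (simp add: Rz_def)
  have "AE p in lam M. rt (ri p) \<in> Ft M \<longleftrightarrow> ri p \<in> Ft M \<and> fst (ri p) \<in> M"
    by (rule AE_lam_ri[OF AE_rt_Ft])
  with AE_lam_Y l2_inv_Ut[OF gL] show "AE p in lam M. psit M p = indicator (Pt M) p"
  proof eventually_elim
    case (elim p)
    have "2 powr (- 1 / 2) = 1 / sqrt 2"
      using powr_minus[of "2::real" "1/2"] by (simp add: powr_half_sqrt inverse_eq_divide)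
    then have "psit M p = complex_of_real (1 - m0 M (fst (ri p))) * phit M (ri p)"
      using elim(2) by (simp add: psit_def dil_def R1)
    also have "\<dots> = indicator (Pt M) p"
      using elim(1,3) rt_ri[OF elim(1)] m0_unit[OF fst_ri[OF elim(1)]]
      by (auto simp: phit_def Pt_iff indicator_def)
    finally show ?case .
  qed
qed

end

section \<open>Sigma-finiteness and bounded multipliers\<close>

context measurable_tile begin

lemma level_integrable: "integrable (lam M) (indicator (level j) :: pt \<Rightarrow> real)"
proof -
  have "(\<lambda>p. complex_of_real (1 / 2 powr (real_of_int j / 2)) * dil j (phit M) p) \<in> L2 (lam M)"
    by (rule L2_scale[OF dil_L2[OF phit_L2]])
  then have "integrable (lam M) (\<lambda>p. (norm (complex_of_real (1 / 2 powr (real_of_int j / 2)) * dil j (phit M) p))\<^sup>2)"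
    by (rule L2_integrable)
  then show ?thesis
  proof (rule Bochner_Integration.integrable_bound)
    show "AE p in lam M. norm (indicator (level j) p :: real)
      \<le> norm ((norm (complex_of_real (1 / 2 powr (real_of_int j / 2)) * dil j (phit M) p))\<^sup>2)"
      by (rule AE_I2) (simp add: dil_def phit_def level_def norm_mult indicator_def)
  qed (rule borel_measurable_indicator[OF level_sets])
qed

text \<open>The levels have finite measure and cover the fibred space; their null complement is
  added as one more set so that the cover is complete. This provides a strictly positive integrable
  function later.\<close>

lemma sigma_finite_lam: "sigma_finite_measure (lam M)"
proof
  let ?L = "range (\<lambda>n::nat. level (- int n))"
  let ?R = "UNIV - \<Union>?L"
  have R: "?R \<in> sets (lam M)" using sets.compl_sets[of "\<Union>?L" "lam M"] by simp
  have "AE p in lam M. p \<notin> ?R" using AE_lam_Xt by eventually_elim (use Xt_level in auto)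
  then have "?R \<in> null_sets (lam M)" by (subst AE_iff_null_sets[OF R])
  then have "emeasure (lam M) ?R = 0" by (simp add: null_sets_def)
  moreover have "emeasure (lam M) (level j) \<noteq> \<infinity>" for j
    using level_integrable[of j] by (simp add: integrable_indicator_iff)
  ultimately show "\<exists>A. countable A \<and> A \<subseteq> sets (lam M) \<and> \<Union>A = space (lam M) \<and> (\<forall>a\<in>A. emeasure (lam M) a \<noteq> \<infinity>)"
    using R by (intro exI[of _ "insert ?R ?L"]) auto
qed

text \<open>The a.e. bound is part of the notion, so that products with square integrable functions
  remain in the domain of \<open>P\<close>.\<close>

definition mult_comm :: "((pt \<Rightarrow> complex) \<Rightarrow> (pt \<Rightarrow> complex)) \<Rightarrow> (pt \<Rightarrow> complex) \<Rightarrow> bool" where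
  "mult_comm P g \<longleftrightarrow> g \<in> borel_measurable (lam M) \<and> (\<exists>B. AE p in lam M. norm (g p) \<le> B) \<and>
     (\<forall>f\<in>L2 (lam M). AE p in lam M. P (\<lambda>p. g p * f p) p = g p * P f p)"

lemma mult_comm_L2: "mult_comm P g \<Longrightarrow> f \<in> L2 (lam M) \<Longrightarrow> (\<lambda>p. g p * f p) \<in> L2 (lam M)"
proof -
  assume "mult_comm P g" and f: "f \<in> L2 (lam M)"
  then obtain B where g: "g \<in> borel_measurable (lam M)" "AE p in lam M. norm (g p) \<le> B"
    by (auto simp: mult_comm_def)
  show ?thesis
  proof (rule L2_dominated[OF f])
    show "AE p in lam M. norm (g p * f p) \<le> B * norm (f p)"
      using g(2) by eventually_elim (auto simp: norm_mult intro: mult_right_mono)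
  qed (intro borel_measurable_times g L2_measurable[OF f])
qed

lemma mult_commD:
  "mult_comm P g \<Longrightarrow> f \<in> L2 (lam M) \<Longrightarrow> AE p in lam M. P (\<lambda>p. g p * f p) p = g p * P f p"
  by (simp add: mult_comm_def)

lemma mult_comm_times:
  assumes g: "mult_comm P g" and h: "mult_comm P h"
  shows "mult_comm P (\<lambda>p. g p * h p)"
  unfolding mult_comm_def
proof (intro conjI ballI)
  show "(\<lambda>p. g p * h p) \<in> borel_measurable (lam M)"
    using g h by (intro borel_measurable_times) (auto simp: mult_comm_def)
  obtain B C where "AE p in lam M. norm (g p) \<le> B" "AE p in lam M. norm (h p) \<le> C"
    using g h by (auto simp: mult_comm_def)
  then have "AE p in lam M. norm (g p * h p) \<le> B * C"
    by eventually_elim (auto simp: norm_mult intro!: mult_mono intro: order_trans[OF norm_ge_zero])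
  then show "\<exists>B. AE p in lam M. norm (g p * h p) \<le> B" by blast
  fix f assume f: "f \<in> L2 (lam M)"
  show "AE p in lam M. P (\<lambda>p. g p * h p * f p) p = g p * h p * P f p"
    using mult_commD[OF g mult_comm_L2[OF h f]] mult_commD[OF h f]
    by eventually_elim (simp add: mult.assoc)
qed

end

subsection \<open>Projections commuting with dilation and translation\<close>

locale invariant_projection = measurable_tile +
  fixes P :: "(pt \<Rightarrow> complex) \<Rightarrow> (pt \<Rightarrow> complex)"
  assumes proj: "l2_orth_proj (lam M) P"
    and PU: "l2_commute (lam M) P Ut"
    and PT: "l2_commute (lam M) P Tt"
begin

lemma P_L2: "f \<in> L2 (lam M) \<Longrightarrow> P f \<in> L2 (lam M)"
  using proj by (simp add: l2_orth_proj_def l2_operator_def)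

lemma P_AE_cong: "f \<in> L2 (lam M) \<Longrightarrow> g \<in> L2 (lam M) \<Longrightarrow> AE p in lam M. f p = g p \<Longrightarrow>
    AE p in lam M. P f p = P g p"
  using proj by (simp add: l2_orth_proj_def l2_operator_def)

lemma P_lin: "f \<in> L2 (lam M) \<Longrightarrow> g \<in> L2 (lam M) \<Longrightarrow>
    AE p in lam M. P (\<lambda>p. c * f p + g p) p = c * P f p + P g p"
  using proj by (simp add: l2_orth_proj_def l2_operator_def)

lemma P_idem: "f \<in> L2 (lam M) \<Longrightarrow> AE p in lam M. P (P f) p = P f p"
  using proj by (simp add: l2_orth_proj_def)

lemma P_self_adjoint: "f \<in> L2 (lam M) \<Longrightarrow> g \<in> L2 (lam M) \<Longrightarrow>
    l2_inner (lam M) (P f) g = l2_inner (lam M) f (P g)"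
  using proj by (simp add: l2_orth_proj_def)

lemma mult_comm_lin:
  assumes g: "mult_comm P g" and h: "mult_comm P h"
  shows "mult_comm P (\<lambda>p. c * g p + h p)"
  unfolding mult_comm_def
proof (intro conjI ballI)
  show "(\<lambda>p. c * g p + h p) \<in> borel_measurable (lam M)"
    using g h by (intro borel_measurable_times borel_measurable_add) (auto simp: mult_comm_def)
  obtain B C where "AE p in lam M. norm (g p) \<le> B" "AE p in lam M. norm (h p) \<le> C"
    using g h by (auto simp: mult_comm_def)
  then have "AE p in lam M. norm (c * g p + h p) \<le> norm c * B + C"
  proof eventually_elim
    case (elim p)
    have "norm (c * g p + h p) \<le> norm c * norm (g p) + norm (h p)"
      using norm_triangle_ineq[of "c * g p" "h p"] by (simp add: norm_mult)
    also have "\<dots> \<le> norm c * B + C" by (intro add_mono mult_left_mono elim) auto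
    finally show ?case .
  qed
  then show "\<exists>B. AE p in lam M. norm (c * g p + h p) \<le> B" by blast
  fix f assume f: "f \<in> L2 (lam M)"
  have eq: "(\<lambda>p. (c * g p + h p) * f p) = (\<lambda>p. c * (g p * f p) + h p * f p)"
    by (simp add: algebra_simps)
  show "AE p in lam M. P (\<lambda>p. (c * g p + h p) * f p) p = (c * g p + h p) * P f p"
    unfolding eq
    using mult_commD[OF g f] mult_commD[OF h f] P_lin[OF mult_comm_L2[OF g f] mult_comm_L2[OF h f], of c]
    by eventually_elim (simp add: algebra_simps)
qed

lemma mult_comm_one: "mult_comm P (\<lambda>p. 1)"
  by (auto simp: mult_comm_def)

lemma mult_comm_AE_cong:
  assumes g: "mult_comm P g" and h: "h \<in> borel_measurable (lam M)" and eq: "AE p in lam M. h p = g p"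
  shows "mult_comm P h"
  unfolding mult_comm_def
proof (intro conjI ballI h)
  obtain B where "AE p in lam M. norm (g p) \<le> B" using g by (auto simp: mult_comm_def)
  with eq have "AE p in lam M. norm (h p) \<le> B" by eventually_elim simp
  then show "\<exists>B. AE p in lam M. norm (h p) \<le> B" by blast
  fix f assume f: "f \<in> L2 (lam M)"
  have eq': "AE p in lam M. h p * f p = g p * f p" using eq by eventually_elim simp
  have "(\<lambda>p. h p * f p) \<in> L2 (lam M)"
    by (rule L2_AE_cong[OF mult_comm_L2[OF g f] _ eq']) (intro borel_measurable_times h L2_measurable[OF f])
  from P_AE_cong[OF this mult_comm_L2[OF g f] eq'] mult_commD[OF g f] eq
  show "AE p in lam M. P (\<lambda>p. h p * f p) p = h p * P f p" by eventually_elim simp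
qed

text \<open>Frequency 1 is the commutation with \<open>Tt\<close>; applying it to
  \<open>ch (-1)\<close> times f yields frequency -1, and products give the rest.\<close>

lemma mult_comm_ch: "mult_comm P (\<lambda>p. ch k (fst p))"
proof -
  have bd: "\<exists>B. AE p in lam M. norm (ch k (fst p)) \<le> B" for k by (intro exI[of _ 1]) simp
  have Teq: "Tt f = (\<lambda>p. ch 1 (fst p) * f p)" for f by (rule ext) (simp add: Tt_ch)
  have c1: "mult_comm P (\<lambda>p. ch 1 (fst p))"
    using PT bd by (simp add: mult_comm_def l2_commute_def Teq)
  have cm1: "mult_comm P (\<lambda>p. ch (-1) (fst p))"
    unfolding mult_comm_def
  proof (intro conjI ballI bd)
    fix f assume f: "f \<in> L2 (lam M)"
    have gf: "(\<lambda>p. ch (-1) (fst p) * f p) \<in> L2 (lam M)"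
      by (rule L2_bounded_mult[OF f, where B = 1]) auto
    have "(\<lambda>p. ch 1 (fst p) * (ch (-1) (fst p) * f p)) = f"
      by (simp add: mult.assoc[symmetric] ch_mult)
    with mult_commD[OF c1 gf]
    have "AE p in lam M. P f p = ch 1 (fst p) * P (\<lambda>p. ch (-1) (fst p) * f p) p" by simp
    then show "AE p in lam M. P (\<lambda>p. ch (-1) (fst p) * f p) p = ch (-1) (fst p) * P f p"
      by eventually_elim (simp add: mult.assoc[symmetric] ch_mult)
  qed measurable
  show ?thesis
  proof (induction k rule: int_induct[where k = 0])
    case base
    then show ?case using mult_comm_one by simp
  next
    case (step1 i)
    then show ?case using mult_comm_times[OF step1(2) c1] by (simp add: ch_mult)
  next
    case (step2 i)
    then show ?case using mult_comm_times[OF step2(2) cm1] by (simp add: ch_mult)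
  qed
qed

text \<open>Self-adjointness moves \<open>P\<close> to the test function, so only scalar integrals
  of a fixed integrable function times \<open>F n\<close> have to converge. Norm continuity of
  \<open>P\<close> does not enter.\<close>

lemma mult_comm_limit:
  fixes F :: "nat \<Rightarrow> pt \<Rightarrow> complex"
  assumes F: "\<And>n. mult_comm P (F n)" and g[measurable]: "g \<in> borel_measurable (lam M)"
    and B: "\<And>n. AE p in lam M. norm (F n p) \<le> B"
    and lim: "AE p in lam M. (\<lambda>n. F n p) \<longlonglongrightarrow> g p"
  shows "mult_comm P g"
proof -
  have Fm[measurable]: "F n \<in> borel_measurable (lam M)" for n using F[of n] by (simp add: mult_comm_def)
  have gB: "AE p in lam M. norm (g p) \<le> B"
  proof -
    have "AE p in lam M. \<forall>n. norm (F n p) \<le> B" using B by (simp add: AE_all_countable)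
    with lim show ?thesis
    proof eventually_elim
      case (elim p)
      show ?case by (rule LIMSEQ_le_const2[OF tendsto_norm[OF elim(1)]]) (use elim(2) in blast)
    qed
  qed
  have conv: "(\<lambda>n. \<integral>p. F n p * u p \<partial>lam M) \<longlonglongrightarrow> (\<integral>p. g p * u p \<partial>lam M)"
    if u: "integrable (lam M) u" for u :: "pt \<Rightarrow> complex"
  proof (rule integral_dominated_convergence)
    note [measurable] = borel_measurable_integrable[OF u]
    show "(\<lambda>p. g p * u p) \<in> borel_measurable (lam M)" "(\<lambda>p. F n p * u p) \<in> borel_measurable (lam M)" for n
      by measurable
    show "integrable (lam M) (\<lambda>p. B * norm (u p))" using u by simp
    show "AE p in lam M. (\<lambda>n. F n p * u p) \<longlonglongrightarrow> g p * u p"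
      using lim by eventually_elim (intro tendsto_intros)
    show "AE p in lam M. norm (F n p * u p) \<le> B * norm (u p)" for n
      using B[of n] by eventually_elim (auto simp: norm_mult intro: mult_right_mono)
  qed
  have gL: "(\<lambda>p. g p * f p) \<in> L2 (lam M)" if f: "f \<in> L2 (lam M)" for f
  proof (rule L2_dominated[OF f])
    show "AE p in lam M. norm (g p * f p) \<le> B * norm (f p)"
      using gB by eventually_elim (auto simp: norm_mult intro: mult_right_mono)
  qed (intro borel_measurable_times g L2_measurable[OF f])
  show ?thesis unfolding mult_comm_def
  proof (intro conjI ballI g)
    show "\<exists>B. AE p in lam M. norm (g p) \<le> B" using gB by blast
    fix f assume f: "f \<in> L2 (lam M)"
    show "AE p in lam M. P (\<lambda>p. g p * f p) p = g p * P f p"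
    proof (rule L2_weak_eq_AE[OF P_L2[OF gL[OF f]] gL[OF P_L2[OF f]]])
      fix h assume h: "h \<in> L2 (lam M)"
      have "l2_inner (lam M) (\<lambda>p. F n p * f p) (P h) = l2_inner (lam M) (\<lambda>p. F n p * P f p) h" for n
      proof -
        have "l2_inner (lam M) (\<lambda>p. F n p * f p) (P h) = l2_inner (lam M) (P (\<lambda>p. F n p * f p)) h"
          by (rule P_self_adjoint[symmetric, OF mult_comm_L2[OF F f] h])
        also have "\<dots> = l2_inner (lam M) (\<lambda>p. F n p * P f p) h"
          by (rule l2_inner_AE_cong[OF L2_measurable[OF P_L2[OF mult_comm_L2[OF F f]]]
                L2_measurable[OF mult_comm_L2[OF F P_L2[OF f]]] L2_measurable[OF h] L2_measurable[OF h]
                mult_commD[OF F f]]) simp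
        finally show ?thesis .
      qed
      then have "(\<lambda>n. \<integral>p. F n p * (f p * cnj (P h p)) \<partial>lam M) = (\<lambda>n. \<integral>p. F n p * (P f p * cnj (h p)) \<partial>lam M)"
        by (simp add: l2_inner_def mult.assoc)
      with conv[OF L2_inner_integrable[OF f P_L2[OF h]]]
      have "(\<lambda>n. \<integral>p. F n p * (P f p * cnj (h p)) \<partial>lam M) \<longlonglongrightarrow> (\<integral>p. g p * (f p * cnj (P h p)) \<partial>lam M)"
        by simp
      from LIMSEQ_unique[OF this conv[OF L2_inner_integrable[OF P_L2[OF f] h]]]
      have "l2_inner (lam M) (\<lambda>p. g p * f p) (P h) = l2_inner (lam M) (\<lambda>p. g p * P f p) h"
        by (simp add: l2_inner_def mult.assoc)
      then show "l2_inner (lam M) (P (\<lambda>p. g p * f p)) h = l2_inner (lam M) (\<lambda>p. g p * P f p) h"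
        using P_self_adjoint[OF gL[OF f] h] by simp
    qed
  qed
qed

text \<open>Dilation moves the multiplier: \<open>Ut\<close> applied to the product of g after
  \<open>ri\<close> with f is g times \<open>Ut f\<close>. Commuting \<open>P\<close> past
  \<open>Ut\<close> on both sides and composing with \<open>ri\<close> removes the dilation
  again.\<close>

lemma mult_comm_ri:
  assumes g: "mult_comm P g" shows "mult_comm P (\<lambda>p. g (ri p))"
proof -
  obtain B where gm[measurable]: "g \<in> borel_measurable (lam M)" and B: "AE p in lam M. norm (g p) \<le> B"
    using g by (auto simp: mult_comm_def)
  have B': "AE p in lam M. norm (g (ri p)) \<le> B" by (rule AE_lam_ri[OF B])
  show ?thesis unfolding mult_comm_def
  proof (intro conjI ballI)
    show "\<exists>B. AE p in lam M. norm (g (ri p)) \<le> B" using B' by blast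
    fix f assume f: "f \<in> L2 (lam M)"
    let ?h = "\<lambda>p. g (ri p) * f p"
    have UL: "Ut u \<in> L2 (lam M)" if "u \<in> L2 (lam M)" for u
      using that unitary_Ut by (simp add: l2_unitary_def l2_operator_def)
    have h: "?h \<in> L2 (lam M)"
    proof (rule L2_dominated[OF f])
      show "AE p in lam M. norm (?h p) \<le> B * norm (f p)"
        using B' by eventually_elim (auto simp: norm_mult intro: mult_right_mono)
      show "?h \<in> borel_measurable (lam M)"
        by (intro borel_measurable_times L2_measurable[OF f]) measurable
    qed
    have comm: "AE p in lam M. P (Ut u) p = Ut (P u) p" if "u \<in> L2 (lam M)" for u
      using PU that by (simp add: l2_commute_def)
    have "AE p in lam M. Ut ?h p = g p * Ut f p"
      using AE_lam_Y by eventually_elim (simp add: Ut_def ri_rt)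
    from P_AE_cong[OF UL[OF h] mult_comm_L2[OF g UL[OF f]] this]
      comm[OF h] mult_commD[OF g UL[OF f]] comm[OF f]
    have "AE p in lam M. Ut (P ?h) p = g p * Ut (P f) p" by eventually_elim simp
    from AE_lam_ri[OF this] AE_lam_Y
    show "AE p in lam M. P ?h p = g (ri p) * P f p"
      by eventually_elim (simp add: Ut_def rt_ri)
  qed measurable
qed

lemma mult_comm_indicator_fst:
  assumes E: "E \<in> sets lebesgue"
  shows "mult_comm P (\<lambda>p. indicator E (fst p))"
proof (rule trig_class_indicator[where Q = "\<lambda>g. mult_comm P (\<lambda>p. g (fst p))", OF mult_comm_ch _ _ E])
  show "mult_comm P (\<lambda>p. f (fst p)) \<Longrightarrow> mult_comm P (\<lambda>p. g (fst p)) \<Longrightarrow>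
      mult_comm P (\<lambda>p. c * f (fst p) + g (fst p))" for f g c
    by (rule mult_comm_lin)
  fix F :: "nat \<Rightarrow> real \<Rightarrow> complex" and f B
  assume F: "\<And>n. mult_comm P (\<lambda>p. F n (fst p))" and f: "f \<in> borel_measurable lebesgue"
    and B: "\<And>n x. norm (F n x) \<le> B"
    and lim: "AE x in lebesgue. x \<in> {0..<1} \<longrightarrow> (\<lambda>n. F n x) \<longlonglongrightarrow> f x"
  show "mult_comm P (\<lambda>p. f (fst p))"
  proof (rule mult_comm_limit[OF F measurable_compose[OF fst_measurable_lam f]])
    show "AE p in lam M. norm (F n (fst p)) \<le> B" for n using B by simp
    show "AE p in lam M. (\<lambda>n. F n (fst p)) \<longlonglongrightarrow> f (fst p)"
      using AE_lam_fst[OF lim] AE_lam_Y by eventually_elim simp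
  qed
qed

definition comm_sets :: "pt set set" where
  "comm_sets = {A \<in> sets (lam M). mult_comm P (indicator A)}"

text \<open>Complements, intersections and increasing unions correspond to 1 - g, products and
  bounded limits of multipliers.\<close>

lemma sigma_algebra_comm_sets: "sigma_algebra UNIV comm_sets"
proof (unfold sigma_algebra_iff2, intro conjI ballI allI impI)
  have zero: "mult_comm P (\<lambda>p. 0)"
    using mult_comm_lin[OF mult_comm_one mult_comm_one, of "-1"] by simp
  have ind0: "indicator {} = (\<lambda>p. 0)" by auto
  show "comm_sets \<subseteq> Pow UNIV" by simp
  show "{} \<in> comm_sets" using zero by (simp add: comm_sets_def ind0)
  have compl: "UNIV - A \<in> comm_sets" if "A \<in> comm_sets" for A
  proof -
    have A: "A \<in> sets (lam M)" "mult_comm P (indicator A)" using that by (auto simp: comm_sets_def)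
    have eq: "(\<lambda>p. -1 * indicator A p + 1) = (indicator (UNIV - A) :: pt \<Rightarrow> complex)"
      by (auto simp: indicator_def)
    have "mult_comm P (indicator (UNIV - A))"
      using mult_comm_lin[OF A(2) mult_comm_one, of "-1"] unfolding eq .
    moreover have "UNIV - A \<in> sets (lam M)" using sets.compl_sets[OF A(1)] by simp
    ultimately show ?thesis by (simp add: comm_sets_def)
  qed
  then show "\<And>A. A \<in> comm_sets \<Longrightarrow> UNIV - A \<in> comm_sets" .
  have inter: "A \<inter> B \<in> comm_sets" if "A \<in> comm_sets" "B \<in> comm_sets" for A B
  proof -
    have eq: "(\<lambda>p. indicator A p * indicator B p) = (indicator (A \<inter> B) :: pt \<Rightarrow> complex)"
      by (auto simp: indicator_def)
    have "mult_comm P (indicator (A \<inter> B))"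
      using that mult_comm_times[of P "indicator A" "indicator B"] unfolding eq by (simp add: comm_sets_def)
    with that show ?thesis by (auto simp: comm_sets_def)
  qed
  fix A :: "nat \<Rightarrow> pt set" assume A: "range A \<subseteq> comm_sets"
  \<comment> \<open>Finite unions come from De Morgan, so the countable union is a limit of
    indicators uniformly bounded by 1.\<close>
  have fin: "(\<Union>i<n. A i) \<in> comm_sets" for n
  proof (induction n)
    case 0
    then show ?case using zero by (simp add: comm_sets_def ind0)
  next
    case (Suc n)
    have "(\<Union>i<Suc n. A i) = UNIV - ((UNIV - (\<Union>i<n. A i)) \<inter> (UNIV - A n))"
      by (auto simp: less_Suc_eq)
    moreover have "A n \<in> comm_sets" using A by auto
    ultimately show ?case using compl inter Suc by metis
  qed
  have U: "(\<Union>i. A i) \<in> sets (lam M)" using A by (auto simp: comm_sets_def)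
  have "mult_comm P (indicator (\<Union>i. A i))"
  proof (rule mult_comm_limit[where F = "\<lambda>n. indicator (\<Union>i<n. A i)" and B = 1])
    show "mult_comm P (indicator (\<Union>i<n. A i))" for n using fin[of n] by (simp add: comm_sets_def)
    show "indicator (\<Union>i. A i) \<in> borel_measurable (lam M)" by (rule borel_measurable_indicator[OF U])
    show "AE p in lam M. norm (indicator (\<Union>i<n. A i) p :: complex) \<le> 1" for n
      by (simp add: indicator_def)
    show "AE p in lam M. (\<lambda>n. indicator (\<Union>i<n. A i) p :: complex) \<longlonglongrightarrow> indicator (\<Union>i. A i) p"
      by (intro AE_I2 LIMSEQ_indicator_UN)
  qed
  with U show "(\<Union>i. A i) \<in> comm_sets" by (simp add: comm_sets_def)
qed

text \<open>The identity is viewed as a measurable map from the commuting sets into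
  \<open>lam M\<close>. This reduces the claim to generators: sets of x and the single letters of
  the word, which \<open>ri\<close> shifts to the front.\<close>

lemma mult_comm_indicator:
  assumes A: "A \<in> sets (lam M)" shows "mult_comm P (indicator A)"
proof -
  interpret sigma_algebra UNIV comm_sets by (rule sigma_algebra_comm_sets)
  define N where "N = measure_of UNIV comm_sets (\<lambda>_. 0)"
  have spN: "space N = UNIV" and setsN: "sets N = comm_sets"
    by (simp_all add: N_def)
  have fstN: "fst \<in> N \<rightarrow>\<^sub>M lebesgue"
  proof (rule measurableI)
    fix E :: "real set" assume E: "E \<in> sets lebesgue"
    have "fst -` E \<in> sets (lam M)" using measurable_sets[OF fst_measurable_lam E] by simp
    moreover have eq: "indicator (fst -` E) = (\<lambda>p. indicator E (fst p) :: complex)"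
      by (auto simp: indicator_def)
    have "mult_comm P (indicator (fst -` E))" unfolding eq by (rule mult_comm_indicator_fst[OF E])
    ultimately show "fst -` E \<inter> space N \<in> sets N"
      by (simp add: spN setsN comm_sets_def)
  qed simp
  have wsets: "{p. snd p n} \<in> sets (lam M)" for n
  proof -
    have "{p \<in> space (lam M). snd p n} \<in> sets (lam M)" by measurable
    then show ?thesis by simp
  qed
  have w: "mult_comm P (indicator {p. snd p n})" for n
  proof (induction n)
    case 0
    \<comment> \<open>Over [0,1) the first letter is 1 exactly when the first coordinate of
      \<open>ri p\<close> is at least 1/2.\<close>
    have "mult_comm P (\<lambda>p. indicator {1/2..} (fst (ri p)))"
      by (rule mult_comm_ri[OF mult_comm_indicator_fst]) simp
    moreover have "AE p in lam M. indicator {p. snd p 0} p = (indicator {1/2..} (fst (ri p)) :: complex)"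
      using AE_lam_Y
      by eventually_elim (auto simp: indicator_def ri_def tau_def dig_def)
    ultimately show ?case
      by (rule mult_comm_AE_cong[OF _ borel_measurable_indicator[OF wsets]])
  next
    case (Suc n)
    have "(\<lambda>p. indicator {p. snd p n} (ri p)) = (indicator {p. snd p (Suc n)} :: pt \<Rightarrow> complex)"
      by (auto simp: ri_def indicator_def)
    then show ?case using mult_comm_ri[OF Suc] by simp
  qed
  have sndN: "snd \<in> N \<rightarrow>\<^sub>M Omega_M"
  proof (rule measurable_OmegaI)
    fix n
    have "{p. snd p n} \<in> sets N" using w wsets by (simp add: setsN comm_sets_def)
    then show "(\<lambda>p. snd p n) \<in> N \<rightarrow>\<^sub>M count_space UNIV" by (simp add: pred_def spN)
  qed
  have "(\<lambda>p. p) \<in> N \<rightarrow>\<^sub>M lam M" by (rule measurable_into_lam[OF fstN sndN])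
  from measurable_sets[OF this A] show ?thesis by (simp add: spN setsN comm_sets_def)
qed

text \<open>Testing self-adjointness against a strictly positive square integrable \<open>f0\<close> identifies
  \<open>P\<close> with multiplication by \<open>cnj (P f0) / f0\<close>.\<close>

lemma P_eq_indicator:
  "\<exists>S\<in>sets (lam M). \<forall>f\<in>L2 (lam M). AE p in lam M. P f p = indicator S p * f p"
proof -
  interpret sigma_finite_measure "lam M" by (rule sigma_finite_lam)
  \<comment> \<open>Being at most 1, u satisfies u^2 <= u and is therefore square
    integrable.\<close>
  obtain u :: "pt \<Rightarrow> real" where u: "u \<in> borel_measurable (lam M)" "\<And>p. u p > 0" "\<And>p. u p \<le> 1" "integrable (lam M) u"
    using obtain_positive_integrable_function by (metis order_less_imp_le)
  define f0 where "f0 p = complex_of_real (u p)" for p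
  have f0: "f0 \<in> L2 (lam M)"
  proof -
    have "integrable (lam M) (\<lambda>p. (norm (f0 p))\<^sup>2)"
    proof (rule Bochner_Integration.integrable_bound[OF u(4)])
      show "AE p in lam M. norm ((norm (f0 p))\<^sup>2) \<le> norm (u p)"
      proof (rule AE_I2)
        fix p
        have "u p * u p \<le> u p * 1" using u(2)[of p] u(3)[of p] by (intro mult_left_mono) auto
        then show "norm ((norm (f0 p))\<^sup>2) \<le> norm (u p)"
          using u(2)[of p] by (simp add: f0_def power2_eq_square)
      qed
    qed (use u(1) in \<open>simp add: f0_def\<close>)
    then show ?thesis using u(1) by (simp add: L2_iff f0_def[abs_def])
  qed
  have f0nz: "f0 p \<noteq> 0" "cnj (f0 p) = f0 p" for p using u(2)[of p] by (auto simp: f0_def)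
  define q where "q p = cnj (P f0 p) / f0 p" for p
  have Pq: "AE p in lam M. P f p = q p * f p" if f: "f \<in> L2 (lam M)" for f
  proof -
    \<comment> \<open>Commutation with indicators localises self-adjointness to every measurable
      set, so the two integrands agree a.e.\<close>
    have "AE p in lam M. f p * cnj (P f0 p) = P f p * cnj (f0 p)"
    proof (rule density_unique_banach)
      show "integrable (lam M) (\<lambda>p. f p * cnj (P f0 p))"
        by (rule L2_inner_integrable[OF f P_L2[OF f0]])
      show "integrable (lam M) (\<lambda>p. P f p * cnj (f0 p))"
        by (rule L2_inner_integrable[OF P_L2[OF f] f0])
      fix A assume A: "A \<in> sets (lam M)"
      note c = mult_comm_indicator[OF A]
      have "l2_inner (lam M) (\<lambda>p. indicator A p * f p) (P f0) = l2_inner (lam M) (P (\<lambda>p. indicator A p * f p)) f0"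
        by (rule P_self_adjoint[symmetric, OF mult_comm_L2[OF c f] f0])
      also have "\<dots> = l2_inner (lam M) (\<lambda>p. indicator A p * P f p) f0"
        by (rule l2_inner_AE_cong[OF L2_measurable[OF P_L2[OF mult_comm_L2[OF c f]]]
              L2_measurable[OF mult_comm_L2[OF c P_L2[OF f]]] L2_measurable[OF f0] L2_measurable[OF f0]
              mult_commD[OF c f]]) simp
      finally show "set_lebesgue_integral (lam M) A (\<lambda>p. f p * cnj (P f0 p)) =
          set_lebesgue_integral (lam M) A (\<lambda>p. P f p * cnj (f0 p))"
      proof -
        have "indicator A p * a * b = indicator A p *\<^sub>R (a * b)" for p and a b :: complex
          by (simp add: indicator_def)
        then show "l2_inner (lam M) (\<lambda>p. indicator A p * f p) (P f0) = l2_inner (lam M) (\<lambda>p. indicator A p * P f p) f0 \<Longrightarrow> ?thesis"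
          by (simp add: l2_inner_def set_lebesgue_integral_def)
      qed
    qed
    then show ?thesis
    proof eventually_elim
      case (elim p)
      then show ?case using f0nz[of p] by (simp add: q_def field_simps)
    qed
  qed
  let ?S = "{p. q p = 1}"
  have qm: "q \<in> borel_measurable (lam M)"
    unfolding q_def[abs_def] by (intro borel_measurable_divide borel_measurable_cnj' L2_measurable P_L2 f0)
  then have S: "?S \<in> sets (lam M)"
    using measurable_sets[OF qm, of "{1}"] by (simp add: vimage_def)
  \<comment> \<open>Idempotence at \<open>f0\<close> reads q^2 = q, because \<open>f0\<close>
    vanishes nowhere.\<close>
  have "AE p in lam M. q p = 0 \<or> q p = 1"
    using Pq[OF f0] Pq[OF P_L2[OF f0]] P_idem[OF f0]
  proof eventually_elim
    case (elim p)
    then have "q p * f0 p = q p * (q p * f0 p)" by simp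
    then have "q p * (1 - q p) * f0 p = 0" by (simp add: algebra_simps)
    then show ?case using f0nz[of p] by auto
  qed
  then have "\<forall>f\<in>L2 (lam M). AE p in lam M. P f p = indicator ?S p * f p"
  proof (intro ballI)
    fix f assume "AE p in lam M. q p = 0 \<or> q p = 1" "f \<in> L2 (lam M)"
    from this(1) Pq[OF this(2)] show "AE p in lam M. P f p = indicator ?S p * f p"
      by eventually_elim (auto simp: indicator_def)
  qed
  with S show ?thesis by blast
qed

text \<open>The set found so far is invariant only up to null sets. Keeping the points over [0,1)
  whose entire orbit lies in it changes it by a null set and gives exact invariance.\<close>

lemma P_eq_invariant_indicator:
  "\<exists>S. S \<in> sets (lam M) \<and> S \<subseteq> {0..<1} \<times> UNIV \<and> rt ` S = S \<and>
     (\<forall>f\<in>L2 (lam M). AE p in lam M. P f p = indicator S p * f p)"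
proof -
  obtain S0 where S0[measurable]: "S0 \<in> sets (lam M)"
    and PS: "\<And>f. f \<in> L2 (lam M) \<Longrightarrow> AE p in lam M. P f p = indicator S0 p * f p"
    using P_eq_indicator by blast
  have step: "AE p in lam M. p \<in> S0 \<longleftrightarrow> rt p \<in> S0"
  proof -
    \<comment> \<open>Commutation with \<open>Ut\<close> is tested on indicators of levels, which
      are square integrable and together cover almost everything.\<close>
    have lev: "AE p in lam M. rt p \<in> level j \<longrightarrow> (p \<in> S0 \<longleftrightarrow> rt p \<in> S0)" for j
    proof -
      let ?f = "indicator (level j) :: pt \<Rightarrow> complex"
      have f: "?f \<in> L2 (lam M)"
      proof -
        have "(norm (?f p))\<^sup>2 = indicator (level j) p" for p by (simp add: indicator_def)
        then show ?thesis using level_integrable[of j] by (simp add: L2_iff)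
      qed
      have U: "Ut ?f \<in> L2 (lam M)"
        using f unitary_Ut by (simp add: l2_unitary_def l2_operator_def)
      have "AE p in lam M. P (Ut ?f) p = Ut (P ?f) p"
        using PU f by (simp add: l2_commute_def)
      with PS[OF U] AE_lam_rt[OF PS[OF f]] show ?thesis
        by eventually_elim (auto simp: Ut_def indicator_def split: if_splits)
    qed
    have "AE p in lam M. \<forall>j. rt p \<in> level j \<longrightarrow> (p \<in> S0 \<longleftrightarrow> rt p \<in> S0)"
      unfolding AE_all_countable using lev by blast
    with AE_lam_rt[OF AE_lam_Xt] show ?thesis
      by eventually_elim (use Xt_level in blast)
  qed
  define S where "S = {p. fst p \<in> {0..<1} \<and> (\<forall>j. Rz j p \<in> S0)}"
  have "AE p in lam M. p \<in> S0 \<longleftrightarrow> Rz j p \<in> S0" for j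
  proof (induction j rule: int_induct[where k = 0])
    case (step1 i)
    from step1(2) AE_lam_Rz[OF step, of i] AE_lam_Y show ?case
      by eventually_elim (simp add: rt_Rz)
  next
    case (step2 i)
    from step2(2) AE_lam_Rz[OF step, of "i - 1"] AE_lam_Y show ?case
      by eventually_elim (simp add: rt_Rz)
  qed simp
  then have "AE p in lam M. \<forall>j. p \<in> S0 \<longleftrightarrow> Rz j p \<in> S0" unfolding AE_all_countable by blast
  with AE_lam_Y have eq: "AE p in lam M. p \<in> S \<longleftrightarrow> p \<in> S0"
    by eventually_elim (auto simp: S_def)
  have "S = (\<Inter>j. {p. fst p \<in> {0..<1} \<and> Rz j p \<in> S0})" by (auto simp: S_def)
  also have "\<dots> \<in> sets (lam M)" using sets.top[of "lam M"] by (intro sets.countable_INT'' Collect_Rz_sets S0) auto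
  finally have Sm: "S \<in> sets (lam M)" .
  have rt1: "rt p = Rz 1 p" and ri1: "ri p = Rz (-1) p" for p by (simp_all add: Rz_def)
  have "rt ` S = S"
  proof (intro set_eqI iffI)
    fix p assume "p \<in> rt ` S"
    then obtain q where "p = rt q" "q \<in> S" by (rule imageE)
    then show "p \<in> S" using fst_rt[of q] by (auto simp: S_def rt1 Rz_Rz)
  next
    fix p assume p: "p \<in> S"
    then have Y: "fst p \<in> {0..<1}" by (simp add: S_def)
    have "ri p \<in> S" using p fst_ri[OF Y] by (auto simp: S_def ri1 Rz_Rz)
    then show "p \<in> rt ` S" using rt_ri[OF Y] by (metis image_eqI)
  qed
  moreover have "S \<subseteq> {0..<1} \<times> UNIV" by (auto simp: S_def)
  moreover have "AE p in lam M. P f p = indicator S p * f p" if "f \<in> L2 (lam M)" for f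
    using PS[OF that] eq by eventually_elim (auto simp: indicator_def)
  ultimately show ?thesis using Sm by blast
qed

end

context measurable_tile begin

lemma commute_if_indicator:
  assumes proj: "l2_orth_proj (lam M) P" and S: "S \<subseteq> {0..<1} \<times> UNIV" "rt ` S = S"
    and PS: "\<And>f. f \<in> L2 (lam M) \<Longrightarrow> AE p in lam M. P f p = indicator S p * f p"
  shows "l2_commute (lam M) P Ut \<and> l2_commute (lam M) P Tt"
proof -
  \<comment> \<open>Injectivity of \<open>rt\<close> over [0,1) turns invariance under images into a
    pointwise equivalence.\<close>
  have inv: "p \<in> S \<longleftrightarrow> rt p \<in> S" if p: "fst p \<in> {0..<1}" for p
  proof
    assume "rt p \<in> S"
    then have "rt p \<in> rt ` S" using S(2) by simp
    then obtain q where q: "q \<in> S" "rt p = rt q" by (rule imageE)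
    have qY: "fst q \<in> {0..<1}" using q(1) S(1) by auto
    have "ri (rt p) = ri (rt q)" using q(2) by (rule arg_cong)
    then have "p = q" by (simp only: ri_rt[OF p] ri_rt[OF qY])
    then show "p \<in> S" using q(1) by (simp only:)
  qed (use S(2) in auto)
  have UL: "Ut f \<in> L2 (lam M)" "Tt f \<in> L2 (lam M)" if "f \<in> L2 (lam M)" for f
    using that unitary_Ut unitary_Tt by (auto simp: l2_unitary_def l2_operator_def)
  have "AE p in lam M. P (Ut f) p = Ut (P f) p" if f: "f \<in> L2 (lam M)" for f
    using PS[OF UL(1)[OF f]] AE_lam_rt[OF PS[OF f]] AE_lam_Y
    by eventually_elim (simp add: Ut_def indicator_def inv)
  moreover have "AE p in lam M. P (Tt f) p = Tt (P f) p" if f: "f \<in> L2 (lam M)" for f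
    using PS[OF UL(2)[OF f]] PS[OF f] by eventually_elim (simp add: Tt_def)
  ultimately show ?thesis by (simp add: l2_commute_def)
qed

lemma commute_iff_indicator:
  assumes "l2_orth_proj (lam M) P"
  shows "(l2_commute (lam M) P Ut \<and> l2_commute (lam M) P Tt) \<longleftrightarrow>
    (\<exists>S. S \<in> sets (lam M) \<and> S \<subseteq> {0..<1} \<times> UNIV \<and> rt ` S = S \<and>
      (\<forall>f\<in>L2 (lam M). AE p in lam M. P f p = indicator S p * f p))"
proof
  assume c: "l2_commute (lam M) P Ut \<and> l2_commute (lam M) P Tt"
  interpret invariant_projection M P by unfold_locales (use assms c in auto)
  show "\<exists>S. S \<in> sets (lam M) \<and> S \<subseteq> {0..<1} \<times> UNIV \<and> rt ` S = S \<and>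
      (\<forall>f\<in>L2 (lam M). AE p in lam M. P f p = indicator S p * f p)"
    by (rule P_eq_invariant_indicator)
next
  assume "\<exists>S. S \<in> sets (lam M) \<and> S \<subseteq> {0..<1} \<times> UNIV \<and> rt ` S = S \<and>
      (\<forall>f\<in>L2 (lam M). AE p in lam M. P f p = indicator S p * f p)"
  then show "l2_commute (lam M) P Ut \<and> l2_commute (lam M) P Tt"
    using commute_if_indicator[OF assms] by blast
qed

end

subsection \<open>Eventually constant words and the real line\<close>

text \<open>The two's complement value of a word, with its last n + 1 letters replaced by a cut at
  n: the bit at the cut carries negative weight. Any cut after stabilisation serves, which avoids
  the least one.\<close>

definition dZ_at :: "nat \<Rightarrow> word \<Rightarrow> int" where
  "dZ_at n w = (\<Sum>k<n. (if w k then 2 ^ k else 0)) - (if w n then 2 ^ n else 0)"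

text \<open>Moving the cut one place further replaces -2^m by 2^m - 2^(m+1) when the tail is 1, and
  changes nothing when it is 0.\<close>

lemma dZ_eq:
  assumes N: "\<forall>m\<ge>N. w m = w N"
  shows "dZ w = dZ_at N w"
proof -
  let ?n = "LEAST n. \<forall>m\<ge>n. w m = w n"
  have n: "\<forall>m\<ge>?n. w m = w ?n" by (rule LeastI[of "\<lambda>n. \<forall>m\<ge>n. w m = w n", OF N])
  have "?n \<le> N" by (rule Least_le[of "\<lambda>n. \<forall>m\<ge>n. w m = w n", OF N])
  then have "dZ_at N w = dZ_at ?n w"
  proof (induction N rule: dec_induct)
    case (step m)
    have "w m = w ?n" "w (Suc m) = w ?n" using n step(1) by (meson le_SucI)+
    then have "w (Suc m) = w m" by simp
    then have "dZ_at (Suc m) w = dZ_at m w" by (simp add: dZ_at_def)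
    then show ?case using step(3) by simp
  qed simp
  moreover have "dZ w = dZ_at ?n w" by (simp add: dZ_def dZ_at_def Let_def)
  ultimately show ?thesis by simp
qed

lemma AZ_shift: "w \<in> AZ \<Longrightarrow> (\<lambda>n. w (Suc n)) \<in> AZ"
proof -
  assume "w \<in> AZ"
  then obtain N where "\<forall>m\<ge>N. w m = w N" by (auto simp: AZ_def)
  then have "\<forall>m\<ge>N. w (Suc m) = w (Suc N)" by (metis le_SucI order_refl)
  then show ?thesis by (auto simp: AZ_def)
qed

lemma AZ_cons: "w \<in> AZ \<Longrightarrow> case_nat b w \<in> AZ"
proof -
  assume "w \<in> AZ"
  then obtain N where N: "\<forall>m\<ge>N. w m = w N" by (auto simp: AZ_def)
  have "\<forall>m\<ge>Suc N. case_nat b w m = case_nat b w (Suc N)"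
  proof (intro allI impI)
    fix m assume "m \<ge> Suc N"
    then obtain k where k: "m = Suc k" "k \<ge> N" by (cases m) auto
    from N k(2) have "w k = w N" by blast
    then show "case_nat b w m = case_nat b w (Suc N)" by (simp add: k(1))
  qed
  then show ?thesis unfolding AZ_def by blast
qed

text \<open>Reading the word as a 2-adic integer: the first letter is the parity, and the shifted
  word carries the remaining half.\<close>

lemma dZ_Suc:
  assumes "w \<in> AZ"
  shows "dZ w = (if w 0 then 1 else 0) + 2 * dZ (\<lambda>n. w (Suc n))"
proof -
  obtain N where N: "\<forall>m\<ge>N. w m = w N" using assms by (auto simp: AZ_def)
  then have N1: "\<forall>m\<ge>N. w (Suc m) = w (Suc N)" and N2: "\<forall>m\<ge>Suc N. w m = w (Suc N)"
    by (metis le_SucI order_refl, metis Suc_leD le_SucI order_refl)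
  have "(\<Sum>k<Suc N. (if w k then 2 ^ k else 0)) =
      (if w 0 then 1 else 0) + (\<Sum>k<N. (if w (Suc k) then 2 ^ Suc k else (0::int)))"
    by (subst sum.lessThan_Suc_shift) simp
  also have "(\<Sum>k<N. (if w (Suc k) then 2 ^ Suc k else (0::int))) = 2 * (\<Sum>k<N. (if w (Suc k) then 2 ^ k else 0))"
    unfolding sum_distrib_left by (intro sum.cong) auto
  finally show ?thesis unfolding dZ_eq[OF N2] dZ_eq[OF N1] by (simp add: dZ_at_def)
qed

lemma rt_AZ: "rt ` ({0..<1} \<times> AZ) = {0..<1} \<times> AZ"
proof (intro set_eqI iffI)
  fix p :: pt assume "p \<in> rt ` ({0..<1} \<times> AZ)"
  then obtain q where "p = rt q" "q \<in> {0..<1} \<times> AZ" by (rule imageE)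
  then show "p \<in> {0..<1} \<times> AZ" using fst_rt[of q] AZ_cons[of "snd q"] by (auto simp: rt_def)
next
  fix p :: pt assume p: "p \<in> {0..<1} \<times> AZ"
  then have f: "fst p \<in> {0..<1}" by auto
  have "ri p \<in> {0..<1} \<times> AZ"
    using p fst_ri[OF f] AZ_shift[of "snd p"] by (auto simp: ri_def)
  then show "p \<in> rt ` ({0..<1} \<times> AZ)" using rt_ri[OF f] by (metis image_eqI)
qed

lemma fst_ri_eq: "fst (ri p) = tau (snd p 0) (fst p)"
  by (simp add: ri_def)

lemma snd_ri_eq: "snd (ri p) = (\<lambda>n. snd p (Suc n))"
  by (simp add: ri_def)

definition line :: "pt \<Rightarrow> real" where
  "line p = fst p + of_int (dZ (snd p))"

lemma line_ri: "snd p \<in> AZ \<Longrightarrow> line (ri p) = line p / 2"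
  using dZ_Suc[of "snd p"] by (simp add: line_def fst_ri_eq snd_ri_eq tau_def dig_def field_simps)

lemma ri_pow:
  assumes "fst p \<in> {0..<1}" "snd p \<in> AZ"
  shows "fst ((ri ^^ n) p) \<in> {0..<1}" "snd ((ri ^^ n) p) \<in> AZ" "line ((ri ^^ n) p) = line p / 2 ^ n"
proof -
  have "fst ((ri ^^ n) p) \<in> {0..<1} \<and> snd ((ri ^^ n) p) \<in> AZ \<and> line ((ri ^^ n) p) = line p / 2 ^ n"
  proof (induction n)
    case (Suc n)
    let ?q = "(ri ^^ n) p"
    have "snd (ri ?q) \<in> AZ" using Suc AZ_shift[of "snd ?q"] by (simp add: fst_ri_eq snd_ri_eq)
    then show ?case using Suc line_ri[of ?q] fst_ri[of ?q] by (simp del: atLeastLessThan_iff)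
  qed (use assms in simp)
  then show "fst ((ri ^^ n) p) \<in> {0..<1}" "snd ((ri ^^ n) p) \<in> AZ" "line ((ri ^^ n) p) = line p / 2 ^ n"
    by auto
qed

lemma ri_pow_snd: "snd ((ri ^^ n) p) = (\<lambda>m. snd p (m + n))"
  by (induction n) (auto simp: fst_ri_eq snd_ri_eq)

lemma ri_pow_tau_list: "fst ((ri ^^ n) p) = tau_list (map (snd p) [0..<n]) (fst p)"
  by (induction n) (auto simp: fst_ri_eq snd_ri_eq ri_pow_snd tau_list_def)

context measurable_tile begin

lemma Ft_iff_digits:
  assumes "fst p \<in> {0..<1}"
  shows "p \<in> Ft M \<longleftrightarrow> (\<forall>n. snd p n = choose_dig M (fst ((ri ^^ n) p)))"
proof
  assume p: "p \<in> Ft M"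
  show "\<forall>n. snd p n = choose_dig M (fst ((ri ^^ n) p))"
  proof
    fix n
    have "(ri ^^ n) p \<in> Ft M" using p ri_Ft by (induction n) auto
    then have "snd ((ri ^^ n) p) 0 = choose_dig M (fst ((ri ^^ n) p))"
      by (simp add: Ft_eq chosen_def path_pt_def)
    then show "snd p n = choose_dig M (fst ((ri ^^ n) p))" by (simp add: ri_pow_snd)
  qed
next
  assume d: "\<forall>n. snd p n = choose_dig M (fst ((ri ^^ n) p))"
  have "path_pt M (fst p) n = fst ((ri ^^ n) p)" for n
  proof (induction n)
    case (Suc n)
    have "fst ((ri ^^ Suc n) p) = tau (snd p n) (fst ((ri ^^ n) p))"
      by (simp add: fst_ri_eq snd_ri_eq ri_pow_snd)
    with Suc d show ?case by (simp add: path_pt_def)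
  qed (simp add: path_pt_def)
  then have "snd p = chosen M (fst p)" using d by (auto simp: chosen_def)
  with assms show "p \<in> Ft M" by (simp add: Ft_eq)
qed

text \<open>The converse of \<open>Xt_level\<close> for the fibre: going back up with
  \<open>rt\<close> prepends one letter at a time, which preserves admissibility by
  \<open>Aset_rr\<close>.\<close>

lemma Aset_if_ri_Ft:
  "fst p \<in> {0..<1} \<Longrightarrow> (ri ^^ n) p \<in> Ft M \<Longrightarrow> snd p \<in> Aset M (fst p)"
proof (induction n arbitrary: p)
  case 0
  then show ?case using chosen_in_Aset by (simp add: Ft_eq)
next
  case (Suc n)
  let ?q = "ri p"
  have q: "fst ?q \<in> {0..<1}" by (rule fst_ri[OF Suc.prems(1)])
  have "snd ?q \<in> Aset M (fst ?q)"
    by (rule Suc.IH[OF q]) (use Suc.prems(2) in \<open>simp add: funpow_swap1\<close>)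
  then have "case_nat (digit_of (fst ?q)) (snd ?q) \<in> Aset M (rr (fst ?q))"
    using Aset_rr[OF q] by simp
  then have "snd (rt ?q) \<in> Aset M (fst (rt ?q))" by (simp add: rt_def)
  then show ?case using rt_ri[OF Suc.prems(1)] by simp
qed

end

section \<open>Scaling function and wavelet on the copy of the real line\<close>

context scaling_tile begin

text \<open>The filter is 1-periodic and \<open>line p\<close> differs from the first coordinate by
  an integer.\<close>

lemma m0_line:
  assumes "fst p \<in> {0..<1}" shows "m0 M (line p) = indicator M (fst p)"
proof -
  have "frac (line p) = fst p"
    using assms by (simp add: line_def frac_unique_iff)
  then show ?thesis using M_sub by (simp add: m0_def Per_eq_frac)
qed

text \<open>The a.e. facts used below, required at every integer translate because \<open>dZ\<close>
  may take any integer value. Together with \<open>good_orbit\<close> this makes the remaining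
  arguments pointwise and simultaneous in all words.\<close>

definition good_point :: "real set \<Rightarrow> real set \<Rightarrow> real \<Rightarrow> bool" where
  "good_point F P x \<longleftrightarrow>
     (x \<in> {0..<1} \<longrightarrow> (choose_dig M (rr x) = digit_of x \<longleftrightarrow> x \<in> M)) \<and>
     (\<forall>k::int. let y = x + of_int k in
        (\<lambda>N. \<Prod>n\<in>{1..N}. m0 M (y / 2 ^ n)) \<longlonglongrightarrow> indicator F y \<and>
        indicator P (2 * y) = (1 - m0 M y) * indicator F y \<and>
        (\<exists>n. y \<in> (\<lambda>x. 2 ^ n * x) ` F))"

definition good_orbit :: "real set \<Rightarrow> real set \<Rightarrow> real \<Rightarrow> bool" where
  "good_orbit F P x \<longleftrightarrow> (\<forall>eta. good_point F P (tau_list eta x))"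

text \<open>Finite words and integers are countable, and the branches as well as translations pull
  null sets back to null sets.\<close>

lemma AE_good_orbit:
  assumes prod: "AE x in lebesgue. (\<lambda>N. \<Prod>n\<in>{1..N}. m0 M (x / 2 ^ n)) \<longlonglongrightarrow> indicator F x"
    and psi: "AE x in lebesgue. indicator P (2 * x) = (1 - m0 M x) * indicator F x"
    and cover: "UNIV - (\<Union>n\<in>{1::nat..}. (\<lambda>x. 2 ^ n * x) ` F) \<in> null_sets lebesgue"
  shows "AE x in lebesgue. good_orbit F P x"
proof -
  let ?Q = "\<lambda>y. (\<lambda>N. \<Prod>n\<in>{1..N}. m0 M (y / 2 ^ n)) \<longlonglongrightarrow> indicator F y \<and>
        indicator P (2 * y) = (1 - m0 M y) * indicator F y \<and> (\<exists>n. y \<in> (\<lambda>x. 2 ^ n * x) ` F)"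
  have Q: "AE y in lebesgue. ?Q y"
    using prod psi AE_not_in[OF cover] by eventually_elim auto
  have "AE x in lebesgue. \<forall>k::int. ?Q (x + of_int k)"
    unfolding AE_all_countable
  proof
    fix k :: int
    have "AE x in lebesgue. ?Q (of_int k + 1 * x)" by (rule AE_lebesgue_real_affine[OF _ Q]) simp
    then show "AE x in lebesgue. ?Q (x + of_int k)"
      by eventually_elim (simp only: mult_1 add.commute[of "of_int k"])
  qed
  with AE_choose_iff have "AE x in lebesgue. good_point F P x"
    by eventually_elim (simp add: good_point_def Let_def)
  then have "AE x in lebesgue. good_point F P (tau_list eta x)" for eta by (rule AE_tau_list)
  then show ?thesis unfolding good_orbit_def AE_all_countable by blast
qed

lemma good_orbit_ri_pow: "good_orbit F P (fst p) \<Longrightarrow> good_orbit F P (fst ((ri ^^ n) p))"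
proof -
  assume g: "good_orbit F P (fst p)"
  have "tau_list eta (tau_list eta' x) = tau_list (eta' @ eta) x" for eta eta' x
    by (simp add: tau_list_def)
  with g show ?thesis by (simp add: good_orbit_def ri_pow_tau_list)
qed

lemma good_orbitD:
  assumes "good_orbit F P (fst p)" shows "good_point F P (fst p)"
  using assms unfolding good_orbit_def by (metis tau_list_Nil)

lemma good_orbit_line:
  assumes "good_orbit F P (fst p)"
  shows "(\<lambda>N. \<Prod>n\<in>{1..N}. m0 M (line p / 2 ^ n)) \<longlonglongrightarrow> indicator F (line p)"
    and "indicator P (2 * line p) = (1 - m0 M (line p)) * indicator F (line p)"
    and "\<exists>n. line p \<in> (\<lambda>x. 2 ^ n * x) ` F"
  using good_orbitD[OF assms] unfolding good_point_def Let_def line_def by blast+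

text \<open>All factors of the product are 0 or 1, so the partial products are either constantly 1
  or eventually 0. The factor at index n tests whether the n-th iterate under \<open>ri\<close> has
  its first coordinate in \<open>M\<close>.\<close>

lemma Ft_iff_line:
  assumes p: "fst p \<in> {0..<1}" "snd p \<in> AZ" and g: "good_orbit F P (fst p)"
  shows "p \<in> Ft M \<longleftrightarrow> line p \<in> F"
proof -
  let ?q = "\<lambda>n. (ri ^^ n) p"
  have step: "snd p n = choose_dig M (fst (?q n)) \<longleftrightarrow> fst (?q (Suc n)) \<in> M" for n
  proof -
    have f: "fst (?q n) \<in> {0..<1}" "fst (?q (Suc n)) \<in> {0..<1}" by (rule ri_pow(1)[OF p])+
    have e: "fst (?q (Suc n)) = tau (snd p n) (fst (?q n))"
      by (simp add: fst_ri_eq snd_ri_eq ri_pow_snd)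
    have "rr (fst (?q (Suc n))) = fst (?q n)" "digit_of (fst (?q (Suc n))) = snd p n"
      unfolding e using rr_tau[OF f(1)] digit_tau[OF f(1)] by auto
    then show ?thesis
      using good_orbitD[OF good_orbit_ri_pow[OF g, of "Suc n"]] f(2) by (auto simp: good_point_def)
  qed
  have m: "m0 M (line p / 2 ^ n) = indicator M (fst (?q n))" for n
    using m0_line[OF ri_pow(1)[OF p, of n]] ri_pow(3)[OF p, of n] by simp
  have lim: "(\<lambda>N. \<Prod>n\<in>{1..N}. indicator M (fst (?q n)) :: real) \<longlonglongrightarrow> indicator F (line p)"
    using good_orbit_line(1)[OF g] by (simp only: m)
  \<comment> \<open>The letter stored at index n is judged at the point reached after applying it;
    the shift by one matches a product that starts at index 1.\<close>
  have "p \<in> Ft M \<longleftrightarrow> (\<forall>n. fst (?q (Suc n)) \<in> M)"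
    unfolding Ft_iff_digits[OF p(1)] step ..
  also have "\<dots> \<longleftrightarrow> line p \<in> F"
  proof
    assume a: "\<forall>n. fst (?q (Suc n)) \<in> M"
    have "(\<Prod>n\<in>{1..N}. indicator M (fst (?q n)) :: real) = 1" for N
    proof (rule prod.neutral, rule ballI)
      fix n assume "n \<in> {1..N}"
      then obtain k where "n = Suc k" by (cases n) auto
      then show "indicator M (fst (?q n)) = (1::real)" using a by (simp del: funpow.simps)
    qed
    then have "indicator F (line p) = (1::real)"
      using LIMSEQ_unique[OF lim] by (simp add: tendsto_const)
    then show "line p \<in> F" by (simp add: indicator_eq_1_iff)
  next
    assume F: "line p \<in> F"
    show "\<forall>n. fst (?q (Suc n)) \<in> M"
    proof (rule ccontr)
      assume "\<not> (\<forall>n. fst (?q (Suc n)) \<in> M)"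
      then obtain k where k: "fst (?q (Suc k)) \<notin> M" by blast
      have "(\<Prod>n\<in>{1..N}. indicator M (fst (?q n)) :: real) = 0" if "N \<ge> Suc k" for N
        by (rule prod_zero) (use k that in \<open>auto intro!: bexI[of _ "Suc k"] simp del: funpow.simps\<close>)
      then have "\<forall>\<^sub>F N in sequentially. (\<Prod>n\<in>{1..N}. indicator M (fst (?q n)) :: real) = 0"
        unfolding eventually_sequentially by blast
      then have "(\<lambda>N. \<Prod>n\<in>{1..N}. indicator M (fst (?q n)) :: real) \<longlonglongrightarrow> 0"
        by (rule tendsto_eventually)
      from LIMSEQ_unique[OF lim this] F show False by simp
    qed
  qed
  finally show ?thesis .
qed

text \<open>Since the dilates of F cover the line, halving \<open>line p\<close> often enough lands
  in F. The corresponding iterate of \<open>ri\<close> is then on \<open>Ft M\<close>, so the word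
  eventually follows the chosen path.\<close>

lemma AZ_subset_Aset:
  assumes x: "x \<in> {0..<1}" and g: "good_orbit F P x"
  shows "AZ \<subseteq> Aset M x"
proof
  fix w assume w: "w \<in> AZ"
  let ?p = "(x, w)"
  have p: "fst ?p \<in> {0..<1}" "snd ?p \<in> AZ" "good_orbit F P (fst ?p)" using x w g by auto
  obtain n where n: "line ?p \<in> (\<lambda>x. 2 ^ n * x) ` F"
    using good_orbit_line(3)[OF p(3)] by blast
  then have "line ((ri ^^ n) ?p) \<in> F" using ri_pow(3)[OF p(1,2), of n] by auto
  then have "(ri ^^ n) ?p \<in> Ft M"
    using Ft_iff_line[OF ri_pow(1,2)[OF p(1,2)] good_orbit_ri_pow[OF p(3)]] by simp
  from Aset_if_ri_Ft[OF p(1) this] show "w \<in> Aset M x" by simp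
qed

lemma phit_Emb:
  assumes "AE x in lebesgue. good_orbit F P x"
  shows "AE p in lam M. indicator ({0..<1} \<times> AZ) p * phit M p = Emb (\<lambda>x. indicator F x) p"
  using AE_lam_fst[OF assms] AE_lam_Y
proof eventually_elim
  case (elim p)
  show ?case
  proof (cases "snd p \<in> AZ")
    case True
    then show ?thesis using elim Ft_iff_line[OF elim(2) True elim(1)]
      by (cases p) (auto simp: Emb_def phit_def line_def indicator_def)
  next
    case False
    then show ?thesis by (cases p) (simp add: Emb_def)
  qed
qed

lemma psit_Emb:
  assumes "AE x in lebesgue. good_orbit F P x"
  shows "AE p in lam M. indicator ({0..<1} \<times> AZ) p * psit M p = Emb (\<lambda>x. indicator P x) p"
  using AE_lam_fst[OF assms] AE_lam_Y psit_AE AE_lam_ri[OF AE_rt_Ft]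
proof eventually_elim
  case (elim p)
  show ?case
  proof (cases "snd p \<in> AZ")
    case True
    have r: "fst (ri p) \<in> {0..<1}" "snd (ri p) \<in> AZ" "good_orbit F P (fst (ri p))"
      using ri_pow(1,2)[OF elim(2) True, of 1] good_orbit_ri_pow[OF elim(1), of 1] by auto
    have half: "line p = 2 * line (ri p)" using line_ri[OF True] by simp
    \<comment> \<open>The wavelet equation is used at \<open>ri p\<close>, where the doubled
      argument is \<open>line p\<close> itself.\<close>
    have "indicator P (2 * line (ri p)) = (1 - m0 M (line (ri p))) * indicator F (line (ri p))"
      by (rule good_orbit_line(2)[OF r(3)])
    then have "line p \<in> P \<longleftrightarrow> fst (ri p) \<notin> M \<and> line (ri p) \<in> F"
      unfolding m0_line[OF r(1)] half[symmetric]
      by (cases "fst (ri p) \<in> M"; cases "line (ri p) \<in> F") (auto simp: indicator_def split: if_splits)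
    moreover have "p \<in> Pt M \<longleftrightarrow> fst (ri p) \<notin> M \<and> line (ri p) \<in> F"
      using elim(2,4) rt_ri[OF elim(2)] Ft_iff_line[OF r] by (auto simp: Pt_iff)
    ultimately show ?thesis using elim(2,3) True
      by (cases p) (auto simp: Emb_def line_def indicator_def)
  next
    case False
    then show ?thesis by (cases p) (simp add: Emb_def)
  qed
qed

end

text \<open>The exponential does not see the integer part removed by \<open>frac\<close>, so
  evaluating it at r(x) squares it.\<close>

lemma (in measurable_tile) Ut_Tt_conjugate:
  assumes f: "f \<in> L2 (lam M)"
  shows "AE p in lam M. Ut (Tt (l2_inv (lam M) Ut f)) p = Tt (Tt f) p"
  using l2_inv_unitary(2)[OF unitary_Ut f] AE_lam_Y
proof eventually_elim
  case (elim p)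
  have "ch 1 (rr (fst p)) = ch 1 (2 * fst p)"
    using ch_add_int[of 1 "rr (fst p)" "\<lfloor>2 * fst p\<rfloor>"] by (simp add: rr_def frac_def)
  also have "\<dots> = ch 1 (fst p) * ch 1 (fst p)" by (simp add: ch_mult ch_double)
  finally have "Ut (Tt (l2_inv (lam M) Ut f)) p = ch 1 (fst p) * (ch 1 (fst p) * Ut (l2_inv (lam M) Ut f) p)"
    by (simp add: Ut_def Tt_ch rt_def mult_ac)
  then show ?case using elim(1) by (simp add: Tt_ch)
qed

theorem theorem3p14:
  fixes M :: "real set"
  assumes M_meas: "M \<in> sets lebesgue" and M_sub: "M \<subseteq> {0..<1}"
    and M_disj: "M \<inter> ss ` M \<in> null_sets lebesgue"
    and M_cover: "{0..<1} - (M \<union> ss ` M) \<in> null_sets lebesgue"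
  shows
   \<comment> \<open>(1)\<close>
   "(l2_unitary (lam M) Tt \<and> l2_unitary (lam M) Ut \<and>
     (\<forall>f\<in>L2 (lam M). AE p in lam M. Ut (Tt (l2_inv (lam M) Ut f)) p = Tt (Tt f) p))
   \<comment> \<open>(2)\<close>
   \<and> (\<forall>P. l2_orth_proj (lam M) P \<longrightarrow>
        ((l2_commute (lam M) P Ut \<and> l2_commute (lam M) P Tt) \<longleftrightarrow>
         (\<exists>S. S \<in> sets (lam M) \<and> S \<subseteq> {0..<1} \<times> UNIV \<and> rt ` S = S \<and>
              (\<forall>f\<in>L2 (lam M). AE p in lam M. P f p = indicator S p * f p))))
   \<comment> \<open>(3)\<close>
   \<and> (\<forall>k::int. l2_inner (lam M) (l2_zpow (lam M) Tt k (phit M)) (phit M) = (if k = 0 then 1 else 0))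
   \<and> (AE p in lam M. Ut (phit M) p = complex_of_real (sqrt 2 * m0 M (fst p)) * phit M p)
   \<comment> \<open>(4)\<close>
   \<and> (\<forall>n. Vn M n \<subseteq> Vn M (n + 1))
   \<and> (\<forall>f\<in>L2 (lam M). \<forall>\<epsilon>>0. \<exists>n. \<exists>g\<in>Vn M n. l2_norm (lam M) (\<lambda>p. f p - g p) < \<epsilon>)
   \<and> (\<forall>f. (\<forall>n. f \<in> Vn M n) \<longrightarrow> (AE p in lam M. f p = 0))
   \<and> l2_onb_of (lam M) (\<lambda>k. l2_zpow (lam M) Tt k (phit M)) (V0 M)
   \<comment> \<open>(5)\<close>
   \<and> (AE p in lam M. psit M p = indicator (Pt M) p)
   \<and> l2_onb_of (lam M) (\<lambda>(j, k). l2_zpow (lam M) Ut j (l2_zpow (lam M) Tt k (psit M))) (L2 (lam M))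
   \<comment> \<open>(6)\<close>
   \<and> (\<forall>P psi. MRA_parseval_wavelet_set P psi \<longrightarrow>
        (let F = (\<Union>j\<in>{1::nat..}. (\<lambda>x. x / 2 ^ j) ` P) in
          (AE x in lebesgue. indicator F (2 * x) = m0 M x * indicator F x) \<longrightarrow>
          (AE x in lebesgue. (\<lambda>N. \<Prod>n\<in>{1..N}. m0 M (x / 2 ^ n)) \<longlonglongrightarrow> indicator F x) \<longrightarrow>
          (AE x in lebesgue. indicator P (2 * x) = (1 - m0 M x) * indicator F x) \<longrightarrow>
          UNIV - (\<Union>n\<in>{1::nat..}. (\<lambda>x. 2 ^ n * x) ` F) \<in> null_sets lebesgue \<longrightarrow>
          (AE x in lebesgue. x \<in> {0..<1} \<longrightarrow> AZ \<subseteq> Aset M x)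
          \<and> rt ` ({0..<1} \<times> AZ) = {0..<1} \<times> AZ
          \<and> (AE p in lam M. indicator ({0..<1} \<times> AZ) p * phit M p
                = Emb (\<lambda>x. indicator F x) p)
          \<and> (AE p in lam M. indicator ({0..<1} \<times> AZ) p * psit M p
                = Emb (\<lambda>x. indicator P x) p)))"
proof -
  interpret scaling_tile M
    by unfold_locales (fact M_meas M_sub M_disj M_cover)+
  have inner: "l2_inner (lam M) (l2_zpow (lam M) Tt k (phit M)) (phit M) = (if k = 0 then 1 else 0)" for k
  proof -
    \<comment> \<open>The power 0 is the identity, so \<open>phit M\<close> is itself the member of
      the orthonormal family with index 0.\<close>
    have "l2_inner (lam M) (l2_zpow (lam M) Tt k (phit M)) (l2_zpow (lam M) Tt 0 (phit M)) = (if k = 0 then 1 else 0)"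
      using Tt_phit_orthonormal unfolding l2_orthonormal_def by blast
    then show ?thesis by (simp add: l2_zpow_def)
  qed
  have onb: "l2_onb_of (lam M) (\<lambda>k. l2_zpow (lam M) Tt k (phit M)) (V0 M)"
    using Tt_phit_orthonormal by (simp add: l2_onb_of_def V0_def)
  show ?thesis
    unfolding Let_def
  proof (intro conjI allI ballI impI, goal_cases)
    case 1
    show ?case by (rule unitary_Tt)
  next
    case 2
    show ?case by (rule unitary_Ut)
  next
    case (3 f)
    then show ?case by (rule Ut_Tt_conjugate)
  next
    case (4 P)
    then show ?case by (rule commute_iff_indicator)
  next
    case (5 k)
    show ?case by (rule inner)
  next
    case 6
    show ?case by (rule Ut_phit)
  next
    case (7 n)
    show ?case by (rule Vn_subset)
  next
    case (8 f \<epsilon>)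
    then show ?case by (rule Vn_dense)
  next
    case (9 f)
    then show ?case by (intro Vn_Inter) blast
  next
    case 10
    show ?case by (rule onb)
  next
    case 11
    show ?case by (rule psit_AE)
  next
    case 12
    show ?case by (rule wavelet_basis[OF psit_L2 psit_AE])
  next
    case (13 P psi)
    from AE_good_orbit[OF 13(3-5)] show ?case
      by eventually_elim (use AZ_subset_Aset in blast)
  next
    case (14 P psi)
    show ?case by (rule rt_AZ)
  next
    case (15 P psi)
    show ?case by (rule phit_Emb[OF AE_good_orbit[OF 15(3-5)]])
  next
    case (16 P psi)
    show ?case by (rule psit_Emb[OF AE_good_orbit[OF 16(3-5)]])
  qed
qed

end
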